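(* Let $0<\alpha\le2$, $0<H<1$, and let $\{\Lambda_{\alpha,H}(t),t\ge0\}$ be a linear fractional stable motion with local time $L(t,x)$. Assume that $f:\mathbb{R}\to\mathbb{R}$ is such that $f$ and $f^2$ are Lebesgue integrable. Then, for each $t\ge0$ and $x\in\mathbb{R}$, $$\frac{1}{\kappa^{1-H}}\int_0^{\kappa t} f\left(\kappa^H\left(\Lambda_{\alpha,H}\left(\tfrac{s}{\kappa}\right)-x\right)\right)ds\to\left(\int_{-\infty}^\infty f(y)\,dy\right)L(t,x)\qquad\text{in }\mathbf{L}^2$$ as $\kappa\to\infty$.
   Context: An $\alpha$-stable Lévy motion $\{Z_\alpha(t),t\in\mathbb{R}\}$, $0<\alpha\le2$, has stationary independent increments, and for $s<t$, $Z_\alpha(t)-Z_\alpha(s)$ has characteristic function $\exp\{-(t-s)|u|^\alpha(1+i\beta\,\mathrm{sign}(u)\tan(\pi\alpha/2))\}$, $|\beta|\le1$, with $\beta=0$ when $\alpha=1$. For $0<H<1$, $H\neq1/\alpha$, a linear fractional stable motion (LFSM) is $$\Lambda_{\alpha,H}(t)=a\int_{-\infty}^0\{(t-u)^{H-1/\alpha}-(-u)^{H-1/\alpha}\}Z_\alpha(du)+a\int_0^t(t-u)^{H-1/\alpha}Z_\alpha(du),\quad t\ge0,$$ with $a$ a nonzero constant; for $H=1/\alpha$ (which forces $1<\alpha\le2$), by convention the LFSM is $\{Z_\alpha(t),t\ge0\}$. The LFSM is taken to be a measurable process. A local time of $\Lambda_{\alpha,H}$ is a measurable process $\{L(t,x),t\ge0,x\in\mathbb{R}\}$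 such that for each $t\ge 0$, with probability one, $\int_0^t\mathbb{I}_A(\Lambda_{\alpha,H}(s))\,ds=\int_{-\infty}^\infty\mathbb{I}_A(x)L(t,x)\,dx$ for all Borel $A\subset\mathbb{R}$. The version used here is the one for which, for each $t$ and $x$, $L(t,x)=\lim_{\eta\downarrow0}\eta^{-1}\int_0^t\mathbb{I}_{[x,x+\eta)}(\Lambda_{\alpha,H}(s))\,ds$ in $\mathbf{L}^2$. Convergence in $\mathbf{L}^2$ is mean-square convergence. *)

theory Defs
  imports "HOL-Probability.Probability"
begin

definition tendsto_in_prob ::
    "'w measure \<Rightarrow> (nat \<Rightarrow> 'w \<Rightarrow> real) \<Rightarrow> ('w \<Rightarrow> real) \<Rightarrow> bool" where
  "tendsto_in_prob M X Y \<longleftrightarrow>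
     (\<forall>\<epsilon>>0. (\<lambda>n. measure M {\<omega> \<in> space M. \<epsilon> < \<bar>X n \<omega> - Y \<omega>\<bar>}) \<longlonglongrightarrow> 0)"

definition square_integrable :: "'w measure \<Rightarrow> ('w \<Rightarrow> real) \<Rightarrow> bool" where
  "square_integrable M X \<longleftrightarrow> X \<in> borel_measurable M \<and> integrable M (\<lambda>\<omega>. (X \<omega>)\<^sup>2)"

definition tendsto_L2 ::
    "'w measure \<Rightarrow> ('i \<Rightarrow> 'w \<Rightarrow> real) \<Rightarrow> ('w \<Rightarrow> real) \<Rightarrow> 'i filter \<Rightarrow> bool" where
  "tendsto_L2 M X Y F \<longleftrightarrow>
     square_integrable M Y \<and>
     (\<forall>\<^sub>F i in F. square_integrable M (X i)) \<and>
     ((\<lambda>i. \<integral>\<omega>. (X i \<omega> - Y \<omega>)\<^sup>2 \<partial>M) \<longlongrightarrow> 0) F"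

text \<open>The normalisation \<open>Z 0 = 0\<close> almost surely is part of the notion of a Levy motion.
  Increments over finitely many consecutive intervals are required to be jointly independent.\<close>

definition stable_levy_motion ::
    "'w measure \<Rightarrow> real \<Rightarrow> real \<Rightarrow> (real \<Rightarrow> 'w \<Rightarrow> real) \<Rightarrow> bool" where
  "stable_levy_motion M \<alpha> \<beta> Z \<longleftrightarrow>
     0 < \<alpha> \<and> \<alpha> \<le> 2 \<and> \<bar>\<beta>\<bar> \<le> 1 \<and> (\<alpha> = 1 \<longrightarrow> \<beta> = 0) \<and>
     (\<forall>t. Z t \<in> borel_measurable M) \<and>
     (AE \<omega> in M. Z 0 \<omega> = 0) \<and>
     (\<forall>n (\<tau> :: nat \<Rightarrow> real). (\<forall>i<n. \<tau> i < \<tau> (Suc i)) \<longrightarrow>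
        prob_space.indep_vars M (\<lambda>_. borel) (\<lambda>i \<omega>. Z (\<tau> (Suc i)) \<omega> - Z (\<tau> i) \<omega>) {..<n}) \<and>
     (\<forall>s t h. s < t \<longrightarrow>
        distr M borel (\<lambda>\<omega>. Z (t + h) \<omega> - Z (s + h) \<omega>) = distr M borel (\<lambda>\<omega>. Z t \<omega> - Z s \<omega>)) \<and>
     (\<forall>s t u. s < t \<longrightarrow>
        char (distr M borel (\<lambda>\<omega>. Z t \<omega> - Z s \<omega>)) u =
          exp (- (complex_of_real ((t - s) * \<bar>u\<bar> powr \<alpha>) *
                  (1 + \<i> * complex_of_real (\<beta> * sgn u * tan (pi * \<alpha> / 2))))))"

text \<open>A step function is a list of triples \<open>(c, a, b)\<close>, each standing for \<open>c\<close> times the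
  indicator of the interval from \<open>a\<close> (excluded) to \<open>b\<close> (included). The integral of a
  deterministic function with respect to \<open>Z\<close> is the limit in probability of integrals of step
  functions that converge to it in the (quasi-)norm of \<open>L\<^sup>\<alpha>\<close>; it is determined up to
  null sets.\<close>

definition step_fun :: "(real \<times> real \<times> real) list \<Rightarrow> real \<Rightarrow> real" where
  "step_fun p u = (\<Sum>(c, a, b)\<leftarrow>p. c * indicator {a<..b} u)"

definition step_integral ::
    "(real \<Rightarrow> 'w \<Rightarrow> real) \<Rightarrow> (real \<times> real \<times> real) list \<Rightarrow> 'w \<Rightarrow> real" where
  "step_integral Z p \<omega> = (\<Sum>(c, a, b)\<leftarrow>p. c * (Z b \<omega> - Z a \<omega>))"

definition is_stable_integral ::
    "'w measure \<Rightarrow> real \<Rightarrow> (real \<Rightarrow> 'w \<Rightarrow> real) \<Rightarrow> (real \<Rightarrow> real) \<Rightarrow> ('w \<Rightarrow> real) \<Rightarrow> bool" where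
  "is_stable_integral M \<alpha> Z g I \<longleftrightarrow>
     g \<in> borel_measurable borel \<and> I \<in> borel_measurable M \<and>
     (\<exists>p :: nat \<Rightarrow> (real \<times> real \<times> real) list.
        (\<forall>n. \<forall>(c, a, b) \<in> set (p n). a \<le> b) \<and>
        (\<lambda>n. \<integral>\<^sup>+u. ennreal (\<bar>g u - step_fun (p n) u\<bar> powr \<alpha>) \<partial>lborel) \<longlonglongrightarrow> 0 \<and>
        tendsto_in_prob M (\<lambda>n. step_integral Z (p n)) I)"

definition measurable_process :: "'w measure \<Rightarrow> (real \<Rightarrow> 'w \<Rightarrow> real) \<Rightarrow> bool" where
  "measurable_process M X \<longleftrightarrow>
     (\<lambda>(t, \<omega>). X t \<omega>) \<in> borel_measurable (restrict_space borel {0..} \<Otimes>\<^sub>M M)"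

text \<open>Only the values at times \<open>t \<ge> 0\<close> are constrained. Since stochastic integrals are
  determined up to null sets, the defining identity is required almost surely for each \<open>t\<close>.\<close>

definition linear_fractional_stable_motion ::
    "'w measure \<Rightarrow> real \<Rightarrow> real \<Rightarrow> (real \<Rightarrow> 'w \<Rightarrow> real) \<Rightarrow> bool" where
  "linear_fractional_stable_motion M \<alpha> H \<Lambda> \<longleftrightarrow>
     measurable_process M \<Lambda> \<and>
     (\<exists>\<beta> Z. stable_levy_motion M \<alpha> \<beta> Z \<and>
        (if H = 1 / \<alpha>
         then \<forall>t\<ge>0. AE \<omega> in M. \<Lambda> t \<omega> = Z t \<omega>
         else \<exists>a. a \<noteq> 0 \<and>
           (\<forall>t\<ge>0. \<exists>I J.
              is_stable_integral M \<alpha> Z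
                (\<lambda>u. indicator {..<0} u * ((t - u) powr (H - 1 / \<alpha>) - (- u) powr (H - 1 / \<alpha>))) I \<and>
              is_stable_integral M \<alpha> Z
                (\<lambda>u. indicator {0<..<t} u * (t - u) powr (H - 1 / \<alpha>)) J \<and>
              (AE \<omega> in M. \<Lambda> t \<omega> = a * I \<omega> + a * J \<omega>))))"

definition local_time ::
    "'w measure \<Rightarrow> (real \<Rightarrow> 'w \<Rightarrow> real) \<Rightarrow> (real \<Rightarrow> real \<Rightarrow> 'w \<Rightarrow> real) \<Rightarrow> bool" where
  "local_time M \<Lambda> L \<longleftrightarrow>
     (\<lambda>((t, x), \<omega>). L t x \<omega>)
       \<in> borel_measurable ((restrict_space borel {0..} \<Otimes>\<^sub>M borel) \<Otimes>\<^sub>M M) \<and>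
     (\<forall>t\<ge>0. AE \<omega> in M.
        integrable lborel (\<lambda>x. L t x \<omega>) \<and>
        (\<forall>A \<in> sets borel.
           (LINT s:{0..t}|lborel. indicator A (\<Lambda> s \<omega>)) =
           (LINT x|lborel. indicator A x * L t x \<omega>)))"

definition L2_version ::
    "'w measure \<Rightarrow> (real \<Rightarrow> 'w \<Rightarrow> real) \<Rightarrow> (real \<Rightarrow> real \<Rightarrow> 'w \<Rightarrow> real) \<Rightarrow> bool" where
  "L2_version M \<Lambda> L \<longleftrightarrow>
     (\<forall>t\<ge>0. \<forall>x. tendsto_L2 M
        (\<lambda>\<eta> \<omega>. 1 / \<eta> * (LINT s:{0..t}|lborel. indicator {x..<x + \<eta>} (\<Lambda> s \<omega>)))
        (L t x) (at_right 0))"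

end

theory Submission
  imports Defs
begin

text \<open>
  Write \<open>Y\<close> for the linear fractional stable motion. The part of \<open>Y u\<close> driven by the increments
  of \<open>Z\<close> over \<open>(s, u]\<close> is a stable variable of scale \<open>(u - s)\<^sup>H\<close> that is independent of the past,
  so \<open>|E (1\<^sub>A (Y s) exp (i \<xi> Y u))|\<close> is at most \<open>P (Y s \<in> A) exp (- c |(u - s)\<^sup>H \<xi>|\<^sup>\<alpha>)\<close>. By Fourier
  inversion the conditional law of \<open>Y u\<close> given \<open>Y s \<in> A\<close> then has a density bounded by a multiple of
  \<open>(u - s)\<^sup>-\<^sup>H\<close> and Lipschitz with a constant of order \<open>(u - s)\<^sup>-\<^sup>2\<^sup>H\<close>. Since \<open>H < 1\<close>, the first bound
  makes \<open>f \<mapsto> \<integral>\<^sub>0\<^sup>t f (Y s) ds\<close> a bounded map from \<open>L\<^sup>1(\<real>)\<close> to \<open>L\<^sup>2(P)\<close>, and the second shows that the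
  averages over \<open>[x - \<eta>, x)\<close> have the same limit \<open>L t x\<close> as those over \<open>[x, x + \<eta>)\<close>. Rescaling time
  replaces \<open>f\<close> by \<open>f\<^sub>\<kappa>(y) = \<kappa>\<^sup>H f (\<kappa>\<^sup>H (y - x))\<close>, which has the same \<open>L\<^sup>1\<close> norm as \<open>f\<close>; the limit is
  known for indicators of intervals and extends to all of \<open>L\<^sup>1\<close> by density.
\<close>

section \<open>Fourier inversion bounds\<close>

text \<open>Three obstacles shape the proof. The local time is tied only to averages over [x, x +
  \<eta>), whereas a test function also has mass to the left of \<open>x\<close>; hence the
  comparison of adjacent intervals. The Lipschitz constant of order (u - s)^(-2H) is not integrable
  in time once H \<ge> 1/2, so it is interpolated with the density bound: adjacent intervals of
  length e differ by order (e / (u - s)^H)^(1 + \<theta>), and \<theta> > 0 is taken so small that H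
  (1 + \<theta>) < 1. Any positive \<theta> will do, because averaging divides second moments by e^2
  only. Finally, \<open>f\<close> is merely Lebesgue measurable, so its composition with a path need
  not be Borel; it is replaced by a Borel version, which is legitimate because almost every path
  spends no time in a given null set. This is also why the conclusion lives on the completed
  probability space. The exponential exp (- c |w|^\<alpha>) enters only through a bound K / (1 +
  w^2)^2, whose integrals are elementary, so that all \<alpha> are treated at once.\<close>

lemma norm_integral_le_integral:
  fixes f :: "'a \<Rightarrow> 'b::{banach, second_countable_topology}"
  assumes "integrable M f" "integrable M g" "\<And>x. norm (f x) \<le> g x"
  shows "norm (\<integral>x. f x \<partial>M) \<le> (\<integral>x. g x \<partial>M)"
  using assms by (intro order_trans[OF integral_norm_bound integral_mono]) auto

text \<open>Levy's inversion formula gives a limit of integrals over (-n, n). The difference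
  quotient of the exponentials is bounded by b - a, so (b - a) times the majorant \<open>g\<close>
  lets dominated convergence turn that limit into an integral over the line.\<close>

lemma (in real_distribution) measure_Ioc_eq_char_integral:
  fixes g :: "real \<Rightarrow> real"
  assumes "integrable lborel g" and char_le: "\<And>t. cmod (char M t) \<le> g t"
    and "a \<le> b" "measure M {a} = 0" "measure M {b} = 0"
  shows "integrable lborel (\<lambda>t. (iexp (-(t * a)) - iexp (-(t * b))) / (\<i> * t) * char M t)"
    and "measure M {a<..b} =
      1 / (2 * pi) * (CLINT t|lborel. (iexp (-(t * a)) - iexp (-(t * b))) / (\<i> * t) * char M t)"
proof -
  define F where "F t = (iexp (-(t * a)) - iexp (-(t * b))) / (\<i> * complex_of_real t) * char M t" for t :: real
  have g0: "0 \<le> g t" for t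
    using norm_ge_zero char_le order_trans by blast
  have F_le: "norm (F t) \<le> (b - a) * g t" for t
  proof (cases "t = 0")
    case True then show ?thesis using g0 \<open>a \<le> b\<close> by (simp add: F_def)
  next
    case False
    \<comment> \<open>The endpoints are negated and exchanged to match the sign convention of
      \<open>Levy_Inversion_aux2\<close>.\<close>
    have "norm (F t) = cmod ((iexp (t * -a) - iexp (t * -b)) / (\<i> * t)) * cmod (char M t)"
      unfolding F_def norm_mult by simp
    also have "\<dots> \<le> (b - a) * g t"
      using Levy_Inversion_aux2[of "-b" "-a" t] False \<open>a \<le> b\<close> char_le
      by (intro mult_mono) (auto simp: g0)
    finally show ?thesis .
  qed
  have [measurable]: "F \<in> borel_measurable lborel"
    unfolding F_def by measurable
  have int: "integrable lborel (\<lambda>t. (b - a) * g t)"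
    using assms by simp
  show "integrable lborel (\<lambda>t. (iexp (-(t * a)) - iexp (-(t * b))) / (\<i> * t) * char M t)"
    unfolding F_def[symmetric]
    by (rule Bochner_Integration.integrable_bound[OF int]) (auto intro: order_trans[OF F_le abs_ge_self])
  have "(\<lambda>n. CLINT t|lborel. indicator {- real n<..<real n} t *\<^sub>R F t) \<longlonglongrightarrow> (CLINT t|lborel. F t)"
  proof (rule integral_dominated_convergence[OF _ _ int])
    show "AE t in lborel. (\<lambda>n. indicator {- real n<..<real n} t *\<^sub>R F t) \<longlonglongrightarrow> F t"
    proof (intro AE_I2)
      fix t :: real
      obtain N where N: "\<bar>t\<bar> < real N" using reals_Archimedean2 by blast
      have "\<forall>\<^sub>F n in sequentially. indicator {- real n<..<real n} t *\<^sub>R F t = F t"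
        using eventually_ge_at_top[of N] by eventually_elim (use N in \<open>auto simp: indicator_def abs_less_iff\<close>)
      then show "(\<lambda>n. indicator {- real n<..<real n} t *\<^sub>R F t) \<longlonglongrightarrow> F t"
        by (simp add: tendsto_eventually)
    qed
    show "AE t in lborel. norm (indicator {- real n<..<real n} t *\<^sub>R F t) \<le> (b - a) * g t" for n
      using F_le g0 \<open>a \<le> b\<close> by (auto split: split_indicator)
  qed auto
  moreover have "(CLBINT t=-real n..real n. F t) = (CLINT t|lborel. indicator {- real n<..<real n} t *\<^sub>R F t)" for n
    by (simp add: interval_lebesgue_integral_def set_lebesgue_integral_def)
  ultimately have "(\<lambda>n. 1 / (2 * pi) * (CLBINT t=-real n..real n. F t)) \<longlonglongrightarrow> 1 / (2 * pi) * (CLINT t|lborel. F t)"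
    by (intro tendsto_intros) simp
  moreover have "(\<lambda>n. 1 / (2 * pi) * (CLBINT t=-real n..real n. F t)) \<longlonglongrightarrow> measure M {a<..b}"
    using Levy_Inversion[of a b] assms by (simp add: F_def)
  ultimately show "measure M {a<..b} =
      1 / (2 * pi) * (CLINT t|lborel. (iexp (-(t * a)) - iexp (-(t * b))) / (\<i> * t) * char M t)"
    unfolding F_def[symmetric] using LIMSEQ_unique by blast
qed

lemma integrable_inverse_1_plus_square_lborel: "integrable lborel (\<lambda>t::real. 1 / (1 + t\<^sup>2))"
  and integral_inverse_1_plus_square_lborel: "(LINT t|lborel. 1 / (1 + t\<^sup>2)) = pi"
  using integrable_inverse_1_plus_square LBINT_inverse_1_plus_square
  by (simp_all add: set_integrable_def interval_lebesgue_integral_def set_lebesgue_integral_def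
      einterval_def divide_inverse)

lemma integrable_inverse_1_plus_scaled_square: "d > 0 \<Longrightarrow> integrable lborel (\<lambda>t::real. 1 / (1 + (d * t)\<^sup>2))"
  and integral_inverse_1_plus_scaled_square: "d > 0 \<Longrightarrow> (LINT t|lborel. 1 / (1 + (d * t)\<^sup>2)) = pi / d"
  using lborel_integrable_real_affine[OF integrable_inverse_1_plus_square_lborel, of d 0]
    lborel_integral_real_affine[of d "\<lambda>t. 1 / (1 + t\<^sup>2)" 0]
  by (simp_all add: integral_inverse_1_plus_square_lborel field_simps)

section \<open>Laws with a rationally decaying characteristic function\<close>

text \<open>The denominator is squared to have one power to spare: one factor 1 + (d t)^2 absorbs
  the |t| produced by second differences, and the other has the reciprocal integral pi / d.\<close>

locale char_decay = real_distribution +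
  fixes K d :: real
  assumes d_pos: "0 < d" and char_le: "\<And>t. cmod (char M t) \<le> K / (1 + (d * t)\<^sup>2)\<^sup>2"
begin

lemma K_ge_1: "1 \<le> K"
  using char_le[of 0] by (simp add: char_zero)

lemma char_le': "cmod (char M t) \<le> K * (1 / (1 + (d * t)\<^sup>2))"
proof -
  have "0 < 1 + (d * t)\<^sup>2" by (simp add: add_pos_nonneg)
  then have "K / (1 + (d * t)\<^sup>2)\<^sup>2 \<le> K / (1 + (d * t)\<^sup>2)"
    using K_ge_1 self_le_power[of "1 + (d * t)\<^sup>2" 2] by (intro divide_left_mono) auto
  then show ?thesis using char_le[of t] by simp
qed

lemmas measure_Ioc_eq = measure_Ioc_eq_char_integral
  [OF integrable_mult_right[OF integrable_inverse_1_plus_scaled_square[OF d_pos], of K] char_le']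

text \<open>Integrating the majorant and dividing by 2 pi gives K (b - a) / (2 d); the factor 1/2 is
  given away for a simpler constant.\<close>

lemma measure_Ioc_le_if_no_atoms:
  assumes "a \<le> b" "measure M {a} = 0" "measure M {b} = 0"
  shows "measure M {a<..b} \<le> K * (b - a) / d"
proof -
  let ?F = "\<lambda>t. (iexp (-(t * a)) - iexp (-(t * b))) / (\<i> * t) * char M t"
  have "norm (?F t) \<le> (b - a) * (K * (1 / (1 + (d * t)\<^sup>2)))" for t
  proof (cases "t = 0")
    case True then show ?thesis using K_ge_1 \<open>a \<le> b\<close> by simp
  next
    case False
    have "norm (?F t) = cmod ((iexp (t * -a) - iexp (t * -b)) / (\<i> * t)) * cmod (char M t)"
      unfolding norm_mult by simp
    also have "\<dots> \<le> (b - a) * (K * (1 / (1 + (d * t)\<^sup>2)))"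
      using Levy_Inversion_aux2[of "-b" "-a" t] False \<open>a \<le> b\<close> char_le'[of t]
      by (intro mult_mono) auto
    finally show ?thesis .
  qed
  then have "norm (CLINT t|lborel. ?F t) \<le> (LINT t|lborel. (b - a) * (K * (1 / (1 + (d * t)\<^sup>2))))"
    by (intro norm_integral_le_integral measure_Ioc_eq(1) assms integrable_mult_right
        integrable_inverse_1_plus_scaled_square d_pos)
  also have "\<dots> = (b - a) * (K * (pi / d))"
    using d_pos by (simp only: integral_mult_right_zero integral_inverse_1_plus_scaled_square)
  finally have *: "norm (CLINT t|lborel. ?F t) \<le> (b - a) * (K * (pi / d))" .
  have "measure M {a<..b} = norm (complex_of_real (measure M {a<..b}))" by simp
  also have "\<dots> = 1 / (2 * pi) * norm (CLINT t|lborel. ?F t)"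
    unfolding measure_Ioc_eq(2)[OF assms] by (simp add: norm_mult norm_divide)
  also have "\<dots> \<le> 1 / (2 * pi) * ((b - a) * (K * (pi / d)))"
    using * by (intro mult_left_mono) auto
  also have "\<dots> = 1 / 2 * (K * (b - a) / d)" by simp
  also have "\<dots> \<le> 1 * (K * (b - a) / d)"
    using K_ge_1 d_pos \<open>a \<le> b\<close> by (intro mult_right_mono) auto
  finally show ?thesis by simp
qed

text \<open>The inversion formula needs endpoints without mass. They are dense because atoms are
  countable and an interval is not.\<close>

lemma exists_nonatom:
  assumes "x < y" shows "\<exists>z. x < z \<and> z < y \<and> measure M {z} = 0"
proof (rule ccontr)
  assume *: "\<nexists>z. x < z \<and> z < y \<and> measure M {z} = 0"
  have "{x<..<y} \<subseteq> {z. measure M {z} > 0}"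
  proof
    fix z assume "z \<in> {x<..<y}"
    then have "measure M {z} \<noteq> 0" using * by auto
    then show "z \<in> {z. measure M {z} > 0}" by (simp add: zero_less_measure_iff)
  qed
  then have "countable {x<..<y}" using countable_atoms countable_subset by blast
  then show False using uncountable_open_interval[of x y] assms by simp
qed

lemma measure_Ioc_le:
  assumes "a \<le> b" shows "measure M {a<..b} \<le> K * (b - a) / d"
proof (rule field_le_epsilon)
  fix e :: real assume "e > 0"
  \<comment> \<open>Moving both endpoints outwards by at most \<open>h\<close> raises the bound by
    at most 2 K h / d = e.\<close>
  define h where "h = e * d / (2 * K)"
  have "h > 0" using \<open>e > 0\<close> d_pos K_ge_1 by (simp add: h_def)
  obtain a' where a': "a - h < a'" "a' < a" "measure M {a'} = 0"
    using exists_nonatom[of "a - h" a] \<open>h > 0\<close> by auto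
  obtain b' where b': "b < b'" "b' < b + h" "measure M {b'} = 0"
    using exists_nonatom[of b "b + h"] \<open>h > 0\<close> by auto
  have "measure M {a<..b} \<le> measure M {a'<..b'}"
    using a' b' by (intro finite_measure_mono) auto
  also have "\<dots> \<le> K * (b' - a') / d"
    using a' b' assms by (intro measure_Ioc_le_if_no_atoms) auto
  also have "\<dots> \<le> K * (b - a + 2 * h) / d"
    using a' b' K_ge_1 d_pos by (intro divide_right_mono mult_left_mono) auto
  also have "\<dots> = K * (b - a) / d + e"
    using K_ge_1 d_pos by (simp add: h_def field_simps)
  finally show "measure M {a<..b} \<le> K * (b - a) / d + e" .
qed

lemma measure_singleton: "measure M {x} = 0"
proof -
  have "measure M {x} \<le> 0 + e" if "e > 0" for e
  proof -
    have "measure M {x} \<le> measure M {x - e * d / K<..x}"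
      using that d_pos K_ge_1 by (intro finite_measure_mono) auto
    also have "\<dots> \<le> K * (x - (x - e * d / K)) / d"
      using that d_pos K_ge_1 by (intro measure_Ioc_le) auto
    also have "\<dots> = e" using d_pos K_ge_1 by simp
    finally show ?thesis by simp
  qed
  then have "measure M {x} \<le> 0" by (rule field_le_epsilon)
  then show ?thesis using measure_nonneg[of M "{x}"] by linarith
qed

text \<open>Subtracting the two inversion integrals leaves the second difference
  \<open>iexp (t * e) + iexp (-(t * e)) - 2\<close>, of modulus 4 sin^2 (t e / 2) \<le> t^2 e^2. The
  gain is a second power of \<open>e\<close>; the price, after division by t, is a factor
  |t|.\<close>

lemma adjacent_Ioc_difference_le:
  assumes "0 \<le> e"
  shows "\<bar>measure M {x - e<..x} - measure M {x<..x + e}\<bar> \<le> K * e\<^sup>2 / d\<^sup>2"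
proof -
  let ?F = "\<lambda>a b t. (iexp (-(t * a)) - iexp (-(t * b))) / (\<i> * complex_of_real t) * char M t"
  let ?D = "\<lambda>t. ?F (x - e) x t - ?F x (x + e) t"
  note eq = measure_Ioc_eq[OF _ measure_singleton measure_singleton]
  have le: "norm (?D t) \<le> e\<^sup>2 * (K / d * (1 / (1 + (d * t)\<^sup>2)))" for t
  proof (cases "t = 0")
    case True then show ?thesis using K_ge_1 d_pos by simp
  next
    case False
    have D: "?D t = iexp (-(t * x)) * (iexp (t * e) + iexp (-(t * e)) - 2) / (\<i> * t) * char M t"
    proof -
      have "iexp (-(t * (x - e))) = iexp (-(t * x)) * iexp (t * e)"
        "iexp (-(t * (x + e))) = iexp (-(t * x)) * iexp (-(t * e))"
        by (simp_all add: exp_add[symmetric] algebra_simps)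
      then show ?thesis
        by (simp only:) (simp add: diff_divide_distrib add_divide_distrib algebra_simps)
    qed
    have "iexp (t * e) + iexp (-(t * e)) - 2 = of_real (2 * cos (t * e) - 2)"
      by (simp add: complex_eq_iff cis.sel flip: cis_conv_exp of_real_mult of_real_minus)
    then have "cmod (iexp (t * e) + iexp (-(t * e)) - 2) = \<bar>2 * cos (t * e) - 2\<bar>"
      by (simp only: norm_of_real)
    also have "\<dots> = 4 * (sin (t * e / 2))\<^sup>2"
      using cos_double_sin[of "t * e / 2"] by simp
    also have "\<dots> \<le> 4 * (t * e / 2)\<^sup>2"
      using abs_le_square_iff[THEN iffD1, OF abs_sin_x_le_abs_x[of "t * e / 2"]] by linarith
    also have "\<dots> = t\<^sup>2 * e\<^sup>2" by (simp add: power2_eq_square)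
    finally have c: "cmod (iexp (t * e) + iexp (-(t * e)) - 2) \<le> t\<^sup>2 * e\<^sup>2" .
    have "norm (?D t) = cmod (iexp (t * e) + iexp (-(t * e)) - 2) / \<bar>t\<bar> * cmod (char M t)"
      unfolding D by (simp add: norm_mult norm_divide)
    also have "\<dots> \<le> t\<^sup>2 * e\<^sup>2 / \<bar>t\<bar> * (K / (1 + (d * t)\<^sup>2)\<^sup>2)"
      using c char_le by (intro mult_mono divide_right_mono) auto
    also have "\<dots> = e\<^sup>2 * (K * (\<bar>t\<bar> / (1 + (d * t)\<^sup>2)\<^sup>2))"
    proof -
      have "t\<^sup>2 * e\<^sup>2 / \<bar>t\<bar> = (\<bar>t\<bar> * \<bar>t\<bar>) * e\<^sup>2 / \<bar>t\<bar>"
        by (simp only: abs_mult_self_eq power2_eq_square)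
      also have "\<dots> = e\<^sup>2 * \<bar>t\<bar>" using False by (simp del: abs_mult_self_eq)
      finally have "t\<^sup>2 * e\<^sup>2 / \<bar>t\<bar> = e\<^sup>2 * \<bar>t\<bar>" .
      then show ?thesis by simp
    qed
    \<comment> \<open>The inequality d |t| \<le> 1 + (d t)^2 trades one power of the denominator for
      |t|.\<close>
    also have "\<bar>t\<bar> / (1 + (d * t)\<^sup>2)\<^sup>2 \<le> 1 / d * (1 / (1 + (d * t)\<^sup>2))"
    proof -
      have "2 * \<bar>d * t\<bar> \<le> 1 + (d * t)\<^sup>2"
        using sum_squares_bound[of 1 "\<bar>d * t\<bar>"] by simp
      moreover have "0 \<le> d * \<bar>t\<bar>" using d_pos by simp
      moreover have "\<bar>d * t\<bar> = d * \<bar>t\<bar>" using d_pos by (simp add: abs_mult)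
      ultimately have "d * \<bar>t\<bar> \<le> 1 + (d * t)\<^sup>2" by linarith
      then have "d * \<bar>t\<bar> / (1 + (d * t)\<^sup>2)\<^sup>2 \<le> (1 + (d * t)\<^sup>2) / (1 + (d * t)\<^sup>2)\<^sup>2"
        by (intro divide_right_mono) auto
      also have "\<dots> = 1 / (1 + (d * t)\<^sup>2)"
        by (simp add: power2_eq_square)
      finally have "d * \<bar>t\<bar> / (1 + (d * t)\<^sup>2)\<^sup>2 / d \<le> 1 / (1 + (d * t)\<^sup>2) / d"
        using d_pos by (intro divide_right_mono) auto
      then show ?thesis using d_pos by (simp add: mult.commute)
    qed
    finally show ?thesis
      using K_ge_1 by (simp add: mult_left_mono)
  qed
  have int: "integrable lborel (?F (x - e) x)" "integrable lborel (?F x (x + e))"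
    using eq(1)[of "x - e" x] eq(1)[of x "x + e"] assms by auto
  have "norm (CLINT t|lborel. ?D t) \<le> (LINT t|lborel. e\<^sup>2 * (K / d * (1 / (1 + (d * t)\<^sup>2))))"
    using int le by (intro norm_integral_le_integral Bochner_Integration.integrable_diff integrable_mult_right
        integrable_inverse_1_plus_scaled_square d_pos)
  also have "\<dots> = e\<^sup>2 * (K / d * (pi / d))"
    using d_pos by (simp only: integral_mult_right_zero integral_inverse_1_plus_scaled_square)
  finally have *: "norm (CLINT t|lborel. ?D t) \<le> e\<^sup>2 * (K / d * (pi / d))" .
  have "complex_of_real (measure M {x - e<..x} - measure M {x<..x + e}) = 1 / (2 * pi) * (CLINT t|lborel. ?D t)"
    using eq(2)[of "x - e" x] eq(2)[of x "x + e"] assms int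
    by (simp only: Bochner_Integration.integral_diff of_real_diff right_diff_distrib)
  then have "norm (complex_of_real (measure M {x - e<..x} - measure M {x<..x + e})) = 1 / (2 * pi) * norm (CLINT t|lborel. ?D t)"
    by (simp only: norm_mult) (simp add: norm_divide)
  also have "\<dots> \<le> 1 / (2 * pi) * (e\<^sup>2 * (K / d * (pi / d)))"
    using * by (intro mult_left_mono) auto
  also have "\<dots> = 1 / 2 * (K * e\<^sup>2 / d\<^sup>2)" by (simp add: power2_eq_square)
  also have "\<dots> \<le> 1 * (K * e\<^sup>2 / d\<^sup>2)"
    using K_ge_1 d_pos by (intro mult_right_mono) auto
  finally show ?thesis by (simp only: norm_of_real mult_1)
qed

text \<open>Inversion produces intervals (a, b], while local time averages use [a, b); without atoms
  the two agree.\<close>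

lemma measure_Ico_eq_Ioc: "measure M {a..<b} = measure M {a<..b}"
proof (cases "a < b")
  case True
  have "measure M {a..<b} = measure M ({a} \<union> {a<..<b})" "measure M {a<..b} = measure M ({a<..<b} \<union> {b})"
    using True by (auto intro!: arg_cong[where f="measure M"])
  then show ?thesis
    by (subst (asm) finite_measure_Union; subst (asm) finite_measure_Union) (auto simp: measure_singleton)
qed auto

lemma adjacent_Ico_difference_le:
  "0 \<le> e \<Longrightarrow> \<bar>measure M {x - e..<x} - measure M {x..<x + e}\<bar> \<le> K * e\<^sup>2 / d\<^sup>2"
  using adjacent_Ioc_difference_le by (simp add: measure_Ico_eq_Ioc)

end

section \<open>Comparison with Lebesgue measure\<close>

text \<open>The difference \<open>c \<lambda> - N\<close> is realised as the Stieltjes measure of \<open>c x - cdf N x\<close>, so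
  that the comparison reduces to the uniqueness of a measure given on half-open intervals.\<close>

lemma (in finite_borel_measure) emeasure_le_lborel_if_Ioc_le:
  assumes "0 \<le> c" and Ioc_le: "\<And>a b. a \<le> b \<Longrightarrow> measure M {a<..b} \<le> c * (b - a)"
    and "B \<in> sets borel"
  shows "emeasure M B \<le> ennreal c * emeasure lborel B"
proof -
  define F where "F x = c * x - cdf M x" for x
  have F_diff: "F b - F a = c * (b - a) - measure M {a<..b}" if "a \<le> b" for a b
    using that emeasure_Ioc[of a b] cdf_nondecreasing[of a b]
    by (simp add: F_def algebra_simps emeasure_eq_measure)
  then have mono_F: "F a \<le> F b" if "a \<le> b" for a b
    using Ioc_le[OF that] that by (metis diff_ge_0_iff_ge)
  have cont_F: "continuous (at_right a) F" for a
    unfolding F_def by (intro continuous_intros cdf_is_right_cont)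
  let ?R = "interval_measure F"
  define N where "N = measure_of UNIV (sets borel) (\<lambda>A. emeasure M A + emeasure ?R A)"
  have sets_N: "sets N = sets borel"
    unfolding N_def by (metis sets.sets_measure_of_eq space_borel)
  have emeasure_N: "emeasure N A = emeasure M A + emeasure ?R A" if "A \<in> sets borel" for A
    unfolding N_def
  proof (rule emeasure_measure_of_sigma)
    show "sigma_algebra UNIV (sets (borel :: real measure))"
      by (metis sets.sigma_algebra_axioms space_borel)
    show "countably_additive (sets borel) (\<lambda>A. emeasure M A + emeasure ?R A)"
      unfolding countably_additive_def
      by (simp add: suminf_add[symmetric] suminf_emeasure M_is_borel)
  qed (use that in \<open>auto simp: positive_def\<close>)
  have "density lborel (\<lambda>_. ennreal c) = N"
  proof (rule measure_eqI_generator_eq[where \<Omega>=UNIV])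
    show "(\<Union>i. {- real (i::nat)<..real i}) = UNIV"
      by (rule UN_Ioc_eq_UNIV)
    fix X assume "X \<in> range (\<lambda>(a, b). {a<..b::real})"
    then obtain a b where X: "X = {a<..b}" by auto
    show "emeasure (density lborel (\<lambda>_. ennreal c)) X = emeasure N X"
    proof (cases "a \<le> b")
      case True
      have "emeasure N X = ennreal (measure M {a<..b}) + ennreal (F b - F a)"
        using True mono_F cont_F by (simp add: X emeasure_N emeasure_interval_measure_Ioc emeasure_eq_measure)
      also have "\<dots> = ennreal (c * (b - a))"
        using True F_diff Ioc_le[OF True] by (simp flip: ennreal_plus)
      finally show ?thesis
        using True \<open>0 \<le> c\<close> by (simp add: X emeasure_density_const ennreal_mult')
    qed (simp add: X)
  next
    show "emeasure (density lborel (\<lambda>_. ennreal c)) {- real (i::nat)<..real i} \<noteq> \<infinity>" for i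
      by (simp add: emeasure_density_const ennreal_mult_eq_top_iff)
  qed (auto simp: Int_stable_def borel_sigma_sets_Ioc sets_N)
  then have "emeasure N B = ennreal c * emeasure lborel B"
    using emeasure_density_const[of B lborel "ennreal c"] assms by auto
  then show ?thesis
    using emeasure_N[OF \<open>B \<in> sets borel\<close>] by (metis le_iff_add)
qed

text \<open>The hypothesis says that \<open>N\<close> lies below \<open>scale_measure c M\<close> in
  the order on measures, along which nonnegative integrals are monotone.\<close>

lemma nn_integral_le_if_emeasure_le:
  assumes "sets N = sets M" and "\<And>A. A \<in> sets M \<Longrightarrow> emeasure N A \<le> c * emeasure M A"
    and "f \<in> borel_measurable M"
  shows "(\<integral>\<^sup>+x. f x \<partial>N) \<le> c * (\<integral>\<^sup>+x. f x \<partial>M)"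
proof -
  have "N \<le> scale_measure c M"
    using assms by (auto simp: le_measure)
  then have "(\<integral>\<^sup>+x. f x \<partial>N) \<le> (\<integral>\<^sup>+x. f x \<partial>scale_measure c M)"
    using assms by (intro nn_integral_mono_measure) auto
  then show ?thesis using assms by (simp add: nn_integral_scale_measure)
qed

section \<open>Density of step functions among integrable functions\<close>

text \<open>As an induction rule, density lets a property be checked on intervals alone. Borel sets
  come in by Dynkin's argument, run inside windows (-n, n] so that complements remain
  integrable.\<close>

theorem integrable_lborel_Ioc_induct [consumes 1, case_names Ioc linear lim]:
  fixes f :: "real \<Rightarrow> real"
  assumes "integrable lborel f"
    and Ioc: "\<And>a b. a < b \<Longrightarrow> P (indicator {a<..b})"
    and linear: "\<And>c f g. integrable lborel f \<Longrightarrow> P f \<Longrightarrow> integrable lborel g \<Longrightarrow> P g \<Longrightarrow>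
      P (\<lambda>x. c * f x + g x)"
    and lim: "\<And>f. integrable lborel f \<Longrightarrow>
      (\<And>e. 0 < e \<Longrightarrow> \<exists>g. integrable lborel g \<and> P g \<and> (LINT x|lborel. \<bar>f x - g x\<bar>) < e) \<Longrightarrow> P f"
  shows "P f"
proof -
  \<comment> \<open>Pointwise convergence under an integrable majorant implies L1 convergence; every
    limit below is taken in this form.\<close>
  have lim_dominated: "P f"
    if int: "integrable lborel f" "\<And>i. integrable lborel (s i)" "integrable lborel w"
      and P: "\<And>i. P (s i)" and conv: "\<And>x. (\<lambda>i. s i x) \<longlonglongrightarrow> f x"
      and w: "\<And>i x. \<bar>s i x\<bar> \<le> w x" "\<And>x. \<bar>f x\<bar> \<le> w x"
    for f w :: "real \<Rightarrow> real" and s :: "nat \<Rightarrow> real \<Rightarrow> real"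
  proof (rule lim[OF int(1)])
    fix e :: real assume "e > 0"
    have [measurable]: "f \<in> borel_measurable borel" "s i \<in> borel_measurable borel" for i
      using borel_measurable_integrable[OF int(1)] borel_measurable_integrable[OF int(2)[of i]] by auto
    have "(\<lambda>i. LINT x|lborel. \<bar>f x - s i x\<bar>) \<longlonglongrightarrow> (LINT x::real|lborel. 0 :: real)"
    proof (rule integral_dominated_convergence[where w="\<lambda>x. 2 * w x"])
      show "integrable lborel (\<lambda>x. 2 * w x)" using int by simp
      show "AE x in lborel. (\<lambda>i. \<bar>f x - s i x\<bar>) \<longlonglongrightarrow> 0"
        using conv by (intro AE_I2 tendsto_rabs_zero) (auto intro: LIM_zero_cancel simp: LIM_zero_iff intro!: tendsto_eq_intros)
      show "AE x in lborel. norm \<bar>f x - s i x\<bar> \<le> 2 * w x" for i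
      proof (intro AE_I2)
        fix x show "norm \<bar>f x - s i x\<bar> \<le> 2 * w x"
          using w(1)[of i x] w(2)[of x] by simp
      qed
    qed auto
    then have "\<forall>\<^sub>F i in sequentially. (LINT x|lborel. \<bar>f x - s i x\<bar>) < e"
      using \<open>e > 0\<close> by (intro order_tendstoD(2)) auto
    then obtain i where "(LINT x|lborel. \<bar>f x - s i x\<bar>) < e"
      by (auto simp: eventually_sequentially)
    then show "\<exists>g. integrable lborel g \<and> P g \<and> (LINT x|lborel. \<bar>f x - g x\<bar>) < e"
      using int P by blast
  qed
  \<comment> \<open>The zero function has no case of its own; it is an indicator plus -1 times the
    same indicator.\<close>
  have P0: "P (\<lambda>x. 0)"
  proof -
    have "integrable lborel (indicator {0<..1} :: real \<Rightarrow> real)"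
      by (simp add: integrable_indicator_iff)
    from linear[OF this Ioc this Ioc, of "-1"] show ?thesis by simp
  qed
  have P_empty: "P (indicator {})"
  proof -
    have "(indicator {} :: real \<Rightarrow> real) = (\<lambda>x. 0)" by auto
    then show ?thesis using P0 by simp
  qed
  have P_bounded: "P (indicator (A \<inter> {-real n<..real n}))" if "A \<in> sets borel" for A and n :: nat
  proof -
    let ?I = "{-real n<..real n}"
    have int: "integrable lborel (indicator (A \<inter> ?I) :: real \<Rightarrow> real)" if "A \<in> sets borel" for A
    proof -
      have "emeasure lborel (A \<inter> ?I) \<le> emeasure lborel ?I"
        by (intro emeasure_mono) auto
      then have "emeasure lborel (A \<inter> ?I) < \<infinity>"
        by (auto simp: less_top[symmetric] top_unique)
      then show ?thesis using that by (simp add: integrable_indicator_iff)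
    qed
    have *: "sets (borel::real measure) = sigma_sets UNIV (range (\<lambda>(a, b). {a <.. b::real}))"
      by (simp add: borel_sigma_sets_Ioc)
    have "Int_stable (range (\<lambda>(a, b). {a <.. b::real}))"
      by (auto simp: Int_stable_def)
    moreover have "range (\<lambda>(a, b). {a <.. b::real}) \<subseteq> Pow UNIV" by simp
    moreover have "A \<in> sigma_sets UNIV (range (\<lambda>(a, b). {a <.. b::real}))"
      using that * by simp
    ultimately show ?thesis
    proof (induction A rule: sigma_sets_induct_disjoint)
      case (basic A)
      then obtain a b where "A = {a<..b}" by auto
      then have "A \<inter> ?I = {max a (-real n)<..min b (real n)}" by auto
      then show ?case
        using Ioc[of "max a (-real n)" "min b (real n)"] P_empty P0
        by (cases "max a (-real n) < min b (real n)") simp_all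
    next
      case empty
      then show ?case using P0 P_empty by simp
    next
      case (compl A)
      have "P (indicator (UNIV \<inter> ?I))"
        using Ioc[of "-real n" "real n"] P0 P_empty by (cases n) auto
      then have "P (\<lambda>x. (-1) * indicator (A \<inter> ?I) x + indicator (UNIV \<inter> ?I) x)"
        using compl by (intro linear int) (simp_all flip: *)
      also have "(\<lambda>x. (-1) * indicator (A \<inter> ?I) x + indicator (UNIV \<inter> ?I) x) = (indicator ((UNIV - A) \<inter> ?I) :: real \<Rightarrow> real)"
        by (auto simp: fun_eq_iff indicator_def)
      finally show ?case .
    next
      case (union A)
      then have A: "A i \<in> sets borel" for i unfolding * by blast
      let ?s = "\<lambda>m. indicator ((\<Union>i<m. A i) \<inter> ?I) :: real \<Rightarrow> real"
      have P_s: "P (?s m)" for m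
      proof (induction m)
        case 0 then show ?case using P0 P_empty by simp
      next
        case (Suc m)
        have "P (\<lambda>x. 1 * ?s m x + indicator (A m \<inter> ?I) x)"
          using union A Suc by (intro linear int) auto
        also have "(\<lambda>x. 1 * ?s m x + indicator (A m \<inter> ?I) x) = ?s (Suc m)"
        proof
          fix x
          have "\<not> (x \<in> A m \<and> x \<in> A i)" if "i < m" for i
            using disjoint_family_onD[OF union(1), of m i] that by auto
          then show "1 * ?s m x + indicator (A m \<inter> ?I) x = ?s (Suc m) x"
            by (auto simp: indicator_def less_Suc_eq)
        qed
        finally show ?case .
      qed
      show ?case
      proof (rule lim_dominated[where s="?s" and w="indicator (UNIV \<inter> ?I)"])
        fix x
        show "(\<lambda>m. ?s m x) \<longlonglongrightarrow> indicator ((\<Union>i. A i) \<inter> ?I) x"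
        proof (cases "x \<in> (\<Union>i. A i) \<inter> ?I")
          case True
          then obtain i where "x \<in> A i" by auto
          have "\<forall>\<^sub>F m in sequentially. ?s m x = indicator ((\<Union>i. A i) \<inter> ?I) x"
            by (rule eventually_mono[OF eventually_gt_at_top[of i]])
              (use True \<open>x \<in> A i\<close> in \<open>auto simp: indicator_def\<close>)
          then show ?thesis by (rule tendsto_eventually)
        next
          case False
          then have "?s m x = indicator ((\<Union>i. A i) \<inter> ?I) x" for m
            by (auto simp: indicator_def)
          then show ?thesis by simp
        qed
      next
        show "integrable lborel (indicator ((\<Union>i. A i) \<inter> ?I) :: real \<Rightarrow> real)" "integrable lborel (?s m)"
          "integrable lborel (indicator (UNIV \<inter> ?I) :: real \<Rightarrow> real)" for m
          using A by (auto intro!: int simp del: UN_simps)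
      qed (use P_s in \<open>auto simp: indicator_def\<close>)
    qed
  qed
  have P_ind: "P (indicator A)" if "A \<in> sets borel" "emeasure lborel A < \<infinity>" for A
  proof (rule lim_dominated[where s="\<lambda>n. indicator (A \<inter> {-real n<..real n})" and w="indicator A"])
    show int: "integrable lborel (indicator A :: real \<Rightarrow> real)" "integrable lborel (indicator A :: real \<Rightarrow> real)"
      using that by (simp_all add: integrable_indicator_iff)
    show "integrable lborel (indicator (A \<inter> {-real n<..real n}) :: real \<Rightarrow> real)" for n
      using that by (intro Bochner_Integration.integrable_bound[OF int(1)]) (auto simp: indicator_def)
    fix x
    obtain N where N: "\<bar>x\<bar> < real N" using reals_Archimedean2 by blast
    have "\<forall>\<^sub>F n in sequentially. indicator (A \<inter> {-real n<..real n}) x = (indicator A x :: real)"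
      using eventually_ge_at_top[of N] by eventually_elim (use N in \<open>auto simp: indicator_def abs_less_iff\<close>)
    then show "(\<lambda>n. indicator (A \<inter> {-real n<..real n}) x :: real) \<longlonglongrightarrow> indicator A x"
      by (rule tendsto_eventually)
  qed (use that P_bounded in \<open>auto simp: indicator_def\<close>)
  from \<open>integrable lborel f\<close> show "P f"
  proof (induction rule: integrable_induct)
    case (base A c)
    then have "integrable lborel (indicator A :: real \<Rightarrow> real)"
      by (simp add: integrable_indicator_iff)
    then have "P (\<lambda>x. c * indicator A x + 0)"
      using base P0 P_ind by (intro linear) auto
    then show ?case by (simp add: mult.commute)
  next
    case (add f g)
    then show ?case using linear[of f g 1] by simp
  next
    case (lim f s)
    \<comment> \<open>The factor 2 is the bound that \<open>integrable_induct\<close> supplies for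
      its approximating sequence.\<close>
    then show ?case by (intro lim_dominated[of f s "\<lambda>x. 2 * \<bar>f x\<bar>"]) auto
  qed
qed

section \<open>Locally nondeterministic processes\<close>

text \<open>Reflection reduces the claim to [0, t], where \<open>p < 1\<close> makes the singularity
  at 0 integrable.\<close>

lemma nn_integral_abs_powr_finite:
  fixes p t :: real
  assumes "p < 1" "0 \<le> t"
  shows "(\<integral>\<^sup>+v. ennreal (\<bar>v\<bar> powr - p) * indicator {-t..t} v \<partial>lborel) < \<infinity>"
proof -
  let ?f = "\<lambda>v::real. ennreal (v powr - p) * indicator {0..t} v"
  have [measurable]: "?f \<in> borel_measurable borel" by measurable
  have fin: "(\<integral>\<^sup>+v. ?f v \<partial>lborel) < \<infinity>"
    using nn_integral_has_integral_lebesgue'[OF _ has_integral_powr_from_0[of "-p" t]] assms by simp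
  have "(\<integral>\<^sup>+v. ennreal (\<bar>v\<bar> powr - p) * indicator {-t..t} v \<partial>lborel) \<le> (\<integral>\<^sup>+v. ?f v + ?f (- v) \<partial>lborel)"
    by (intro nn_integral_mono) (auto simp: indicator_def abs_if)
  also have "\<dots> = (\<integral>\<^sup>+v. ?f v \<partial>lborel) + (\<integral>\<^sup>+v. ?f (- v) \<partial>lborel)"
    by (intro nn_integral_add) auto
  also have "(\<integral>\<^sup>+v. ?f (- v) \<partial>lborel) = (\<integral>\<^sup>+v. ?f v \<partial>lborel)"
    by (subst (2) nn_integral_real_affine[where c="-1" and t=0]) auto
  also have "(\<integral>\<^sup>+v. ?f v \<partial>lborel) + (\<integral>\<^sup>+v. ?f v \<partial>lborel) < \<infinity>"
    using fin by simp
  finally show ?thesis .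
qed

text \<open>For s < u the joint law of the process at the two times has density at most a constant
  times s^(-H) (u - s)^(-H). Adding the power of \<open>u\<close> makes the weight symmetric, so
  that it serves both orders of the two times. The second exponent is separate because the
  comparison of adjacent intervals needs a larger one.\<close>

definition pair_weight :: "real \<Rightarrow> real \<Rightarrow> real \<Rightarrow> real \<Rightarrow> real" where
  "pair_weight p q s u = (\<bar>s\<bar> powr - p + \<bar>u\<bar> powr - p) * \<bar>u - s\<bar> powr - q"

lemma pair_weight_nonneg: "0 \<le> pair_weight p q s u"
  by (simp add: pair_weight_def)

lemma pair_weight_commute: "pair_weight p q s u = pair_weight p q u s"
  by (simp add: pair_weight_def add.commute abs_minus_commute)

lemma measurable_pair_weight [measurable (raw)]:
  assumes [measurable]: "f \<in> borel_measurable N" "g \<in> borel_measurable N"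
  shows "(\<lambda>x. pair_weight p q (f x) (g x)) \<in> borel_measurable N"
  unfolding pair_weight_def by measurable

definition pair_weight_integral :: "real \<Rightarrow> real \<Rightarrow> real \<Rightarrow> ennreal" where
  "pair_weight_integral p q t =
    (\<integral>\<^sup>+s. \<integral>\<^sup>+u. ennreal (pair_weight p q s u) * indicator {0..t} u * indicator {0..t} s \<partial>lborel \<partial>lborel)"

text \<open>By symmetry the integral is twice that of |s|^(-p) |u - s|^(-q). The shift u = s + v
  puts v into [-t, t] and decouples the two powers.\<close>

lemma pair_weight_integral_finite:
  assumes "p < 1" "q < 1" "0 \<le> t"
  shows "pair_weight_integral p q t < \<infinity>"
proof -
  define R where "R q = (\<integral>\<^sup>+v. ennreal (\<bar>v\<bar> powr - q) * indicator {-t..t} v \<partial>lborel)" for q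
  let ?I = "indicator {0..t} :: real \<Rightarrow> ennreal"
  let ?a = "\<lambda>s u. ennreal (\<bar>s\<bar> powr - p) * (ennreal (\<bar>u - s\<bar> powr - q) * ?I u * ?I s)"
  have "(\<integral>\<^sup>+u. ?a s u \<partial>lborel) \<le> ennreal (\<bar>s\<bar> powr - p) * indicator {-t..t} s * R q" for s
  proof (cases "s \<in> {0..t}")
    case True
    have "(\<integral>\<^sup>+u. ennreal (\<bar>u - s\<bar> powr - q) * ?I u \<partial>lborel)
        = (\<integral>\<^sup>+u. ennreal (\<bar>u\<bar> powr - q) * ?I (s + u) \<partial>lborel)"
      by (subst nn_integral_real_affine[where c=1 and t=s]) auto
    also have "\<dots> \<le> R q"
      unfolding R_def using True by (intro nn_integral_mono) (auto simp: indicator_def)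
    finally show ?thesis
      using True by (simp add: nn_integral_cmult mult_left_mono)
  qed simp
  then have "(\<integral>\<^sup>+s. \<integral>\<^sup>+u. ?a s u \<partial>lborel \<partial>lborel) \<le> (\<integral>\<^sup>+s. ennreal (\<bar>s\<bar> powr - p) * indicator {-t..t} s * R q \<partial>lborel)"
    by (rule nn_integral_mono)
  also have "\<dots> = R p * R q"
    unfolding R_def[of p] by (intro nn_integral_multc) auto
  finally have a: "(\<integral>\<^sup>+s. \<integral>\<^sup>+u. ?a s u \<partial>lborel \<partial>lborel) \<le> R p * R q" .
  have "pair_weight_integral p q t = (\<integral>\<^sup>+s. \<integral>\<^sup>+u. ?a s u + ?a u s \<partial>lborel \<partial>lborel)"
    unfolding pair_weight_integral_def
    by (intro nn_integral_cong)
      (auto simp: pair_weight_def indicator_def ennreal_mult abs_minus_commute distrib_right)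
  also have "\<dots> = (\<integral>\<^sup>+s. \<integral>\<^sup>+u. ?a s u \<partial>lborel \<partial>lborel) + (\<integral>\<^sup>+s. \<integral>\<^sup>+u. ?a u s \<partial>lborel \<partial>lborel)"
    by (simp add: nn_integral_add)
  also have "(\<integral>\<^sup>+s. \<integral>\<^sup>+u. ?a u s \<partial>lborel \<partial>lborel) = (\<integral>\<^sup>+s. \<integral>\<^sup>+u. ?a s u \<partial>lborel \<partial>lborel)"
    by (subst lborel_pair.Fubini') auto
  also have "\<dots> + \<dots> \<le> R p * R q + R p * R q"
    using a by (intro add_mono)
  also have "\<dots> < \<infinity>"
    unfolding R_def using assms by (simp add: ennreal_mult_less_top nn_integral_abs_powr_finite[simplified])
  finally show ?thesis .
qed

text \<open>Multiplying through by the probability of \<open>Y s \<in> A\<close> keeps events of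
  probability 0 inside the statement. The case \<open>s = 0\<close>, \<open>A = UNIV\<close> is
  allowed and bounds the unconditional characteristic function of \<open>Y u\<close>.\<close>

locale locally_nondeterministic_process = prob_space M for M :: "'w measure" +
  fixes Y :: "real \<Rightarrow> 'w \<Rightarrow> real" and H K :: real
  assumes measurable_Y: "(\<lambda>(s, w). Y s w) \<in> borel_measurable (borel \<Otimes>\<^sub>M M)"
    and H_pos: "0 < H" and H_less_1: "H < 1"
    and conditional_char_le: "\<And>s u A \<xi>. 0 \<le> s \<Longrightarrow> s < u \<Longrightarrow> A \<in> sets borel \<Longrightarrow>
      cmod (CLINT w|M. indicator A (Y s w) *\<^sub>R iexp (\<xi> * Y u w)) \<le>
        measure M {w \<in> space M. Y s w \<in> A} * (K / (1 + ((u - s) powr H * \<xi>)\<^sup>2)\<^sup>2)"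
begin

lemma measurable_Y_compose [measurable (raw)]:
  assumes "f \<in> borel_measurable N" "g \<in> measurable N M"
  shows "(\<lambda>x. Y (f x) (g x)) \<in> borel_measurable N"
  using measurable_compose[OF measurable_Pair[OF assms] measurable_Y] by simp

text \<open>Dividing \<open>conditional_char_le\<close> by the probability of the event turns it
  into decay of the characteristic function of the conditional law, so every estimate of
  \<open>char_decay\<close> becomes available conditionally, with scale (u - s)^H.\<close>

lemma char_decay_conditional:
  assumes [measurable]: "A \<in> sets borel" and "0 \<le> s" "s < u"
    and nz: "measure M {w \<in> space M. Y s w \<in> A} \<noteq> 0"
  shows "char_decay (distr (uniform_measure M {w \<in> space M. Y s w \<in> A}) borel (Y u)) K ((u - s) powr H)"
proof -
  let ?A = "{w \<in> space M. Y s w \<in> A}"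
  let ?U = "uniform_measure M ?A"
  have emeasure_A: "emeasure M ?A \<noteq> 0" "emeasure M ?A \<noteq> \<infinity>"
    using nz by (auto simp: measure_def)
  interpret U: prob_space ?U
    using emeasure_A by (rule prob_space_uniform_measure)
  have [measurable]: "Y u \<in> measurable ?U borel"
    by (simp add: measurable_cong_sets[OF sets_uniform_measure refl])
  interpret D: real_distribution "distr ?U borel (Y u)"
    by (rule U.real_distribution_distr) simp
  show ?thesis
  proof
    show "0 < (u - s) powr H" using assms by simp
    fix \<xi>
    have dens: "?U = density M (\<lambda>w. ennreal (indicator ?A w / measure M ?A))"
      unfolding uniform_measure_def using nz
      by (intro density_cong) (auto simp: indicator_def emeasure_eq_measure divide_ennreal zero_less_measure_iff[symmetric] simp flip: ennreal_1)
    have "char (distr ?U borel (Y u)) \<xi> = (CLINT w|?U. iexp (\<xi> * Y u w))"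
      unfolding char_def by (subst integral_distr) auto
    also have "\<dots> = (CLINT w|M. (indicator ?A w / measure M ?A) *\<^sub>R iexp (\<xi> * Y u w))"
      unfolding dens by (subst integral_density) auto
    also have "\<dots> = (CLINT w|M. (1 / measure M ?A) *\<^sub>R (indicator A (Y s w) *\<^sub>R iexp (\<xi> * Y u w)))"
      by (intro Bochner_Integration.integral_cong) (auto simp: indicator_def)
    also have "\<dots> = (1 / measure M ?A) *\<^sub>R (CLINT w|M. indicator A (Y s w) *\<^sub>R iexp (\<xi> * Y u w))"
      by (rule integral_scaleR_right)
    finally have "cmod (char (distr ?U borel (Y u)) \<xi>) =
        cmod (CLINT w|M. indicator A (Y s w) *\<^sub>R iexp (\<xi> * Y u w)) / measure M ?A"
      by simp
    also have "\<dots> \<le> measure M ?A * (K / (1 + ((u - s) powr H * \<xi>)\<^sup>2)\<^sup>2) / measure M ?A"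
      using conditional_char_le assms by (intro divide_right_mono) auto
    also have "\<dots> = K / (1 + ((u - s) powr H * \<xi>)\<^sup>2)\<^sup>2" using nz by simp
    finally show "cmod (char (distr ?U borel (Y u)) \<xi>) \<le> K / (1 + ((u - s) powr H * \<xi>)\<^sup>2)\<^sup>2" .
  qed
qed

lemma measure_conditional:
  assumes [measurable]: "A \<in> sets borel" "B \<in> sets borel"
    and nz: "measure M {w \<in> space M. Y s w \<in> A} \<noteq> 0"
  shows "measure M {w \<in> space M. Y s w \<in> A \<and> Y u w \<in> B} = measure M {w \<in> space M. Y s w \<in> A} *
    measure (distr (uniform_measure M {w \<in> space M. Y s w \<in> A}) borel (Y u)) B"
proof -
  have "emeasure M {w \<in> space M. Y s w \<in> A} \<noteq> 0" "emeasure M {w \<in> space M. Y s w \<in> A} \<noteq> \<infinity>"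
    using nz by (auto simp: measure_def)
  moreover have "{w \<in> space M. Y s w \<in> A} \<inter> (Y u -` B \<inter> space M) = {w \<in> space M. Y s w \<in> A \<and> Y u w \<in> B}"
    by auto
  ultimately show ?thesis
    using nz by (subst measure_distr) auto
qed

lemma K_ge_1: "1 \<le> K"
  using char_decay.K_ge_1[OF char_decay_conditional[of UNIV 0 1]] by (simp add: prob_space)

lemma prob_le:
  assumes [measurable]: "A \<in> sets borel" "B \<in> sets borel"
  shows "measure M {w \<in> space M. Y s w \<in> A \<and> Y u w \<in> B} \<le> measure M {w \<in> space M. Y s w \<in> A}"
  by (intro finite_measure_mono) auto

lemma emeasure_joint_le:
  assumes [measurable]: "A \<in> sets borel" "B \<in> sets borel" and "0 \<le> s" "s < u"
  shows "emeasure M {w \<in> space M. Y s w \<in> A \<and> Y u w \<in> B} \<le>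
    emeasure M {w \<in> space M. Y s w \<in> A} * (ennreal (K / (u - s) powr H) * emeasure lborel B)"
proof (cases "measure M {w \<in> space M. Y s w \<in> A} = 0")
  case True
  then have "measure M {w \<in> space M. Y s w \<in> A \<and> Y u w \<in> B} = 0"
    using prob_le[OF assms(1,2), of s u] measure_nonneg[of M] by (simp add: antisym)
  then show ?thesis by (simp add: emeasure_eq_measure)
next
  case False
  let ?N = "distr (uniform_measure M {w \<in> space M. Y s w \<in> A}) borel (Y u)"
  interpret N: char_decay ?N K "(u - s) powr H"
    using assms False by (intro char_decay_conditional)
  have "emeasure ?N B \<le> ennreal (K / (u - s) powr H) * emeasure lborel B"
    using N.measure_Ioc_le K_ge_1 by (intro N.emeasure_le_lborel_if_Ioc_le) auto
  then show ?thesis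
    using measure_conditional[OF assms(1,2) False, of u]
    by (simp add: N.emeasure_eq_measure emeasure_eq_measure ennreal_mult mult_left_mono)
qed

text \<open>With r = e / (u - s)^H the conditional probabilities differ by at most K r (density
  bound) and at most K r^2 (Lipschitz bound), and min (r, r^2) \<le> r^(1 + \<theta>). The exponent
  stays open because r^2 would cost (u - s)^(-2H), too singular when H \<ge> 1/2.\<close>

lemma adjacent_difference_le:
  assumes [measurable]: "A \<in> sets borel" and "0 \<le> s" "s < u" "0 < e" "0 \<le> \<theta>" "\<theta> \<le> 1"
  shows "\<bar>measure M {w \<in> space M. Y s w \<in> A \<and> Y u w \<in> {x - e..<x}} -
          measure M {w \<in> space M. Y s w \<in> A \<and> Y u w \<in> {x..<x + e}}\<bar>
    \<le> measure M {w \<in> space M. Y s w \<in> A} * (K * (e / (u - s) powr H) powr (1 + \<theta>))"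
proof (cases "measure M {w \<in> space M. Y s w \<in> A} = 0")
  case True
  then have "measure M {w \<in> space M. Y s w \<in> A \<and> Y u w \<in> B} = 0" if "B \<in> sets borel" for B
    using prob_le[OF assms(1) that, of s u] measure_nonneg[of M] by (simp add: antisym)
  from this[of "{x - e..<x}"] this[of "{x..<x + e}"] show ?thesis by (simp add: True)
next
  case False
  let ?N = "distr (uniform_measure M {w \<in> space M. Y s w \<in> A}) borel (Y u)"
  interpret N: char_decay ?N K "(u - s) powr H"
    using assms False by (intro char_decay_conditional)
  define r where "r = e / (u - s) powr H"
  have "r > 0" using assms by (simp add: r_def)
  let ?D = "\<bar>measure ?N {x - e..<x} - measure ?N {x..<x + e}\<bar>"
  have D2: "?D \<le> K * r\<^sup>2"
    using N.adjacent_Ico_difference_le[of e x] assms by (simp add: r_def power_divide)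
  have "measure ?N {x - e..<x} \<le> K * r" "measure ?N {x..<x + e} \<le> K * r"
    using N.measure_Ioc_le[of "x - e" x] N.measure_Ioc_le[of x "x + e"] assms
    by (simp_all add: N.measure_Ico_eq_Ioc r_def)
  then have D1: "?D \<le> K * r"
    using measure_nonneg[of ?N "{x - e..<x}"] measure_nonneg[of ?N "{x..<x + e}"] by linarith
  have "?D \<le> K * r powr (1 + \<theta>)"
  proof (cases "r \<le> 1")
    case True
    then have "r powr 2 \<le> r powr (1 + \<theta>)"
      using \<open>r > 0\<close> assms powr_mono'[of "1 + \<theta>" 2 r] by simp
    then have "K * r\<^sup>2 \<le> K * r powr (1 + \<theta>)"
      using \<open>r > 0\<close> K_ge_1 by (intro mult_left_mono) (auto simp flip: powr_numeral)
    then show ?thesis using D2 by simp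
  next
    case False
    then have "r powr 1 \<le> r powr (1 + \<theta>)"
      using assms by (intro powr_mono) auto
    then have "K * r \<le> K * r powr (1 + \<theta>)"
      using \<open>r > 0\<close> K_ge_1 by (intro mult_left_mono) auto
    then show ?thesis using D1 by simp
  qed
  then have "measure M {w \<in> space M. Y s w \<in> A} * ?D \<le> measure M {w \<in> space M. Y s w \<in> A} * (K * r powr (1 + \<theta>))"
    by (intro mult_left_mono) auto
  then show ?thesis
    using measure_conditional[OF assms(1) _ False, of "{x - e..<x}" u] measure_conditional[OF assms(1) _ False, of "{x..<x + e}" u]
    by (simp add: r_def abs_mult flip: right_diff_distrib)
qed

text \<open>The comparison of measures is used twice: for a fixed event on \<open>Y s\<close> the
  bound on sets lifts to \<open>g\<close>, and for this fixed \<open>g\<close> the resulting bound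
  on events lifts to \<open>f\<close>.\<close>

lemma nn_integral_joint_le:
  assumes [measurable]: "f \<in> borel_measurable borel" "g \<in> borel_measurable borel" and "0 \<le> s" "s < u"
  shows "(\<integral>\<^sup>+w. f (Y s w) * g (Y u w) \<partial>M) \<le>
    (\<integral>\<^sup>+w. f (Y s w) \<partial>M) * (ennreal (K / (u - s) powr H) * (\<integral>\<^sup>+y. g y \<partial>lborel))"
proof -
  let ?c = "ennreal (K / (u - s) powr H)"
  have ind: "(\<integral>\<^sup>+w. indicator A (Y s w) * g (Y u w) \<partial>M) \<le>
      emeasure M {w \<in> space M. Y s w \<in> A} * (?c * (\<integral>\<^sup>+y. g y \<partial>lborel))"
    if [measurable]: "A \<in> sets borel" for A
  proof -
    let ?N = "distr (density M (\<lambda>w. indicator A (Y s w))) borel (Y u)"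
    have N: "emeasure ?N B = emeasure M {w \<in> space M. Y s w \<in> A \<and> Y u w \<in> B}" if [measurable]: "B \<in> sets borel" for B
    proof -
      have "emeasure ?N B = (\<integral>\<^sup>+w. indicator A (Y s w) * indicator (Y u -` B \<inter> space M) w \<partial>M)"
        by (subst emeasure_distr) (auto simp: emeasure_density)
      also have "\<dots> = (\<integral>\<^sup>+w. indicator {w \<in> space M. Y s w \<in> A \<and> Y u w \<in> B} w \<partial>M)"
        by (intro nn_integral_cong) (auto simp: indicator_def)
      finally show ?thesis by simp
    qed
    have "(\<integral>\<^sup>+w. indicator A (Y s w) * g (Y u w) \<partial>M) = (\<integral>\<^sup>+y. g y \<partial>?N)"
      by (subst nn_integral_distr) (auto simp: nn_integral_density)
    also have "\<dots> \<le> emeasure M {w \<in> space M. Y s w \<in> A} * ?c * (\<integral>\<^sup>+y. g y \<partial>lborel)"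
      using emeasure_joint_le[of A _ s u] assms(3,4)
      by (intro nn_integral_le_if_emeasure_le) (auto simp: N mult.assoc)
    finally show ?thesis by (simp add: mult.assoc)
  qed
  let ?N = "distr (density M (\<lambda>w. g (Y u w))) borel (Y s)"
  have N: "emeasure ?N A = (\<integral>\<^sup>+w. indicator A (Y s w) * g (Y u w) \<partial>M)" if [measurable]: "A \<in> sets borel" for A
    by (subst emeasure_distr)
      (auto simp: emeasure_density mult.commute intro!: nn_integral_cong split: split_indicator)
  have D: "emeasure (distr M borel (Y s)) A = emeasure M {w \<in> space M. Y s w \<in> A}" if "A \<in> sets borel" for A
    using that by (subst emeasure_distr) (auto simp: vimage_def Int_def conj_commute)
  have "(\<integral>\<^sup>+w. f (Y s w) * g (Y u w) \<partial>M) = (\<integral>\<^sup>+y. f y \<partial>?N)"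
    by (subst nn_integral_distr) (auto simp: nn_integral_density mult.commute)
  also have "\<dots> \<le> ?c * (\<integral>\<^sup>+y. g y \<partial>lborel) * (\<integral>\<^sup>+y. f y \<partial>distr M borel (Y s))"
    using ind by (intro nn_integral_le_if_emeasure_le)
      (auto simp: N D mult.commute mult.left_commute)
  also have "(\<integral>\<^sup>+y. f y \<partial>distr M borel (Y s)) = (\<integral>\<^sup>+w. f (Y s w) \<partial>M)"
    by (subst nn_integral_distr) auto
  finally show ?thesis by (simp add: mult.commute)
qed

text \<open>This is the joint bound with earlier time 0 and the constant function 1 there.\<close>

lemma nn_integral_marginal_le:
  assumes "f \<in> borel_measurable borel" "0 < s"
  shows "(\<integral>\<^sup>+w. f (Y s w) \<partial>M) \<le> ennreal (K / s powr H) * (\<integral>\<^sup>+y. f y \<partial>lborel)"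
  using nn_integral_joint_le[of "\<lambda>_. 1" f 0 s] assms by (simp add: emeasure_space_1)

end

section \<open>Second moments of occupation integrals\<close>

text \<open>For a non-integrable \<open>f\<close> the left side is 0, the default value of the
  integral.\<close>

lemma ennreal_norm_integral_le:
  fixes f :: "'a \<Rightarrow> 'b::{banach, second_countable_topology}"
  shows "ennreal (norm (\<integral>x. f x \<partial>M)) \<le> (\<integral>\<^sup>+x. ennreal (norm (f x)) \<partial>M)"
  by (cases "integrable M f") (auto simp: integral_norm_bound_ennreal not_integrable_integral_eq)

context locally_nondeterministic_process
begin

lemma pair_sigma_finite_lborel: "pair_sigma_finite lborel M"
  by (intro pair_sigma_finite.intro sigma_finite_lborel sigma_finite_measure_axioms)

text \<open>The later time contributes (u - s)^(-H) through the joint bound, the earlier one s^(-H)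
  through the marginal bound; the remaining summand of the weight is merely added.\<close>

lemma nn_integral_pair_le:
  assumes [measurable]: "f \<in> borel_measurable borel" and "0 < s" "0 < u" "s \<noteq> u"
  shows "(\<integral>\<^sup>+w. f (Y s w) * f (Y u w) \<partial>M) \<le> ennreal (K\<^sup>2 * pair_weight H H s u) * (\<integral>\<^sup>+y. f y \<partial>lborel)\<^sup>2"
proof -
  have less: "(\<integral>\<^sup>+w. f (Y s w) * f (Y u w) \<partial>M) \<le> ennreal (K\<^sup>2 * pair_weight H H s u) * (\<integral>\<^sup>+y. f y \<partial>lborel)\<^sup>2"
    if "0 < s" "s < u" for s u
  proof -
    have "(\<integral>\<^sup>+w. f (Y s w) * f (Y u w) \<partial>M) \<le>
        (\<integral>\<^sup>+w. f (Y s w) \<partial>M) * (ennreal (K / (u - s) powr H) * (\<integral>\<^sup>+y. f y \<partial>lborel))"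
      using that by (intro nn_integral_joint_le) auto
    also have "\<dots> \<le> (ennreal (K / s powr H) * (\<integral>\<^sup>+y. f y \<partial>lborel)) *
        (ennreal (K / (u - s) powr H) * (\<integral>\<^sup>+y. f y \<partial>lborel))"
      using that by (intro mult_right_mono nn_integral_marginal_le) auto
    also have "\<dots> = ennreal (K / s powr H * (K / (u - s) powr H)) * (\<integral>\<^sup>+y. f y \<partial>lborel)\<^sup>2"
      using K_ge_1 by (subst ennreal_mult) (auto simp: power2_eq_square mult_ac)
    also have "\<dots> \<le> ennreal (K\<^sup>2 * pair_weight H H s u) * (\<integral>\<^sup>+y. f y \<partial>lborel)\<^sup>2"
      using that K_ge_1
      by (intro mult_right_mono ennreal_leI)
        (auto simp: pair_weight_def powr_minus divide_inverse power2_eq_square mult_ac intro!: mult_left_mono)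
    finally show ?thesis .
  qed
  show ?thesis
    using less[of s u] less[of u s] assms
    by (cases "s < u") (auto simp: mult.commute pair_weight_commute[of H H u s])
qed

text \<open>The squared time integral is a double integral over pairs of times, and Tonelli's
  theorem brings the expectation inside, where the pair bound applies.\<close>

lemma second_moment_occupation_le:
  assumes [measurable]: "f \<in> borel_measurable borel"
  shows "(\<integral>\<^sup>+w. (\<integral>\<^sup>+s. f (Y s w) * indicator {0..t} s \<partial>lborel)\<^sup>2 \<partial>M) \<le>
    ennreal (K\<^sup>2) * pair_weight_integral H H t * (\<integral>\<^sup>+y. f y \<partial>lborel)\<^sup>2"
proof -
  interpret P: pair_sigma_finite lborel M by (rule pair_sigma_finite_lborel)
  let ?I = "indicator {0..t} :: real \<Rightarrow> ennreal"
  let ?F = "\<lambda>s u w. f (Y s w) * f (Y u w) * ?I u * ?I s"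
  have "(\<integral>\<^sup>+s. f (Y s w) * ?I s \<partial>lborel)\<^sup>2 = (\<integral>\<^sup>+s. \<integral>\<^sup>+u. ?F s u w \<partial>lborel \<partial>lborel)"
    if [measurable]: "w \<in> space M" for w
  proof -
    have "(\<integral>\<^sup>+s. f (Y s w) * ?I s \<partial>lborel)\<^sup>2 = (\<integral>\<^sup>+s. f (Y s w) * ?I s * (\<integral>\<^sup>+u. f (Y u w) * ?I u \<partial>lborel) \<partial>lborel)"
      unfolding power2_eq_square by (subst nn_integral_multc) auto
    also have "\<dots> = (\<integral>\<^sup>+s. \<integral>\<^sup>+u. ?F s u w \<partial>lborel \<partial>lborel)"
      by (subst nn_integral_cmult[symmetric]) (auto intro!: nn_integral_cong simp: mult_ac)
    finally show ?thesis .
  qed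
  then have "(\<integral>\<^sup>+w. (\<integral>\<^sup>+s. f (Y s w) * ?I s \<partial>lborel)\<^sup>2 \<partial>M) = (\<integral>\<^sup>+w. \<integral>\<^sup>+s. \<integral>\<^sup>+u. ?F s u w \<partial>lborel \<partial>lborel \<partial>M)"
    by (intro nn_integral_cong) simp
  also have "\<dots> = (\<integral>\<^sup>+s. \<integral>\<^sup>+w. \<integral>\<^sup>+u. ?F s u w \<partial>lborel \<partial>M \<partial>lborel)"
    by (rule P.Fubini') measurable
  also have "\<dots> = (\<integral>\<^sup>+s. \<integral>\<^sup>+u. \<integral>\<^sup>+w. ?F s u w \<partial>M \<partial>lborel \<partial>lborel)"
    by (intro nn_integral_cong P.Fubini') measurable
  also have "\<dots> \<le> (\<integral>\<^sup>+s. \<integral>\<^sup>+u. ennreal (K\<^sup>2) * (\<integral>\<^sup>+y. f y \<partial>lborel)\<^sup>2 *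
      (ennreal (pair_weight H H s u) * ?I u * ?I s) \<partial>lborel \<partial>lborel)"
  \<comment> \<open>The pair bound breaks down at time 0 and on the diagonal; both are null in the
    double integral.\<close>
  proof (intro nn_integral_mono_AE, use AE_lborel_singleton[of "0::real"] in eventually_elim)
    fix s :: real assume "s \<noteq> 0"
    show "(\<integral>\<^sup>+u. \<integral>\<^sup>+w. ?F s u w \<partial>M \<partial>lborel) \<le> (\<integral>\<^sup>+u. ennreal (K\<^sup>2) * (\<integral>\<^sup>+y. f y \<partial>lborel)\<^sup>2 *
      (ennreal (pair_weight H H s u) * ?I u * ?I s) \<partial>lborel)"
    proof (intro nn_integral_mono_AE, use AE_lborel_singleton[of "0::real"] AE_lborel_singleton[of s] in eventually_elim)
      fix u :: real assume "u \<noteq> 0" "u \<noteq> s"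
      show "(\<integral>\<^sup>+w. ?F s u w \<partial>M) \<le> ennreal (K\<^sup>2) * (\<integral>\<^sup>+y. f y \<partial>lborel)\<^sup>2 * (ennreal (pair_weight H H s u) * ?I u * ?I s)"
      proof (cases "s \<in> {0..t} \<and> u \<in> {0..t}")
        case True
        then show ?thesis
          using nn_integral_pair_le[of f s u] \<open>s \<noteq> 0\<close> \<open>u \<noteq> 0\<close> \<open>u \<noteq> s\<close>
          by (simp add: ennreal_mult pair_weight_nonneg mult_ac)
      qed auto
    qed
  qed
  also have "\<dots> = ennreal (K\<^sup>2) * (\<integral>\<^sup>+y. f y \<partial>lborel)\<^sup>2 * pair_weight_integral H H t"
    unfolding pair_weight_integral_def by (simp add: nn_integral_cmult)
  finally show ?thesis by (simp add: mult_ac)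
qed

section \<open>Second moments with cancellation\<close>

text \<open>The absolute value is taken after the expectation, so that cancellation between the
  signs of \<open>h\<close> survives. For a signed integrand the exchange of integrals rests on
  Fubini's theorem, which boundedness of \<open>h\<close> and the finite time horizon
  provide.\<close>

lemma second_moment_le_correlation:
  fixes h :: "real \<Rightarrow> real"
  assumes [measurable]: "h \<in> borel_measurable borel" and h_le: "\<And>y. \<bar>h y\<bar> \<le> C"
  shows "(\<integral>\<^sup>+w. ennreal ((LINT s:{0..t}|lborel. h (Y s w))\<^sup>2) \<partial>M) \<le>
    (\<integral>\<^sup>+s. \<integral>\<^sup>+u. ennreal \<bar>LINT w|M. h (Y s w) * h (Y u w)\<bar> * indicator {0..t} u * indicator {0..t} s \<partial>lborel \<partial>lborel)"
proof -
  define N where "N = density lborel (\<lambda>s::real. ennreal (indicator {0..t} s))"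
  have sets_N [measurable_cong]: "sets N = sets borel" by (simp add: N_def)
  have "emeasure N (space N) = emeasure lborel {0..t}"
    by (simp add: N_def emeasure_density ennreal_indicator)
  then interpret N: finite_measure N
    by (intro finite_measureI) (simp add: emeasure_lborel_Icc_eq)
  interpret P: pair_sigma_finite N M
    by (intro pair_sigma_finite.intro N.sigma_finite_measure_axioms sigma_finite_measure_axioms)
  interpret PF: finite_measure "N \<Otimes>\<^sub>M M"
    by (intro finite_measure_pair_measure N.finite_measure_axioms finite_measure_axioms)
  have C0: "0 \<le> C" using h_le[of 0] by linarith
  define \<Phi> where "\<Phi> w = (LINT s|N. h (Y s w))" for w
  have \<Phi>_eq: "\<Phi> w = (LINT s:{0..t}|lborel. h (Y s w))" if [measurable]: "w \<in> space M" for w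
    unfolding \<Phi>_def N_def set_lebesgue_integral_def by (subst integral_density) auto
  have [measurable]: "\<Phi> \<in> borel_measurable M"
    unfolding \<Phi>_def by measurable
  have \<Phi>_le: "\<bar>\<Phi> w\<bar> \<le> C * measure N (space N)" if [measurable]: "w \<in> space M" for w
  proof -
    have "norm (\<Phi> w) \<le> (LINT s|N. C)"
      unfolding \<Phi>_def using h_le C0
      by (intro norm_integral_le_integral N.integrable_const_bound[where B=C]) auto
    then show ?thesis by (simp add: mult.commute)
  qed
  define D where "D = C * measure N (space N)"
  have D0: "0 \<le> D" by (simp add: D_def C0)
  have int1: "integrable (N \<Otimes>\<^sub>M M) (\<lambda>(s, w). h (Y s w) * \<Phi> w)"
    using h_le \<Phi>_le C0 D0
    by (intro PF.integrable_const_bound[where B="C * D"])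
      (auto simp: space_pair_measure abs_mult D_def[symmetric] intro!: AE_I2 mult_mono)
  have int2: "integrable (N \<Otimes>\<^sub>M M) (\<lambda>(u, w). h (Y s w) * h (Y u w))" for s
    using h_le C0
    by (intro PF.integrable_const_bound[where B="C * C"])
      (auto simp: space_pair_measure abs_mult intro!: AE_I2 mult_mono)
  have int_\<Phi>: "integrable M (\<lambda>w. (\<Phi> w)\<^sup>2)"
    using \<Phi>_le D0
    by (intro integrable_const_bound[where B="D\<^sup>2"])
      (auto simp: D_def[symmetric] power2_le_iff_abs_le intro!: AE_I2)
  have "(LINT w|M. (\<Phi> w)\<^sup>2) = (LINT w|M. LINT s|N. h (Y s w) * \<Phi> w)"
    by (simp add: \<Phi>_def[symmetric] power2_eq_square)
  also have "\<dots> = (LINT s|N. LINT w|M. h (Y s w) * \<Phi> w)"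
    by (rule P.Fubini_integral[OF int1])
  also have "\<dots> = (LINT s|N. LINT w|M. LINT u|N. h (Y s w) * h (Y u w))"
    by (simp add: \<Phi>_def)
  also have "\<dots> = (LINT s|N. LINT u|N. LINT w|M. h (Y s w) * h (Y u w))"
    by (subst P.Fubini_integral[OF int2]) simp
  finally have eq: "(LINT w|M. (\<Phi> w)\<^sup>2) = (LINT s|N. LINT u|N. LINT w|M. h (Y s w) * h (Y u w))" .
  let ?c = "\<lambda>s u. \<bar>LINT w|M. h (Y s w) * h (Y u w)\<bar>"
  have "(\<integral>\<^sup>+w. ennreal ((LINT s:{0..t}|lborel. h (Y s w))\<^sup>2) \<partial>M) = (\<integral>\<^sup>+w. ennreal ((\<Phi> w)\<^sup>2) \<partial>M)"
    by (intro nn_integral_cong) (simp add: \<Phi>_eq)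
  also have "\<dots> = ennreal (LINT w|M. (\<Phi> w)\<^sup>2)"
    using int_\<Phi> by (intro nn_integral_eq_integral) auto
  also have "\<dots> \<le> ennreal (norm (LINT s|N. LINT u|N. LINT w|M. h (Y s w) * h (Y u w)))"
    unfolding eq by (intro ennreal_leI) simp
  also have "\<dots> \<le> (\<integral>\<^sup>+s. ennreal (norm (LINT u|N. LINT w|M. h (Y s w) * h (Y u w))) \<partial>N)"
    by (rule ennreal_norm_integral_le)
  also have "\<dots> \<le> (\<integral>\<^sup>+s. \<integral>\<^sup>+u. ennreal (?c s u) \<partial>N \<partial>N)"
    using ennreal_norm_integral_le[where 'b=real] by (intro nn_integral_mono) simp
  also have "\<dots> = (\<integral>\<^sup>+s. (\<integral>\<^sup>+u. ennreal (?c s u) * indicator {0..t} u \<partial>lborel) * indicator {0..t} s \<partial>lborel)"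
    unfolding N_def by (simp add: nn_integral_density ennreal_indicator mult.commute)
  also have "\<dots> = (\<integral>\<^sup>+s. \<integral>\<^sup>+u. ennreal (?c s u) * indicator {0..t} u * indicator {0..t} s \<partial>lborel \<partial>lborel)"
    by (subst nn_integral_multc) auto
  finally show ?thesis .
qed

text \<open>The two adjacent intervals have almost the same conditional probability, so that the
  correlation gains the factor \<open>e powr \<theta>\<close> over the bound for the two intervals separately.\<close>

lemma adjacent_correlation_le:
  fixes x e \<theta> :: real
  defines "h \<equiv> \<lambda>y. indicator {x - e..<x} y - indicator {x..<x + e} y :: real"
  assumes "0 < s" "0 < u" "s \<noteq> u" "0 < e" "0 \<le> \<theta>" "\<theta> \<le> 1"
  shows "\<bar>LINT w|M. h (Y s w) * h (Y u w)\<bar> \<le> 2 * K\<^sup>2 * e powr (2 + \<theta>) * pair_weight H (H * (1 + \<theta>)) s u"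
proof -
  have less: "\<bar>LINT w|M. h (Y s w) * h (Y u w)\<bar> \<le> 2 * K\<^sup>2 * e powr (2 + \<theta>) * pair_weight H (H * (1 + \<theta>)) s u"
    if su: "0 < s" "s < u" for s u
  proof -
    let ?A = "\<lambda>B. {w \<in> space M. Y s w \<in> B}"
    let ?P = "\<lambda>B C. {w \<in> space M. Y s w \<in> B \<and> Y u w \<in> C}"
    let ?l = "{x - e..<x}" and ?r = "{x..<x + e}"
    have [measurable]: "?P B C \<in> sets M" if "B \<in> sets borel" "C \<in> sets borel" for B C
      using that by measurable
    \<comment> \<open>The four sign combinations are grouped by the interval visited at time
      \<open>s\<close>, so that each group is an adjacent difference at time
      \<open>u\<close>.\<close>
    have "(LINT w|M. h (Y s w) * h (Y u w)) =
        (LINT w|M. (indicator (?P ?l ?l) w - indicator (?P ?l ?r) w) - (indicator (?P ?r ?l) w - indicator (?P ?r ?r) w))"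
      by (intro Bochner_Integration.integral_cong) (auto simp: h_def indicator_def)
    also have "\<dots> = (measure M (?P ?l ?l) - measure M (?P ?l ?r)) - (measure M (?P ?r ?l) - measure M (?P ?r ?r))"
      by (simp add: integrable_indicator_iff emeasure_eq_measure del: mem_Collect_eq)
    finally have eq: "(LINT w|M. h (Y s w) * h (Y u w)) = (measure M (?P ?l ?l) - measure M (?P ?l ?r)) - (measure M (?P ?r ?l) - measure M (?P ?r ?r))" .
    have "?l \<in> sets borel" "?r \<in> sets borel" by auto
    note adj = this[THEN adjacent_difference_le[OF _ less_imp_le[OF su(1)] su(2) assms(5-7)], of x]
    have "\<bar>LINT w|M. h (Y s w) * h (Y u w)\<bar> \<le>
        measure M (?A ?l) * (K * (e / (u - s) powr H) powr (1 + \<theta>)) + measure M (?A ?r) * (K * (e / (u - s) powr H) powr (1 + \<theta>))"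
      unfolding eq using adj by linarith
    also have "\<dots> = (measure M (?A ?l) + measure M (?A ?r)) * (K * (e / (u - s) powr H) powr (1 + \<theta>))"
      by (rule distrib_right[symmetric])
    \<comment> \<open>Each interval has length \<open>e\<close>, so the marginal density bound
      supplies s^(-H) and one more factor \<open>e\<close>, which makes the total power 2 +
      \<theta>.\<close>
    also have "\<dots> \<le> (K / s powr H * e + K / s powr H * e) * (K * (e / (u - s) powr H) powr (1 + \<theta>))"
    proof (intro mult_right_mono add_mono)
      have "measure M (?A B) \<le> K / s powr H * e" if B: "B \<in> sets borel" "emeasure lborel B = ennreal e" for B
      proof -
        have "(\<integral>\<^sup>+w. indicator B (Y s w) \<partial>M) = emeasure M (?A B)"
        proof -
          have "(\<integral>\<^sup>+w. indicator B (Y s w) \<partial>M) = (\<integral>\<^sup>+w. indicator (?A B) w \<partial>M)"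
            by (intro nn_integral_cong) (auto simp: indicator_def)
          then show ?thesis using B(1) by simp
        qed
        then have "ennreal (measure M (?A B)) \<le> ennreal (K / s powr H) * ennreal e"
          using nn_integral_marginal_le[of "indicator B" s] B su by (simp add: emeasure_eq_measure)
        then show ?thesis
          using K_ge_1 assms by (subst (asm) ennreal_mult[symmetric]) (auto simp: ennreal_le_iff)
      qed
      from this[of ?l] this[of ?r] show "measure M (?A ?l) \<le> K / s powr H * e" "measure M (?A ?r) \<le> K / s powr H * e"
        using assms by auto
    qed (use K_ge_1 in auto)
    also have "\<dots> = 2 * K\<^sup>2 * e powr (2 + \<theta>) * (s powr -H * (u - s) powr - (H * (1 + \<theta>)))"
    proof -
      have "(e / (u - s) powr H) powr (1 + \<theta>) = e powr (1 + \<theta>) * (u - s) powr - (H * (1 + \<theta>))"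
        using assms su by (simp add: powr_divide powr_powr powr_minus_divide)
      moreover have "e powr (2 + \<theta>) = e * e powr (1 + \<theta>)"
        using assms powr_add[of e 1 "1 + \<theta>"] by simp
      ultimately show ?thesis
        by (simp add: powr_minus divide_inverse power2_eq_square)
    qed
    also have "\<dots> \<le> 2 * K\<^sup>2 * e powr (2 + \<theta>) * pair_weight H (H * (1 + \<theta>)) s u"
      using su by (intro mult_left_mono) (auto simp: pair_weight_def intro!: mult_right_mono)
    finally show ?thesis .
  qed
  show ?thesis
    using less[of s u] less[of u s] assms(2-4)
    by (cases "s < u") (auto simp: mult.commute pair_weight_commute[of _ _ u s])
qed

text \<open>Averages over the two intervals carry a factor 1 / e, so their difference has second
  moment of order \<open>e powr \<theta>\<close>, which vanishes with \<open>e\<close>.\<close>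

lemma second_moment_adjacent_le:
  fixes x e \<theta> :: real
  defines "h \<equiv> \<lambda>y. indicator {x - e..<x} y - indicator {x..<x + e} y :: real"
  assumes "0 < e" "0 \<le> \<theta>" "\<theta> \<le> 1"
  shows "(\<integral>\<^sup>+w. ennreal ((LINT s:{0..t}|lborel. h (Y s w))\<^sup>2) \<partial>M) \<le>
    ennreal (2 * K\<^sup>2 * e powr (2 + \<theta>)) * pair_weight_integral H (H * (1 + \<theta>)) t"
proof -
  let ?I = "indicator {0..t} :: real \<Rightarrow> ennreal"
  let ?c = "\<lambda>s u. \<bar>LINT w|M. h (Y s w) * h (Y u w)\<bar>"
  let ?w = "pair_weight H (H * (1 + \<theta>))"
  have "(\<integral>\<^sup>+w. ennreal ((LINT s:{0..t}|lborel. h (Y s w))\<^sup>2) \<partial>M) \<le>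
      (\<integral>\<^sup>+s. \<integral>\<^sup>+u. ennreal (?c s u) * ?I u * ?I s \<partial>lborel \<partial>lborel)"
    by (rule second_moment_le_correlation[where C=1]) (auto simp: h_def indicator_def)
  also have "\<dots> \<le> (\<integral>\<^sup>+s. \<integral>\<^sup>+u. ennreal (2 * K\<^sup>2 * e powr (2 + \<theta>)) * (ennreal (?w s u) * ?I u * ?I s) \<partial>lborel \<partial>lborel)"
  proof (intro nn_integral_mono_AE, use AE_lborel_singleton[of "0::real"] in eventually_elim)
    fix s :: real assume "s \<noteq> 0"
    show "(\<integral>\<^sup>+u. ennreal (?c s u) * ?I u * ?I s \<partial>lborel) \<le>
      (\<integral>\<^sup>+u. ennreal (2 * K\<^sup>2 * e powr (2 + \<theta>)) * (ennreal (?w s u) * ?I u * ?I s) \<partial>lborel)"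
    proof (intro nn_integral_mono_AE, use AE_lborel_singleton[of "0::real"] AE_lborel_singleton[of s] in eventually_elim)
      fix u :: real assume "u \<noteq> 0" "u \<noteq> s"
      show "ennreal (?c s u) * ?I u * ?I s \<le> ennreal (2 * K\<^sup>2 * e powr (2 + \<theta>)) * (ennreal (?w s u) * ?I u * ?I s)"
      proof (cases "s \<in> {0..t} \<and> u \<in> {0..t}")
        case True
        then have "ennreal (?c s u) \<le> ennreal (2 * K\<^sup>2 * e powr (2 + \<theta>) * ?w s u)"
          unfolding h_def using \<open>s \<noteq> 0\<close> \<open>u \<noteq> 0\<close> \<open>u \<noteq> s\<close> assms
          by (intro ennreal_leI adjacent_correlation_le) auto
        then show ?thesis
          using True by (simp add: ennreal_mult pair_weight_nonneg)
      qed auto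
    qed
  qed
  also have "\<dots> = ennreal (2 * K\<^sup>2 * e powr (2 + \<theta>)) * pair_weight_integral H (H * (1 + \<theta>)) t"
    unfolding pair_weight_integral_def by (simp add: nn_integral_cmult)
  finally show ?thesis .
qed

end

section \<open>Scaling limit of occupation integrals\<close>

text \<open>The inequality (a + b)^2 \<le> 2 a^2 + 2 b^2 stands in for Minkowski's; the constants 2
  and 4 in later thresholds come from it.\<close>

lemma nn_integral_square_add_le:
  fixes f g :: "'a \<Rightarrow> real"
  assumes [measurable]: "f \<in> borel_measurable M" "g \<in> borel_measurable M"
    and "(\<integral>\<^sup>+x. ennreal ((f x)\<^sup>2) \<partial>M) \<le> ennreal a" "(\<integral>\<^sup>+x. ennreal ((g x)\<^sup>2) \<partial>M) \<le> ennreal b" "0 \<le> a" "0 \<le> b"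
  shows "(\<integral>\<^sup>+x. ennreal ((f x + g x)\<^sup>2) \<partial>M) \<le> ennreal (2 * a + 2 * b)"
proof -
  have "(f x + g x)\<^sup>2 \<le> 2 * (f x)\<^sup>2 + 2 * (g x)\<^sup>2" for x
    using sum_squares_bound[of "f x" "g x"] by (simp add: power2_sum)
  then have "(\<integral>\<^sup>+x. ennreal ((f x + g x)\<^sup>2) \<partial>M) \<le> (\<integral>\<^sup>+x. ennreal (2 * (f x)\<^sup>2 + 2 * (g x)\<^sup>2) \<partial>M)"
    by (intro nn_integral_mono ennreal_leI)
  also have "\<dots> = 2 * (\<integral>\<^sup>+x. ennreal ((f x)\<^sup>2) \<partial>M) + 2 * (\<integral>\<^sup>+x. ennreal ((g x)\<^sup>2) \<partial>M)"
    by (simp add: nn_integral_add nn_integral_cmult ennreal_mult)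
  also have "\<dots> \<le> 2 * ennreal a + 2 * ennreal b"
    using assms(3,4) by (intro add_mono mult_left_mono) simp_all
  also have "\<dots> = ennreal (2 * a + 2 * b)"
    using assms(5,6) by (simp add: ennreal_mult)
  finally show ?thesis .
qed

lemma nn_integral_square_cmult_le:
  fixes f :: "'a \<Rightarrow> real"
  assumes [measurable]: "f \<in> borel_measurable M"
    and "(\<integral>\<^sup>+x. ennreal ((f x)\<^sup>2) \<partial>M) \<le> ennreal a"
  shows "(\<integral>\<^sup>+x. ennreal ((c * f x)\<^sup>2) \<partial>M) \<le> ennreal (c\<^sup>2 * a)"
proof -
  have "(\<integral>\<^sup>+x. ennreal ((c * f x)\<^sup>2) \<partial>M) = ennreal (c\<^sup>2) * (\<integral>\<^sup>+x. ennreal ((f x)\<^sup>2) \<partial>M)"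
    by (simp add: nn_integral_cmult ennreal_mult power_mult_distrib)
  also have "\<dots> \<le> ennreal (c\<^sup>2) * ennreal a"
    using assms by (intro mult_left_mono) auto
  finally show ?thesis by (simp add: ennreal_mult')
qed

definition scaled_test :: "real \<Rightarrow> real \<Rightarrow> real \<Rightarrow> (real \<Rightarrow> real) \<Rightarrow> real \<Rightarrow> real" where
  "scaled_test H x k f y = k powr H * f (k powr H * (y - x))"

lemma measurable_scaled_test [measurable]:
  assumes [measurable]: "f \<in> borel_measurable borel"
  shows "scaled_test H x k f \<in> borel_measurable borel"
  unfolding scaled_test_def[abs_def] by measurable

lemma integrable_scaled_test:
  assumes "integrable lborel f" "0 < k"
  shows "integrable lborel (scaled_test H x k f)"
    and "(LINT y|lborel. \<bar>scaled_test H x k f y\<bar>) = (LINT y|lborel. \<bar>f y\<bar>)"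
proof -
  let ?c = "k powr H"
  have c: "?c > 0" using assms by simp
  have "integrable lborel (\<lambda>y. f (- ?c * x + ?c * y))"
    using c assms by (intro lborel_integrable_real_affine) auto
  then show "integrable lborel (scaled_test H x k f)"
    unfolding scaled_test_def[abs_def] by (simp add: algebra_simps)
  have "(LINT y|lborel. \<bar>f y\<bar>) = ?c * (LINT y|lborel. \<bar>f (- ?c * x + ?c * y)\<bar>)"
    using c lborel_integral_real_affine[of ?c "\<lambda>y. \<bar>f y\<bar>" "- ?c * x"] by simp
  also have "\<dots> = (LINT y|lborel. ?c * \<bar>f (- ?c * x + ?c * y)\<bar>)" by simp
  also have "\<dots> = (LINT y|lborel. \<bar>scaled_test H x k f y\<bar>)"
    unfolding scaled_test_def using c by (simp add: abs_mult algebra_simps)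
  finally show "(LINT y|lborel. \<bar>scaled_test H x k f y\<bar>) = (LINT y|lborel. \<bar>f y\<bar>)" ..
qed

lemma filterlim_powr_neg_at_right_0:
  fixes b H :: real
  assumes "0 < b" "0 < H"
  shows "filterlim (\<lambda>k. b * k powr - H) (at_right 0) at_top"
  unfolding filterlim_at
proof
  have "((\<lambda>k. b * k powr - H) \<longlongrightarrow> b * 0) at_top"
    using assms by (intro tendsto_intros tendsto_neg_powr filterlim_ident) auto
  then show "((\<lambda>k. b * k powr - H) \<longlongrightarrow> 0) at_top" by simp
  show "\<forall>\<^sub>F k in at_top. b * k powr - H \<in> {0<..} \<and> b * k powr - H \<noteq> 0"
    using eventually_gt_at_top[of 0] by eventually_elim (use assms in auto)
qed

section \<open>Occupation integrals and their mean-square bounds\<close>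

context locally_nondeterministic_process
begin

text \<open>As a Bochner integral it is 0 on paths along which the integrand is not integrable, so
  linearity in \<open>f\<close> is available only almost surely.\<close>

definition occupation :: "real \<Rightarrow> (real \<Rightarrow> real) \<Rightarrow> 'w \<Rightarrow> real" where
  "occupation t f w = (LINT s:{0..t}|lborel. f (Y s w))"

lemma measurable_occupation [measurable]:
  assumes [measurable]: "f \<in> borel_measurable borel"
  shows "occupation t f \<in> borel_measurable M"
  unfolding occupation_def set_lebesgue_integral_def by measurable

definition occupation_constant :: "real \<Rightarrow> real" where
  "occupation_constant t = K\<^sup>2 * enn2real (pair_weight_integral H H t)"

lemma occupation_constant_nonneg: "0 \<le> occupation_constant t"
  by (simp add: occupation_constant_def)

text \<open>With the absolute value inside the time integral, one bound gives both the integrability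
  along almost every path and the size of \<open>occupation\<close>.\<close>

lemma nn_second_moment_le:
  assumes "integrable lborel f" "0 \<le> t"
  shows "(\<integral>\<^sup>+w. (\<integral>\<^sup>+s. ennreal \<bar>f (Y s w)\<bar> * indicator {0..t} s \<partial>lborel)\<^sup>2 \<partial>M) \<le>
    ennreal (occupation_constant t * (LINT y|lborel. \<bar>f y\<bar>)\<^sup>2)"
proof -
  have [measurable]: "f \<in> borel_measurable borel" using borel_measurable_integrable[OF assms(1)] by simp
  have "(\<integral>\<^sup>+y. ennreal \<bar>f y\<bar> \<partial>lborel) = ennreal (LINT y|lborel. \<bar>f y\<bar>)"
    using assms by (intro nn_integral_eq_integral) auto
  moreover have "pair_weight_integral H H t = ennreal (enn2real (pair_weight_integral H H t))"
    using pair_weight_integral_finite[of H H t] H_less_1 assms by simp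
  ultimately have "ennreal (K\<^sup>2) * pair_weight_integral H H t * (\<integral>\<^sup>+y. ennreal \<bar>f y\<bar> \<partial>lborel)\<^sup>2 =
      ennreal (occupation_constant t * (LINT y|lborel. \<bar>f y\<bar>)\<^sup>2)"
    by (simp add: occupation_constant_def ennreal_mult ennreal_power)
  then show ?thesis
    using second_moment_occupation_le[of "\<lambda>y. ennreal \<bar>f y\<bar>" t] by simp
qed

lemma AE_integrable_occupation:
  fixes f :: "real \<Rightarrow> real"
  assumes "integrable lborel f" "0 \<le> t"
  shows "AE w in M. set_integrable lborel {0..t} (\<lambda>s. f (Y s w))"
proof -
  have [measurable]: "f \<in> borel_measurable borel" using borel_measurable_integrable[OF assms(1)] by simp
  have "AE w in M. (\<integral>\<^sup>+s. ennreal \<bar>f (Y s w)\<bar> * indicator {0..t} s \<partial>lborel)\<^sup>2 \<noteq> \<infinity>"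
    using nn_second_moment_le[OF assms] by (intro nn_integral_PInf_AE) (auto simp: top_unique)
  then show ?thesis
  proof (rule AE_mp, intro AE_I2 impI)
    fix w assume [measurable]: "w \<in> space M"
      and "(\<integral>\<^sup>+s. ennreal \<bar>f (Y s w)\<bar> * indicator {0..t} s \<partial>lborel)\<^sup>2 \<noteq> \<infinity>"
    then have "(\<integral>\<^sup>+s. ennreal \<bar>f (Y s w)\<bar> * indicator {0..t} s \<partial>lborel) < \<infinity>"
      by (auto simp: power2_eq_square ennreal_mult_eq_top_iff less_top[symmetric])
    also have "(\<integral>\<^sup>+s. ennreal \<bar>f (Y s w)\<bar> * indicator {0..t} s \<partial>lborel) =
        (\<integral>\<^sup>+s. ennreal (norm (indicator {0..t} s *\<^sub>R f (Y s w))) \<partial>lborel)"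
      by (intro nn_integral_cong) (auto simp: indicator_def)
    finally show "set_integrable lborel {0..t} (\<lambda>s. f (Y s w))"
      unfolding set_integrable_def by (intro integrableI_bounded) auto
  qed
qed

lemma second_moment_le:
  assumes "integrable lborel f" "0 \<le> t"
  shows "(\<integral>\<^sup>+w. ennreal ((occupation t f w)\<^sup>2) \<partial>M) \<le>
    ennreal (occupation_constant t * (LINT y|lborel. \<bar>f y\<bar>)\<^sup>2)"
proof -
  have "ennreal ((occupation t f w)\<^sup>2) \<le> (\<integral>\<^sup>+s. ennreal \<bar>f (Y s w)\<bar> * indicator {0..t} s \<partial>lborel)\<^sup>2" for w
  proof -
    have "ennreal ((occupation t f w)\<^sup>2) = (ennreal (norm (LINT s|lborel. indicator {0..t} s *\<^sub>R f (Y s w))))\<^sup>2"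
      by (simp add: occupation_def set_lebesgue_integral_def ennreal_power)
    also have "\<dots> \<le> (\<integral>\<^sup>+s. ennreal (norm (indicator {0..t} s *\<^sub>R f (Y s w))) \<partial>lborel)\<^sup>2"
      by (intro power_mono ennreal_norm_integral_le) auto
    also have "(\<integral>\<^sup>+s. ennreal (norm (indicator {0..t} s *\<^sub>R f (Y s w))) \<partial>lborel) =
        (\<integral>\<^sup>+s. ennreal \<bar>f (Y s w)\<bar> * indicator {0..t} s \<partial>lborel)"
      by (intro nn_integral_cong) (auto simp: indicator_def)
    finally show ?thesis .
  qed
  then show ?thesis
    using nn_second_moment_le[OF assms] by (meson nn_integral_mono order_trans)
qed

lemma AE_occupation_linear:
  assumes "integrable lborel f" "integrable lborel g" "0 \<le> t"
  shows "AE w in M. occupation t (\<lambda>y. c * f y + g y) w = c * occupation t f w + occupation t g w"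
  using AE_integrable_occupation[OF assms(1,3)] AE_integrable_occupation[OF assms(2,3)]
  by eventually_elim (simp add: occupation_def set_integral_add)

end

section \<open>The class of test functions with the scaling limit\<close>

text \<open>Time and level are fixed, so \<open>L\<close> is a single random variable. Only averages
  to the right of \<open>x\<close> are assumed to converge. Errors are nonnegative integrals, which
  are meaningful before square integrability is known.\<close>

locale process_with_local_time = locally_nondeterministic_process +
  fixes t x :: real and L :: "'a \<Rightarrow> real"
  assumes t_nonneg: "0 \<le> t"
    and measurable_L [measurable]: "L \<in> borel_measurable M"
    and L_finite: "(\<integral>\<^sup>+w. ennreal ((L w)\<^sup>2) \<partial>M) < \<infinity>"
    and L_limit: "\<And>\<delta>. 0 < \<delta> \<Longrightarrow> \<forall>\<^sub>F \<eta> in at_right 0.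
      (\<integral>\<^sup>+w. ennreal ((1 / \<eta> * occupation t (indicator {x..<x + \<eta>}) w - L w)\<^sup>2) \<partial>M) \<le> ennreal \<delta>"
begin

definition occupation_error :: "real \<Rightarrow> (real \<Rightarrow> real) \<Rightarrow> ennreal" where
  "occupation_error k f =
    (\<integral>\<^sup>+w. ennreal ((occupation t (scaled_test H x k f) w - (LINT y|lborel. f y) * L w)\<^sup>2) \<partial>M)"

definition occupation_converges :: "(real \<Rightarrow> real) \<Rightarrow> bool" where
  "occupation_converges f \<longleftrightarrow> (\<forall>\<delta>>0. \<forall>\<^sub>F k in at_top. occupation_error k f \<le> ennreal \<delta>)"

lemma occupation_error_linear_le:
  assumes int: "integrable lborel f" "integrable lborel g" and "0 < k" "0 \<le> a" "0 \<le> b"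
    and le: "occupation_error k f \<le> ennreal a" "occupation_error k g \<le> ennreal b"
  shows "occupation_error k (\<lambda>y. c * f y + g y) \<le> ennreal (2 * (c\<^sup>2 * a) + 2 * b)"
proof -
  have [measurable]: "f \<in> borel_measurable borel" "g \<in> borel_measurable borel"
    using int[THEN borel_measurable_integrable] by auto
  let ?X = "\<lambda>f w. occupation t (scaled_test H x k f) w - (LINT y|lborel. f y) * L w"
  have "scaled_test H x k (\<lambda>y. c * f y + g y) = (\<lambda>y. c * scaled_test H x k f y + scaled_test H x k g y)"
    by (simp add: scaled_test_def fun_eq_iff algebra_simps)
  note scaled = this
  have "AE w in M. ?X (\<lambda>y. c * f y + g y) w = c * ?X f w + ?X g w"
    using AE_occupation_linear[OF integrable_scaled_test(1)[OF int(1) \<open>0 < k\<close>] integrable_scaled_test(1)[OF int(2) \<open>0 < k\<close>] t_nonneg]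
    unfolding scaled by eventually_elim (simp add: int algebra_simps)
  then have "occupation_error k (\<lambda>y. c * f y + g y) = (\<integral>\<^sup>+w. ennreal ((c * ?X f w + ?X g w)\<^sup>2) \<partial>M)"
    unfolding occupation_error_def by (intro nn_integral_cong_AE) auto
  also have "\<dots> \<le> ennreal (2 * (c\<^sup>2 * a) + 2 * b)"
    using assms(4-) unfolding occupation_error_def
    by (intro nn_integral_square_add_le nn_integral_square_cmult_le) auto
  finally show ?thesis .
qed

lemma occupation_converges_linear:
  assumes int: "integrable lborel f" "integrable lborel g"
    and conv: "occupation_converges f" "occupation_converges g"
  shows "occupation_converges (\<lambda>y. c * f y + g y)"
  unfolding occupation_converges_def
proof (intro allI impI)
  fix \<delta> :: real assume "\<delta> > 0"
  \<comment> \<open>This solves 2 c^2 d + 2 d = \<delta>, the error bound for the linear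
    combination.\<close>
  define d where "d = \<delta> / (2 * c\<^sup>2 + 2)"
  have den: "0 < 2 * c\<^sup>2 + 2" by (simp add: add_nonneg_pos)
  then have "d > 0" using \<open>\<delta> > 0\<close> by (simp add: d_def)
  have "2 * (c\<^sup>2 * d) + 2 * d = (2 * c\<^sup>2 + 2) * d" by (simp add: algebra_simps)
  also have "\<dots> = \<delta>" using den by (simp add: d_def)
  finally have eq: "2 * (c\<^sup>2 * d) + 2 * d = \<delta>" .
  have "\<forall>\<^sub>F k in at_top. occupation_error k f \<le> ennreal d" "\<forall>\<^sub>F k in at_top. occupation_error k g \<le> ennreal d"
    using conv \<open>d > 0\<close> by (auto simp: occupation_converges_def)
  then show "\<forall>\<^sub>F k in at_top. occupation_error k (\<lambda>y. c * f y + g y) \<le> ennreal \<delta>"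
    using eventually_gt_at_top[of 0]
  proof eventually_elim
    case (elim k)
    then show ?case
      using occupation_error_linear_le[OF int _ _ _ elim(1,2), of c] \<open>d > 0\<close> eq by simp
  qed
qed

text \<open>The remainder f - g enters through its occupation integral and through its integral
  times \<open>L\<close>. Both second moments are at most a multiple of its squared L1 norm,
  uniformly in \<open>k\<close> because rescaling preserves that norm.\<close>

lemma occupation_converges_lim:
  assumes int: "integrable lborel f"
    and approx: "\<And>e. 0 < e \<Longrightarrow> \<exists>g. integrable lborel g \<and> occupation_converges g \<and> (LINT y|lborel. \<bar>f y - g y\<bar>) < e"
  shows "occupation_converges f"
  unfolding occupation_converges_def
proof (intro allI impI)
  fix \<delta> :: real assume "\<delta> > 0"
  define l where "l = enn2real (\<integral>\<^sup>+w. ennreal ((L w)\<^sup>2) \<partial>M)"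
  have l: "(\<integral>\<^sup>+w. ennreal ((L w)\<^sup>2) \<partial>M) \<le> ennreal l" "0 \<le> l"
    using L_finite by (auto simp: l_def)
  \<comment> \<open>The coefficient of e^2 after applying (a + b)^2 \<le> 2 a^2 + 2 b^2
    twice.\<close>
  define A where "A = 4 * occupation_constant t + 4 * l"
  have "A \<ge> 0" using l occupation_constant_nonneg[of t] by (simp add: A_def)
  \<comment> \<open>The cap at 1 gives e^2 \<le> e, and with it A e^2 \<le> \<delta> / 2.\<close>
  define e where "e = min 1 (\<delta> / (2 * (A + 1)))"
  have "e > 0" using \<open>A \<ge> 0\<close> \<open>\<delta> > 0\<close> by (simp add: e_def)
  have "A * e\<^sup>2 \<le> (A + 1) * e"
  proof -
    have "e \<le> 1" by (simp add: e_def)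
    then have "e\<^sup>2 \<le> e" using \<open>e > 0\<close> by (simp add: power2_eq_square mult_left_le)
    then show ?thesis using \<open>A \<ge> 0\<close> \<open>e > 0\<close> by (intro mult_mono) auto
  qed
  also have "\<dots> \<le> (A + 1) * (\<delta> / (2 * (A + 1)))"
    using \<open>A \<ge> 0\<close> by (intro mult_left_mono) (auto simp: e_def)
  also have "\<dots> = \<delta> / 2" using \<open>A \<ge> 0\<close> by (simp add: field_simps)
  finally have Ae: "A * e\<^sup>2 \<le> \<delta> / 2" .
  obtain g where g: "integrable lborel g" "occupation_converges g" "(LINT y|lborel. \<bar>f y - g y\<bar>) < e"
    using approx[OF \<open>e > 0\<close>] by auto
  define r where "r y = f y - g y" for y
  have r: "integrable lborel r" unfolding r_def using int g by simp
  have [measurable]: "r \<in> borel_measurable borel" using r[THEN borel_measurable_integrable] by simp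
  have r_less: "(LINT y|lborel. \<bar>r y\<bar>) \<le> e" using g by (simp add: r_def)
  have "\<bar>LINT y|lborel. r y\<bar> \<le> e"
    using order_trans[OF integral_norm_bound[of lborel r], of e] r_less by simp
  have "\<forall>\<^sub>F k in at_top. occupation_error k g \<le> ennreal (\<delta> / 4)"
    using g \<open>\<delta> > 0\<close> by (auto simp: occupation_converges_def)
  then show "\<forall>\<^sub>F k in at_top. occupation_error k f \<le> ennreal \<delta>"
    using eventually_gt_at_top[of 0]
  proof eventually_elim
    case (elim k)
    let ?C = "occupation_constant t"
    have "(\<integral>\<^sup>+w. ennreal ((occupation t (scaled_test H x k r) w)\<^sup>2) \<partial>M) \<le> ennreal (?C * (LINT y|lborel. \<bar>r y\<bar>)\<^sup>2)"
      using second_moment_le[OF integrable_scaled_test(1)[OF r elim(2)] t_nonneg]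
      by (simp add: integrable_scaled_test(2)[OF r elim(2)])
    also have "\<dots> \<le> ennreal (?C * e\<^sup>2)"
      using r_less occupation_constant_nonneg by (intro ennreal_leI mult_left_mono power_mono) auto
    finally have 1: "(\<integral>\<^sup>+w. ennreal ((occupation t (scaled_test H x k r) w)\<^sup>2) \<partial>M) \<le> ennreal (?C * e\<^sup>2)" .
    have "(\<integral>\<^sup>+w. ennreal ((- (LINT y|lborel. r y) * L w)\<^sup>2) \<partial>M) \<le> ennreal ((- (LINT y|lborel. r y))\<^sup>2 * l)"
      using l by (intro nn_integral_square_cmult_le) auto
    also have "\<dots> \<le> ennreal (e\<^sup>2 * l)"
      using \<open>\<bar>LINT y|lborel. r y\<bar> \<le> e\<close> l \<open>e > 0\<close>
      by (intro ennreal_leI mult_right_mono) (auto simp: power2_le_iff_abs_le)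
    finally have "(\<integral>\<^sup>+w. ennreal ((occupation t (scaled_test H x k r) w + - (LINT y|lborel. r y) * L w)\<^sup>2) \<partial>M) \<le>
        ennreal (2 * (?C * e\<^sup>2) + 2 * (e\<^sup>2 * l))"
      using 1 l occupation_constant_nonneg by (intro nn_integral_square_add_le) auto
    then have "occupation_error k r \<le> ennreal (2 * (?C * e\<^sup>2) + 2 * (e\<^sup>2 * l))"
      unfolding occupation_error_def by simp
    then have "occupation_error k (\<lambda>y. 1 * r y + g y) \<le> ennreal (2 * (1\<^sup>2 * (2 * (?C * e\<^sup>2) + 2 * (e\<^sup>2 * l))) + 2 * (\<delta> / 4))"
      using elim \<open>\<delta> > 0\<close> l occupation_constant_nonneg
      by (intro occupation_error_linear_le r g) auto
    also have "\<dots> = ennreal (A * e\<^sup>2 + \<delta> / 2)"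
      by (simp add: A_def algebra_simps)
    also have "\<dots> \<le> ennreal \<delta>" using Ae by (intro ennreal_leI) simp
    finally show ?case by (simp add: r_def)
  qed
qed

lemma scaled_indicator:
  assumes "0 < k"
  shows "scaled_test H x k (indicator {a..<b}) =
    (\<lambda>y. k powr H * indicator {x + a * k powr - H..<x + b * k powr - H} y)"
proof
  fix y
  have c: "k powr H > 0" using assms by simp
  have "a \<le> k powr H * (y - x) \<longleftrightarrow> x + a * k powr - H \<le> y" "k powr H * (y - x) < b \<longleftrightarrow> y < x + b * k powr - H"
    using c by (simp_all add: powr_minus field_simps)
  then show "scaled_test H x k (indicator {a..<b}) y =
    k powr H * indicator {x + a * k powr - H..<x + b * k powr - H} y"
    by (simp add: scaled_test_def indicator_def)
qed

lemma occupation_cmult: "occupation t (\<lambda>y. c * f y) w = c * occupation t f w"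
  by (simp add: occupation_def)

text \<open>The rescaled indicator is b / \<eta> times that of [x, x + \<eta>) with \<eta> = b
  k^(-H), so its error is \<open>b\<close> times that of a right average.\<close>

lemma occupation_converges_right:
  assumes "0 < b" shows "occupation_converges (indicator {0..<b})"
  unfolding occupation_converges_def
proof (intro allI impI)
  fix \<delta> :: real assume "\<delta> > 0"
  then have "\<forall>\<^sub>F \<eta> in at_right 0. (\<integral>\<^sup>+w. ennreal ((1 / \<eta> * occupation t (indicator {x..<x + \<eta>}) w - L w)\<^sup>2) \<partial>M) \<le> ennreal (\<delta> / b\<^sup>2)"
    using assms by (intro L_limit) auto
  from eventually_compose_filterlim[OF this filterlim_powr_neg_at_right_0[OF assms H_pos]] eventually_gt_at_top[of 0]
  show "\<forall>\<^sub>F k in at_top. occupation_error k (indicator {0..<b}) \<le> ennreal \<delta>"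
  proof eventually_elim
    case (elim k)
    define e where "e = b * k powr - H"
    have "e > 0" using assms elim(2) by (simp add: e_def)
    have e: "k powr H = b / e" using assms elim(2) by (simp add: e_def powr_minus field_simps)
    let ?X = "\<lambda>w. 1 / e * occupation t (indicator {x..<x + e}) w - L w"
    have "occupation_error k (indicator {0..<b}) = (\<integral>\<^sup>+w. ennreal ((b * ?X w)\<^sup>2) \<partial>M)"
      unfolding occupation_error_def scaled_indicator[OF elim(2)] occupation_cmult
      using assms by (simp add: e algebra_simps flip: e_def)
    also have "\<dots> \<le> ennreal (b\<^sup>2 * (\<delta> / b\<^sup>2))"
      using elim(1) by (intro nn_integral_square_cmult_le) (auto simp: e_def)
    finally show ?case using assms by simp
  qed
qed

text \<open>The left average equals the right one plus a difference that tends to 0 in mean square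
  by \<open>second_moment_adjacent_le\<close>.\<close>

lemma occupation_converges_left:
  assumes "0 < b" shows "occupation_converges (indicator {-b..<0})"
  unfolding occupation_converges_def
proof (intro allI impI)
  fix \<delta> :: real assume "\<delta> > 0"
  \<comment> \<open>Then 1 - H (1 + \<theta>) = (1 - H) (2 - H) / 2 is positive, so the time weight
    is integrable, while \<theta> > 0 leaves a positive power of the interval length.\<close>
  define \<theta> where "\<theta> = (1 - H) / 2"
  have \<theta>: "0 < \<theta>" "\<theta> \<le> 1" using H_pos H_less_1 by (auto simp: \<theta>_def)
  have "H * (1 + \<theta>) < 1"
  proof -
    have "0 < (1 - H) * (2 - H)" using H_less_1 by simp
    then show ?thesis by (simp add: \<theta>_def field_simps)
  qed
  then have W: "pair_weight_integral H (H * (1 + \<theta>)) t < \<infinity>"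
    using H_less_1 t_nonneg by (intro pair_weight_integral_finite) auto
  define W0 where "W0 = enn2real (pair_weight_integral H (H * (1 + \<theta>)) t)"
  have W0: "pair_weight_integral H (H * (1 + \<theta>)) t = ennreal W0" "0 \<le> W0"
    using W by (auto simp: W0_def)
  let ?\<eta> = "\<lambda>k. b * k powr - H"
  have "((\<lambda>\<eta>. b\<^sup>2 * (2 * K\<^sup>2 * W0 * \<eta> powr \<theta>)) \<longlongrightarrow> b\<^sup>2 * (2 * K\<^sup>2 * W0 * 0)) (at_right 0)"
    using \<theta> eventually_at_right_less[of "0::real"]
    by (intro tendsto_intros tendsto_zero_powrI) (auto elim: eventually_mono)
  then have "\<forall>\<^sub>F \<eta> in at_right 0. b\<^sup>2 * (2 * K\<^sup>2 * W0 * \<eta> powr \<theta>) < \<delta> / 4"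
    using \<open>\<delta> > 0\<close> by (intro order_tendstoD(2)) auto
  from eventually_compose_filterlim[OF this filterlim_powr_neg_at_right_0[OF assms H_pos]]
  have small: "\<forall>\<^sub>F k in at_top. b\<^sup>2 * (2 * K\<^sup>2 * W0 * (?\<eta> k) powr \<theta>) < \<delta> / 4" .
  have right: "\<forall>\<^sub>F k in at_top. occupation_error k (indicator {0..<b}) \<le> ennreal (\<delta> / 4)"
    using occupation_converges_right[OF assms] \<open>\<delta> > 0\<close> by (simp add: occupation_converges_def)
  from small right eventually_gt_at_top[of 0]
  show "\<forall>\<^sub>F k in at_top. occupation_error k (indicator {-b..<0}) \<le> ennreal \<delta>"
  proof eventually_elim
    case (elim k)
    define e where "e = b * k powr - H"
    have "e > 0" using assms elim(3) by (simp add: e_def)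
    have e: "k powr H = b / e" using assms elim(3) by (simp add: e_def powr_minus field_simps)
    let ?l = "indicator {x - e..<x} :: real \<Rightarrow> real" and ?r = "indicator {x..<x + e} :: real \<Rightarrow> real"
    let ?h = "\<lambda>y. ?l y - ?r y"
    have int: "integrable lborel ?l" "integrable lborel ?r"
      using \<open>e > 0\<close> by (simp_all add: integrable_indicator_iff)
    have "AE w in M. occupation t (\<lambda>y. (-1) * ?r y + ?l y) w = (-1) * occupation t ?r w + occupation t ?l w"
      by (rule AE_occupation_linear[OF int(2,1) t_nonneg])
    then have AE: "AE w in M. occupation t ?l w = occupation t ?h w + occupation t ?r w"
      by eventually_elim simp
    have "occupation_error k (indicator {-b..<0}) = (\<integral>\<^sup>+w. ennreal ((b / e * occupation t ?l w - b * L w)\<^sup>2) \<partial>M)"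
      unfolding occupation_error_def scaled_indicator[OF elim(3)] occupation_cmult
      using assms by (simp add: e flip: e_def)
    also have "\<dots> = (\<integral>\<^sup>+w. ennreal ((b / e * occupation t ?h w + (b / e * occupation t ?r w - b * L w))\<^sup>2) \<partial>M)"
      using AE by (intro nn_integral_cong_AE, eventually_elim) (simp only: distrib_left add_diff_eq)
    also have "\<dots> \<le> ennreal (2 * (\<delta> / 4) + 2 * (\<delta> / 4))"
    proof (rule nn_integral_square_add_le)
      have "(\<integral>\<^sup>+w. ennreal ((occupation t ?h w)\<^sup>2) \<partial>M) \<le> ennreal (2 * K\<^sup>2 * e powr (2 + \<theta>)) * pair_weight_integral H (H * (1 + \<theta>)) t"
        unfolding occupation_def using \<theta> \<open>e > 0\<close> by (intro second_moment_adjacent_le) auto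
      also have "\<dots> = ennreal (2 * K\<^sup>2 * e powr (2 + \<theta>) * W0)"
        using W0 by (simp add: ennreal_mult)
      finally have "(\<integral>\<^sup>+w. ennreal ((b / e * occupation t ?h w)\<^sup>2) \<partial>M) \<le> ennreal ((b / e)\<^sup>2 * (2 * K\<^sup>2 * e powr (2 + \<theta>) * W0))"
        by (intro nn_integral_square_cmult_le) auto
      also have "(b / e)\<^sup>2 * (2 * K\<^sup>2 * e powr (2 + \<theta>) * W0) = b\<^sup>2 * (2 * K\<^sup>2 * W0 * e powr \<theta>)"
        using \<open>e > 0\<close> by (simp add: powr_add power_divide)
      also have "ennreal \<dots> \<le> ennreal (\<delta> / 4)"
        using elim(1) unfolding e_def by (intro ennreal_leI) simp
      finally show "(\<integral>\<^sup>+w. ennreal ((b / e * occupation t ?h w)\<^sup>2) \<partial>M) \<le> ennreal (\<delta> / 4)" .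
      have "occupation_error k (indicator {0..<b}) = (\<integral>\<^sup>+w. ennreal ((b / e * occupation t ?r w - b * L w)\<^sup>2) \<partial>M)"
        unfolding occupation_error_def scaled_indicator[OF elim(3)] occupation_cmult
        using assms by (simp add: e flip: e_def)
      then show "(\<integral>\<^sup>+w. ennreal ((b / e * occupation t ?r w - b * L w)\<^sup>2) \<partial>M) \<le> ennreal (\<delta> / 4)"
        using elim(2) by simp
    qed (use \<open>\<delta> > 0\<close> in auto)
    finally show ?case by simp
  qed
qed

theorem occupation_converges_integrable:
  assumes "integrable lborel f"
  shows "occupation_converges f"
  using assms
proof (induction rule: integrable_lborel_Ioc_induct)
  case (Ioc a b)
  \<comment> \<open>The signed indicator of the interval between 0 and \<open>c\<close>: wherever 0
    lies, \<open>indicator {a..<b}\<close> is \<open>S b\<close> minus \<open>S a\<close>, built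
    from one-sided intervals at 0.\<close>
  define S :: "real \<Rightarrow> real \<Rightarrow> real" where "S c = (if 0 \<le> c then indicator {0..<c} else (\<lambda>y. (-1) * indicator {c..<0} y + 0))" for c
  have int: "integrable lborel (indicator {c..<d} :: real \<Rightarrow> real)" for c d
    by (cases "c \<le> d") (simp_all add: integrable_indicator_iff)
  have zero: "occupation_converges (\<lambda>_. 0)"
    by (simp add: occupation_converges_def occupation_error_def occupation_def scaled_test_def)
  have S: "integrable lborel (S c)" "occupation_converges (S c)" for c
  proof -
    show "integrable lborel (S c)" using int by (simp add: S_def)
    consider "0 < c" | "c = 0" | "c < 0" by linarith
    then show "occupation_converges (S c)"
    proof cases
      case 1 then show ?thesis using occupation_converges_right by (simp add: S_def)
    next
      case 2
      then have "S c = (\<lambda>_. 0)" by (auto simp: S_def)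
      then show ?thesis using zero by simp
    next
      case 3
      then have "occupation_converges (\<lambda>y. (-1) * indicator {c..<0} y + 0)"
        using occupation_converges_left[of "-c"] int zero by (intro occupation_converges_linear) auto
      then show ?thesis using 3 by (simp add: S_def)
    qed
  qed
  have "(\<lambda>y. (-1) * S a y + S b y) = indicator {a..<b}"
    using Ioc by (auto simp: S_def fun_eq_iff indicator_def)
  with occupation_converges_linear[OF S(1)[of a] S(1)[of b] S(2)[of a] S(2)[of b], of "-1"]
  have Ico: "occupation_converges (indicator {a..<b})" by simp
  show ?case
  proof (rule occupation_converges_lim)
    show "integrable lborel (indicator {a<..b} :: real \<Rightarrow> real)"
      using Ioc by (simp add: integrable_indicator_iff)
    fix e :: real assume "e > 0"
    \<comment> \<open>Passing from [a, b) to (a, b] changes two points, hence nothing in L1.\<close>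
    have "AE y in lborel. \<bar>indicator {a<..b} y - indicator {a..<b} y :: real\<bar> = 0"
      using AE_lborel_singleton[of a] AE_lborel_singleton[of b] by eventually_elim (auto simp: indicator_def)
    then have "(LINT y|lborel. \<bar>indicator {a<..b} y - indicator {a..<b} y :: real\<bar>) = 0"
      by (intro integral_eq_zero_AE)
    then show "\<exists>g. integrable lborel g \<and> occupation_converges g \<and> (LINT y|lborel. \<bar>indicator {a<..b} y - g y\<bar>) < e"
      using int Ico \<open>e > 0\<close> by (intro exI[of _ "indicator {a..<b}"]) auto
  qed
next
  case (linear c f g)
  then show ?case by (intro occupation_converges_linear) auto
next
  case (lim f)
  then show ?case by (rule occupation_converges_lim)
qed

end

section \<open>Step integrals\<close>

definition valid_steps :: "(real \<times> real \<times> real) list \<Rightarrow> bool" where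
  "valid_steps p \<longleftrightarrow> (\<forall>(c, a, b) \<in> set p. a \<le> b)"

definition endpoints :: "(real \<times> real \<times> real) list \<Rightarrow> real set" where
  "endpoints p = (\<Union>(c, a, b) \<in> set p. {a, b})"

lemma valid_steps_simps [simp]:
  "valid_steps []" "valid_steps ((c, a, b) # p) \<longleftrightarrow> a \<le> b \<and> valid_steps p"
  by (simp_all add: valid_steps_def)

lemma endpoints_simps [simp]:
  "endpoints [] = {}" "endpoints ((c, a, b) # p) = insert a (insert b (endpoints p))"
  by (auto simp: endpoints_def)

definition is_grid :: "(nat \<Rightarrow> real) \<Rightarrow> nat \<Rightarrow> bool" where
  "is_grid T n \<longleftrightarrow> (\<forall>i<n. T i < T (Suc i))"

lemma finite_endpoints: "finite (endpoints p)"
  by (auto simp: endpoints_def)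

lemma grid_less:
  assumes "is_grid T n" "i < j" "j \<le> n" shows "T i < T j"
  using assms(2,3)
proof (induction j)
  case (Suc j)
  then have "T j < T (Suc j)" using assms(1) by (simp add: is_grid_def)
  then show ?case using Suc by (cases "i = j") auto
qed simp

lemma grid_less_iff:
  assumes "is_grid T n" "i \<le> n" "j \<le> n" shows "T i < T j \<longleftrightarrow> i < j"
  using grid_less[OF assms(1), of i j] grid_less[OF assms(1), of j i] assms(2,3)
  by (cases i j rule: linorder_cases) auto

lemma grid_le_iff:
  assumes "is_grid T n" "i \<le> n" "j \<le> n" shows "T i \<le> T j \<longleftrightarrow> i \<le> j"
  using grid_less_iff[OF assms(1,3,2)] by (simp add: not_less[symmetric])

lemma exists_grid:
  assumes "finite F" "F \<noteq> {}"
  obtains T n where "is_grid T n" "F = T ` {..n}"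
proof
  let ?l = "sorted_list_of_set F"
  have len: "length ?l = card F" and pos: "card F > 0"
    using assms by (simp_all add: card_gt_0_iff)
  show "is_grid ((!) ?l) (card F - 1)"
    unfolding is_grid_def using sorted_wrt_nth_less[OF strict_sorted_list_of_set[of F]] len by auto
  have "F = set ?l" using assms by simp
  also have "\<dots> = (!) ?l ` {..<card F}"
    unfolding set_conv_nth using len by auto
  also have "{..<card F} = {..card F - 1}" using pos by auto
  finally show "F = (!) ?l ` {..card F - 1}" .
qed

lemma step_integral_Cons: "step_integral Z ((c, a, b) # p) w = c * (Z b w - Z a w) + step_integral Z p w"
  by (simp add: step_integral_def)

lemma step_fun_Cons: "step_fun ((c, a, b) # p) v = c * indicator {a<..b} v + step_fun p v"
  by (simp add: step_fun_def)

lemma step_integral_Nil [simp]: "step_integral Z [] w = 0"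
  by (simp add: step_integral_def)

lemma step_fun_Nil [simp]: "step_fun [] v = 0"
  by (simp add: step_fun_def)

lemma step_fun_eq_0:
  "(\<And>c a b. (c, a, b) \<in> set p \<Longrightarrow> v \<notin> {a<..b}) \<Longrightarrow> step_fun p v = 0"
proof (induction p)
  case (Cons x p)
  then show ?case by (cases x) (simp add: step_fun_Cons indicator_def, metis)
qed simp

lemma measurable_step_fun [measurable]: "step_fun p \<in> borel_measurable borel"
proof (induction p)
  case (Cons x p)
  obtain c a b where x: "x = (c, a, b)" by (cases x)
  have "(\<lambda>v. c * indicator {a<..b} v + step_fun p v) \<in> borel_measurable borel"
    using Cons by (intro borel_measurable_add borel_measurable_times) auto
  also have "(\<lambda>v. c * indicator {a<..b} v + step_fun p v) = step_fun (x # p)"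
    by (simp add: x step_fun_Cons fun_eq_iff)
  finally show ?case .
next
  case Nil
  have "step_fun [] = (\<lambda>v. 0)" by (simp add: fun_eq_iff)
  then show ?case by simp
qed

text \<open>A grid through all endpoints turns overlapping intervals into a sum over disjoint
  increments. Since intervals contain their right end, the value of the step function on a cell is
  read off at \<open>T (Suc i)\<close>.\<close>

lemma step_integral_grid:
  assumes T: "is_grid T n" and "valid_steps p" "endpoints p \<subseteq> T ` {..n}"
  shows "step_integral Z p w = (\<Sum>i<n. step_fun p (T (Suc i)) * (Z (T (Suc i)) w - Z (T i) w))"
  using assms(2,3)
proof (induction p)
  case (Cons x p)
  obtain c a b where x: "x = (c, a, b)" by (cases x)
  have IH: "step_integral Z p w = (\<Sum>i<n. step_fun p (T (Suc i)) * (Z (T (Suc i)) w - Z (T i) w))"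
    using Cons.prems by (intro Cons.IH) (simp_all add: x)
  have ab: "a \<le> b" "a \<in> T ` {..n}" "b \<in> T ` {..n}"
    using Cons.prems by (simp_all add: x)
  then obtain j k where jk: "a = T j" "b = T k" "j \<le> n" "k \<le> n"
    by blast
  moreover have "j \<le> k"
    using ab(1) jk grid_le_iff[OF T, of j k] by simp
  ultimately have jk: "a = T j" "b = T k" "j \<le> n" "k \<le> n" "j \<le> k" .
  \<comment> \<open>The increment telescopes over the cells between the grid indices of
    \<open>a\<close> and \<open>b\<close>.\<close>
  have "Z b w - Z a w = (\<Sum>i = j..<k. Z (T (Suc i)) w - Z (T i) w)"
    using jk by (simp add: sum_Suc_diff'[of j k "\<lambda>i. Z (T i) w"])
  also have "\<dots> = (\<Sum>i<n. indicator {a<..b} (T (Suc i)) * (Z (T (Suc i)) w - Z (T i) w))"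
  proof -
    have "T (Suc i) \<in> {a<..b} \<longleftrightarrow> i \<in> {j..<k}" if "i < n" for i
      using jk that grid_less_iff[OF T, of j "Suc i"] grid_le_iff[OF T, of "Suc i" k] by auto
    then have "indicator {a<..b} (T (Suc i)) = (indicator {j..<k} i :: real)" if "i < n" for i
      using that by (simp only: indicator_def)
    then show ?thesis
      using jk by (intro sum.mono_neutral_cong_left) (auto simp: not_less)
  qed
  finally have eq: "Z b w - Z a w = (\<Sum>i<n. indicator {a<..b} (T (Suc i)) * (Z (T (Suc i)) w - Z (T i) w))" .
  show ?case
    unfolding x step_integral_Cons step_fun_Cons IH eq
    by (simp only: sum_distrib_left distrib_right sum.distrib mult.assoc)
qed simp

text \<open>A step function is the step integral with respect to the process
  \<open>b \<mapsto> 1\<^bsub>v \<le> b\<^esub>\<close>, so the previous lemma also expands it on the grid.\<close>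

lemma step_fun_grid:
  assumes "is_grid T n" "valid_steps p" "endpoints p \<subseteq> T ` {..n}"
  shows "step_fun p v = (\<Sum>i<n. step_fun p (T (Suc i)) * indicator {T i<..T (Suc i)} v)"
proof -
  have ind: "indicator {..b} v - indicator {..a} v = (indicator {a<..b} v :: real)" if "a \<le> b" for a b
    using that by (auto simp: indicator_def)
  have "step_fun p v = step_integral (\<lambda>b v. indicator {..b} v) p v"
    using assms(2) unfolding step_fun_def step_integral_def
    by (intro arg_cong[where f=sum_list] map_cong) (auto simp: valid_steps_def ind)
  also have "\<dots> = (\<Sum>i<n. step_fun p (T (Suc i)) * (indicator {..T (Suc i)} v - indicator {..T i} v))"
    by (rule step_integral_grid[OF assms])
  also have "\<dots> = (\<Sum>i<n. step_fun p (T (Suc i)) * indicator {T i<..T (Suc i)} v)"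
    using assms(1) by (intro sum.cong refl) (simp add: ind is_grid_def less_imp_le)
  finally show ?thesis .
qed

text \<open>The \<alpha>-th power of the quasi-norm in which integrands are approximated. Times
  |\<xi>|^\<alpha> it is the negative logarithm of the modulus of the characteristic function of the
  step integral.\<close>

definition step_energy :: "real \<Rightarrow> (real \<times> real \<times> real) list \<Rightarrow> ennreal" where
  "step_energy \<alpha> p = (\<integral>\<^sup>+v. ennreal (\<bar>step_fun p v\<bar> powr \<alpha>) \<partial>lborel)"

text \<open>At each point at most one cell is active, so the power passes through the sum.\<close>

lemma step_energy_grid:
  assumes T: "is_grid T n" and p: "valid_steps p" "endpoints p \<subseteq> T ` {..n}"
  shows "step_energy \<alpha> p = ennreal (\<Sum>i<n. \<bar>step_fun p (T (Suc i))\<bar> powr \<alpha> * (T (Suc i) - T i))"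
proof -
  let ?J = "\<lambda>i. {T i<..T (Suc i)}"
  have le: "T i \<le> T (Suc i)" if "i < n" for i
    using T that by (simp add: is_grid_def less_imp_le)
  have pointwise: "\<bar>step_fun p v\<bar> powr \<alpha> = (\<Sum>i<n. \<bar>step_fun p (T (Suc i))\<bar> powr \<alpha> * indicator (?J i) v)" for v
  proof (cases "\<exists>i<n. v \<in> ?J i")
    case True
    then obtain i where i: "i < n" "v \<in> ?J i" by auto
    have ind: "indicator (?J j) v = (if j = i then 1 else 0 :: real)" if "j < n" for j
    proof (cases j i rule: linorder_cases)
      case less
      then have "T (Suc j) \<le> T i" using i grid_le_iff[OF T, of "Suc j" i] by simp
      then show ?thesis using i less by simp
    next
      case greater
      then have "T (Suc i) \<le> T j" using that grid_le_iff[OF T, of "Suc i" j] by simp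
      then show ?thesis using i greater by simp
    qed (use i in simp)
    have sum_eq: "(\<Sum>j<n. d j * indicator (?J j) v) = d i" for d :: "nat \<Rightarrow> real"
    proof -
      have "(\<Sum>j<n. d j * indicator (?J j) v) = (\<Sum>j<n. if j = i then d j else 0)"
        by (intro sum.cong refl) (simp add: ind)
      then show ?thesis using i by simp
    qed
    show ?thesis
      by (subst step_fun_grid[OF assms]) (simp only: sum_eq)
  next
    case False
    then have "indicator (?J i) v = (0 :: real)" if "i < n" for i using that by simp
    then show ?thesis by (subst step_fun_grid[OF assms]) simp
  qed
  have "step_energy \<alpha> p = (\<integral>\<^sup>+v. (\<Sum>i<n. ennreal (\<bar>step_fun p (T (Suc i))\<bar> powr \<alpha>) * indicator (?J i) v) \<partial>lborel)"
    unfolding step_energy_def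
  proof (intro nn_integral_cong)
    fix v
    have "ennreal (\<bar>step_fun p v\<bar> powr \<alpha>) = (\<Sum>i<n. ennreal (\<bar>step_fun p (T (Suc i))\<bar> powr \<alpha> * indicator (?J i) v))"
      unfolding pointwise[of v] by (intro sum_ennreal[symmetric]) simp
    then show "ennreal (\<bar>step_fun p v\<bar> powr \<alpha>) = (\<Sum>i<n. ennreal (\<bar>step_fun p (T (Suc i))\<bar> powr \<alpha>) * indicator (?J i) v)"
      by (simp add: ennreal_mult' ennreal_indicator)
  qed
  also have "\<dots> = (\<Sum>i<n. ennreal (\<bar>step_fun p (T (Suc i))\<bar> powr \<alpha>) * emeasure lborel (?J i))"
    by (subst nn_integral_sum) (auto intro!: sum.cong nn_integral_cmult_indicator)
  also have "\<dots> = (\<Sum>i<n. ennreal (\<bar>step_fun p (T (Suc i))\<bar> powr \<alpha> * (T (Suc i) - T i)))"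
    using le by (intro sum.cong refl) (simp add: ennreal_mult)
  also have "\<dots> = ennreal (\<Sum>i<n. \<bar>step_fun p (T (Suc i))\<bar> powr \<alpha> * (T (Suc i) - T i))"
    using le by (intro sum_ennreal) simp
  finally show ?thesis .
qed

section \<open>Characteristic functions and independence of step integrals\<close>

locale stable_levy_process = prob_space M for M :: "'w measure" +
  fixes \<alpha> \<beta> :: real and Z :: "real \<Rightarrow> 'w \<Rightarrow> real"
  assumes levy: "stable_levy_motion M \<alpha> \<beta> Z"
begin

lemma \<alpha>_pos: "0 < \<alpha>" and \<beta>_le: "\<bar>\<beta>\<bar> \<le> 1"
  using levy by (auto simp: stable_levy_motion_def)

lemma measurable_Z [measurable]: "Z t \<in> borel_measurable M"
  using levy by (simp add: stable_levy_motion_def)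

lemma AE_Z_0: "AE w in M. Z 0 w = 0"
  using levy by (simp add: stable_levy_motion_def)

lemma indep_increments:
  assumes "is_grid T n"
  shows "indep_vars (\<lambda>_. borel) (\<lambda>i w. Z (T (Suc i)) w - Z (T i) w) {..<n}"
  using levy assms by (auto simp: stable_levy_motion_def is_grid_def)

lemma char_increment:
  assumes "s < t"
  shows "char (distr M borel (\<lambda>w. Z t w - Z s w)) u =
    exp (- (complex_of_real ((t - s) * \<bar>u\<bar> powr \<alpha>) * (1 + \<i> * complex_of_real (\<beta> * sgn u * tan (pi * \<alpha> / 2)))))"
  using levy assms unfolding stable_levy_motion_def by blast

lemma measurable_step_integral [measurable]: "step_integral Z p \<in> borel_measurable M"
proof (induction p)
  case (Cons x p)
  obtain c a b where x: "x = (c, a, b)" by (cases x)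
  have "(\<lambda>w. c * (Z b w - Z a w) + step_integral Z p w) \<in> borel_measurable M"
    using Cons by (intro borel_measurable_add borel_measurable_times borel_measurable_diff) auto
  also have "(\<lambda>w. c * (Z b w - Z a w) + step_integral Z p w) = step_integral Z (x # p)"
    by (simp add: x step_integral_Cons fun_eq_iff)
  finally show ?case .
next
  case Nil
  have "step_integral Z [] = (\<lambda>w. 0)" by (simp add: fun_eq_iff)
  then show ?case by simp
qed

text \<open>Increments over a grid are independent, so their exponents add. Skewness affects only
  the imaginary part of the exponent, which the last clause bounds by a multiple of the real part;
  small energy therefore makes the whole exponent small.\<close>

lemma char_step_integral:
  assumes p: "valid_steps p"
  obtains w where "char (distr M borel (step_integral Z p)) \<xi> = exp (- w)"
    and "ennreal (Re w) = ennreal (\<bar>\<xi>\<bar> powr \<alpha>) * step_energy \<alpha> p" "0 \<le> Re w"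
    and "cmod w \<le> (1 + \<bar>tan (pi * \<alpha> / 2)\<bar>) * Re w"
proof -
  \<comment> \<open>The point 0 is added to keep the set of grid points nonempty when
    \<open>p\<close> has no endpoints.\<close>
  obtain T n where T: "is_grid T n" and F: "insert 0 (endpoints p) = T ` {..n}"
    by (rule exists_grid[of "insert 0 (endpoints p)"]) (auto simp: finite_endpoints)
  have ep: "endpoints p \<subseteq> T ` {..n}" using F by auto
  let ?d = "\<lambda>i. step_fun p (T (Suc i))"
  let ?X = "\<lambda>i w. ?d i * (Z (T (Suc i)) w - Z (T i) w)"
  define r where "r i = (T (Suc i) - T i) * \<bar>\<xi> * ?d i\<bar> powr \<alpha>" for i
  define w where "w i = complex_of_real (r i) * (1 + \<i> * complex_of_real (\<beta> * sgn (\<xi> * ?d i) * tan (pi * \<alpha> / 2)))" for i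
  have less: "T i < T (Suc i)" if "i < n" for i using T that by (simp add: is_grid_def)
  have r0: "0 \<le> r i" if "i < n" for i using less[OF that] by (simp add: r_def)
  have sum_r0: "0 \<le> (\<Sum>i<n. r i)" using r0 by (intro sum_nonneg) auto
  have Re_w: "Re (\<Sum>i<n. w i) = (\<Sum>i<n. r i)" by (simp add: w_def)
  have "step_integral Z p = (\<lambda>w. \<Sum>i<n. ?X i w)"
    by (intro ext step_integral_grid T p ep)
  moreover have "indep_vars (\<lambda>_. borel) ?X {..<n}"
    by (rule indep_vars_compose2[OF indep_increments[OF T]]) auto
  ultimately have "char (distr M borel (step_integral Z p)) \<xi> = (\<Prod>i<n. char (distr M borel (?X i)) \<xi>)"
    by (simp add: char_distr_sum)
  also have "\<dots> = (\<Prod>i<n. exp (- w i))"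
  proof (intro prod.cong refl)
    fix i assume "i \<in> {..<n}"
    have "char (distr M borel (?X i)) \<xi> = char (distr M borel (\<lambda>w. Z (T (Suc i)) w - Z (T i) w)) (\<xi> * ?d i)"
      unfolding char_def by (simp add: integral_distr mult.assoc)
    also have "\<dots> = exp (- w i)"
      using less \<open>i \<in> {..<n}\<close> by (subst char_increment) (auto simp: w_def r_def)
    finally show "char (distr M borel (?X i)) \<xi> = exp (- w i)" .
  qed
  also have "\<dots> = exp (- (\<Sum>i<n. w i))"
    by (simp add: exp_sum sum_negf[symmetric])
  finally have "char (distr M borel (step_integral Z p)) \<xi> = exp (- (\<Sum>i<n. w i))" .
  moreover have "ennreal (Re (\<Sum>i<n. w i)) = ennreal (\<bar>\<xi>\<bar> powr \<alpha>) * step_energy \<alpha> p"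
  proof -
    have "Re (\<Sum>i<n. w i) = \<bar>\<xi>\<bar> powr \<alpha> * (\<Sum>i<n. \<bar>?d i\<bar> powr \<alpha> * (T (Suc i) - T i))"
      unfolding Re_w sum_distrib_left
      by (intro sum.cong refl) (simp add: r_def abs_mult powr_mult mult_ac)
    then show ?thesis
      unfolding step_energy_grid[OF T p ep] by (simp add: ennreal_mult')
  qed
  moreover have "cmod (\<Sum>i<n. w i) \<le> (1 + \<bar>tan (pi * \<alpha> / 2)\<bar>) * Re (\<Sum>i<n. w i)"
  proof -
    have "cmod (w i) \<le> (1 + \<bar>tan (pi * \<alpha> / 2)\<bar>) * r i" if "i < n" for i
    proof -
      let ?y = "\<beta> * sgn (\<xi> * ?d i) * tan (pi * \<alpha> / 2)"
      have "\<bar>?y\<bar> \<le> 1 * 1 * \<bar>tan (pi * \<alpha> / 2)\<bar>"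
        unfolding abs_mult using \<beta>_le by (intro mult_mono) (auto simp: abs_sgn_eq)
      moreover have "cmod (1 + \<i> * complex_of_real ?y) \<le> 1 + \<bar>?y\<bar>"
        using norm_triangle_ineq[of 1 "\<i> * complex_of_real ?y"]
        by (simp only: norm_one norm_mult norm_ii norm_of_real mult_1_left)
      ultimately have "cmod (1 + \<i> * complex_of_real ?y) \<le> 1 + \<bar>tan (pi * \<alpha> / 2)\<bar>" by linarith
      then have "r i * cmod (1 + \<i> * complex_of_real ?y) \<le> r i * (1 + \<bar>tan (pi * \<alpha> / 2)\<bar>)"
        using r0[OF that] by (rule mult_left_mono)
      then show ?thesis using r0[OF that] unfolding w_def norm_mult by (simp add: mult.commute)
    qed
    then have "cmod (\<Sum>i<n. w i) \<le> (\<Sum>i<n. (1 + \<bar>tan (pi * \<alpha> / 2)\<bar>) * r i)"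
      by (intro sum_norm_le) simp
    then show ?thesis unfolding Re_w sum_distrib_left .
  qed
  ultimately show ?thesis
    using that sum_r0 Re_w by auto
qed

lemma indep_var_step_integrals:
  fixes f :: "real \<Rightarrow> real \<Rightarrow> 'b::{second_countable_topology, topological_space}"
    and g :: "real \<Rightarrow> 'b"
  assumes valid: "valid_steps p" "valid_steps q" "valid_steps r"
    and past: "endpoints p \<subseteq> {..s}" "endpoints q \<subseteq> {..s}" and future: "endpoints r \<subseteq> {s..}"
    and [measurable]: "case_prod f \<in> borel_measurable (borel \<Otimes>\<^sub>M borel)" "g \<in> borel_measurable borel"
  shows "indep_var borel (\<lambda>w. f (step_integral Z p w) (step_integral Z q w)) borel (\<lambda>w. g (step_integral Z r w))"
proof -
  obtain T n where T: "is_grid T n" and F: "insert s (endpoints p \<union> endpoints q \<union> endpoints r) = T ` {..n}"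
    by (rule exists_grid[of "insert s (endpoints p \<union> endpoints q \<union> endpoints r)"]) (auto simp: finite_endpoints)
  then obtain m where m: "m \<le> n" "s = T m" by auto
  have ep: "endpoints p \<subseteq> T ` {..n}" "endpoints q \<subseteq> T ` {..n}" "endpoints r \<subseteq> T ` {..n}"
    using F by auto
  let ?X = "\<lambda>i w. Z (T (Suc i)) w - Z (T i) w"
  have past_eq: "step_integral Z l w = (\<Sum>i<m. step_fun l (T (Suc i)) * ?X i w)"
    if l: "valid_steps l" "endpoints l \<subseteq> T ` {..n}" "endpoints l \<subseteq> {..s}" for l w
  proof -
    \<comment> \<open>A cell with index at least \<open>m\<close> has its right end strictly beyond
      \<open>s\<close>, where no past interval reaches.\<close>
    have zero: "step_fun l (T (Suc i)) = 0" if "i \<in> {..<n} - {..<m}" for i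
    proof -
      have "s < T (Suc i)" using that m grid_less_iff[OF T, of m "Suc i"] by auto
      then show ?thesis
        using l(3) by (intro step_fun_eq_0) (fastforce simp: endpoints_def)
    qed
    show ?thesis
      unfolding step_integral_grid[OF T l(1,2)] using m zero
      by (intro sum.mono_neutral_right) auto
  qed
  have future_eq: "step_integral Z r w = (\<Sum>i=m..<n. step_fun r (T (Suc i)) * ?X i w)" for w
  proof -
    \<comment> \<open>A cell with index below \<open>m\<close> ends at \<open>s\<close> at the
      latest, and \<open>s\<close> itself is excluded because intervals are open on the
      left.\<close>
    have zero: "step_fun r (T (Suc i)) = 0" if "i \<in> {..<n} - {m..<n}" for i
    proof -
      have "T (Suc i) \<le> s" using that m grid_le_iff[OF T, of "Suc i" m] by auto
      then show ?thesis
        using future by (intro step_fun_eq_0) (fastforce simp: endpoints_def)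
    qed
    show ?thesis
      unfolding step_integral_grid[OF T valid(3) ep(3)] using zero
      by (intro sum.mono_neutral_right) auto
  qed
  have indep: "indep_var (PiM {..<m} (\<lambda>_. borel)) (\<lambda>w. restrict (\<lambda>i. ?X i w) {..<m})
      (PiM {m..<n} (\<lambda>_. borel)) (\<lambda>w. restrict (\<lambda>i. ?X i w) {m..<n})"
    using m by (intro indep_var_restrict[OF indep_increments[OF T]]) auto
  let ?S = "\<lambda>l x. \<Sum>i<m. step_fun l (T (Suc i)) * x i" and ?T = "\<lambda>x. \<Sum>i=m..<n. step_fun r (T (Suc i)) * x i"
  have [measurable]: "?S l \<in> borel_measurable (PiM {..<m} (\<lambda>_. borel))" for l by measurable
  have [measurable]: "?T \<in> borel_measurable (PiM {m..<n} (\<lambda>_. borel))" by measurable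
  have "(\<lambda>x. f (?S p x) (?S q x)) \<in> borel_measurable (PiM {..<m} (\<lambda>_. borel))"
    using measurable_compose[OF measurable_Pair[of "?S p" _ borel "?S q" borel] assms(7)] by simp
  moreover have "(\<lambda>x. g (?T x)) \<in> borel_measurable (PiM {m..<n} (\<lambda>_. borel))" by measurable
  ultimately have "indep_var borel ((\<lambda>x. f (?S p x) (?S q x)) \<circ> (\<lambda>w. restrict (\<lambda>i. ?X i w) {..<m}))
      borel ((\<lambda>x. g (?T x)) \<circ> (\<lambda>w. restrict (\<lambda>i. ?X i w) {m..<n}))"
    by (rule indep_var_compose[OF indep])
  then show ?thesis
    using valid past ep by (simp add: past_eq future_eq comp_def)
qed

end

section \<open>Local nondeterminism of stable integrals\<close>

text \<open>Endpoints are clamped at \<open>s\<close> rather than triples deleted: an interval on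
  the wrong side collapses to the empty (s, s] and contributes nothing, and the list keeps its shape
  for induction.\<close>

definition past_steps :: "real \<Rightarrow> (real \<times> real \<times> real) list \<Rightarrow> (real \<times> real \<times> real) list" where
  "past_steps s = map (\<lambda>(c, a, b). (c, min a s, min b s))"

definition future_steps :: "real \<Rightarrow> (real \<times> real \<times> real) list \<Rightarrow> (real \<times> real \<times> real) list" where
  "future_steps s = map (\<lambda>(c, a, b). (c, max a s, max b s))"

lemma past_future_simps [simp]:
  "past_steps s [] = []" "past_steps s ((c, a, b) # p) = (c, min a s, min b s) # past_steps s p"
  "future_steps s [] = []" "future_steps s ((c, a, b) # p) = (c, max a s, max b s) # future_steps s p"
  by (simp_all add: past_steps_def future_steps_def)

lemma valid_past_steps: "valid_steps p \<Longrightarrow> valid_steps (past_steps s p)"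
  by (induction p) (auto simp: min_def)

lemma valid_future_steps: "valid_steps p \<Longrightarrow> valid_steps (future_steps s p)"
  by (induction p) (auto simp: max_def)

lemma endpoints_past_steps: "endpoints (past_steps s p) \<subseteq> {..s}"
  by (induction p) auto

lemma endpoints_future_steps: "endpoints (future_steps s p) \<subseteq> {s..}"
  by (induction p) auto

lemma step_integral_past_future:
  "step_integral Z p w = step_integral Z (past_steps s p) w + step_integral Z (future_steps s p) w"
proof (induction p)
  case (Cons x p)
  obtain c a b where x: "x = (c, a, b)" by (cases x)
  have "Z b w - Z a w = (Z (min b s) w - Z (min a s) w) + (Z (max b s) w - Z (max a s) w)"
    by (simp add: min_def max_def)
  then show ?case using Cons by (simp add: x step_integral_Cons distrib_left)
qed simp

lemma step_fun_future_steps: "step_fun (future_steps s p) v = indicator {s<..} v * step_fun p v"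
proof (induction p)
  case (Cons x p)
  obtain c a b where x: "x = (c, a, b)" by (cases x)
  have "indicator {max a s<..max b s} v = (indicator {s<..} v * indicator {a<..b} v :: real)"
    by (auto simp: indicator_def max_def split: if_splits)
  then show ?case using Cons by (simp only: x past_future_simps step_fun_Cons distrib_left mult.left_commute)
qed simp

lemma step_energy_future_steps:
  "step_energy \<alpha> (future_steps s p) = (\<integral>\<^sup>+v. ennreal (\<bar>step_fun p v\<bar> powr \<alpha>) * indicator {s<..} v \<partial>lborel)"
  unfolding step_energy_def step_fun_future_steps by (intro nn_integral_cong) (simp add: indicator_def)

section \<open>Truncated distances and convergence in probability\<close>

lemma cmod_iexp_diff_le: "cmod (iexp x - iexp y) \<le> \<bar>x - y\<bar>"
proof -
  have "iexp x - iexp y = iexp y * (iexp (x - y) - 1)"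
    by (simp add: right_diff_distrib flip: exp_add)
  then have "cmod (iexp x - iexp y) = cmod (iexp (x - y) - 1)"
    by (simp add: norm_mult)
  also have "\<dots> \<le> \<bar>x - y\<bar>" using iexp_approx1[of "x - y" 0] by simp
  finally show ?thesis .
qed

text \<open>Differences that are both bounded and Lipschitz are thereby controlled by the truncated
  distance \<open>min 1 d\<close>, in which convergence in probability is measured below.\<close>

lemma min_one_mult_le:
  fixes c d l :: real
  assumes "0 \<le> l" "0 \<le> d" "0 \<le> c" shows "min c (l * d) \<le> (c + l) * min 1 d"
proof (cases "d \<le> 1")
  case True
  have "l * d \<le> (c + l) * d" using assms by (intro mult_right_mono) auto
  then show ?thesis using True by (simp add: min_def)
next
  case False
  then show ?thesis using assms by (simp add: min_def)
qed

text \<open>A substitute for the triangle inequality that also covers \<alpha> < 1: |x| is at most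
  twice the larger of the two terms.\<close>

lemma powr_abs_le_add:
  fixes x y \<alpha> :: real
  assumes "0 < \<alpha>" shows "\<bar>x\<bar> powr \<alpha> \<le> 2 powr \<alpha> * (\<bar>x - y\<bar> powr \<alpha> + \<bar>y\<bar> powr \<alpha>)"
proof -
  have "\<bar>x\<bar> \<le> 2 * max \<bar>x - y\<bar> \<bar>y\<bar>" by (auto simp: max_def abs_if)
  then have "\<bar>x\<bar> powr \<alpha> \<le> (2 * max \<bar>x - y\<bar> \<bar>y\<bar>) powr \<alpha>"
    using assms by (intro powr_mono2) auto
  also have "\<dots> = 2 powr \<alpha> * (max \<bar>x - y\<bar> \<bar>y\<bar>) powr \<alpha>"
    by (simp add: powr_mult)
  also have "\<dots> \<le> 2 powr \<alpha> * (\<bar>x - y\<bar> powr \<alpha> + \<bar>y\<bar> powr \<alpha>)"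
    by (intro mult_left_mono) (auto simp: max_def)
  finally show ?thesis .
qed

context prob_space
begin

text \<open>The truncated distance is at most \<open>e\<close> plus the indicator of a deviation
  above \<open>e\<close>. A single expectation that tends to 0 is easier to add and compare than
  probabilities of deviations.\<close>

lemma tendsto_expectation_min_one:
  assumes lim: "tendsto_in_prob M X X'" and [measurable]: "\<And>n. X n \<in> borel_measurable M" "X' \<in> borel_measurable M"
  shows "(\<lambda>n. expectation (\<lambda>w. min 1 \<bar>X n w - X' w\<bar>)) \<longlonglongrightarrow> 0"
proof (rule order_tendstoI)
  let ?E = "\<lambda>n. expectation (\<lambda>w. min 1 \<bar>X n w - X' w\<bar>)"
  have int: "integrable M (\<lambda>w. min 1 \<bar>X n w - X' w\<bar>)" for n
    by (intro integrable_const_bound[where B=1]) auto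
  fix a :: real
  { assume "a < 0"
    moreover have "0 \<le> ?E n" for n by (intro Bochner_Integration.integral_nonneg) auto
    ultimately show "\<forall>\<^sub>F n in sequentially. a < ?E n"
      by (intro always_eventually allI) (auto intro: less_le_trans) }
  assume "0 < a"
  define e where "e = a / 2"
  have "e > 0" using \<open>0 < a\<close> by (simp add: e_def)
  let ?A = "\<lambda>n. {w \<in> space M. e < \<bar>X n w - X' w\<bar>}"
  have "?E n \<le> e + prob (?A n)" for n
  proof -
    have "?E n \<le> expectation (\<lambda>w. e + indicator (?A n) w)"
      using \<open>e > 0\<close>
      by (intro integral_mono int Bochner_Integration.integrable_add integrable_const integrable_real_indicator)
        (auto simp: indicator_def less_top[symmetric])
    also have "\<dots> = e + prob (?A n)"
      by (simp add: prob_space emeasure_eq_measure integrable_indicator_iff)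
    finally show ?thesis .
  qed
  moreover have "\<forall>\<^sub>F n in sequentially. prob (?A n) < e"
    using lim \<open>e > 0\<close> unfolding tendsto_in_prob_def by (intro order_tendstoD(2)) auto
  ultimately show "\<forall>\<^sub>F n in sequentially. ?E n < a"
    by (elim eventually_mono) (smt (verit) e_def field_sum_of_halves)
qed

end

context stable_levy_process
begin

lemma expectation_future_decouple:
  fixes \<phi> :: "real \<Rightarrow> real"
  assumes p: "valid_steps p" and q: "valid_steps q"
    and [measurable]: "\<phi> \<in> borel_measurable borel" and \<phi>: "\<And>x. 0 \<le> \<phi> x" "\<And>x. \<phi> x \<le> 1"
    and e: "ennreal e \<le> step_energy \<alpha> (future_steps s p)"
  shows "cmod (CLINT w|M. \<phi> (step_integral Z (past_steps s q) w) *\<^sub>R iexp (\<xi> * step_integral Z p w))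
    \<le> (LINT w|M. \<phi> (step_integral Z (past_steps s q) w)) * exp (- (\<bar>\<xi>\<bar> powr \<alpha> * e))"
proof -
  let ?Q = "step_integral Z (past_steps s q)" and ?P = "step_integral Z (past_steps s p)" and ?F = "step_integral Z (future_steps s p)"
  let ?U = "\<lambda>w. \<phi> (?Q w) *\<^sub>R iexp (\<xi> * ?P w)" and ?V = "\<lambda>w. iexp (\<xi> * ?F w)"
  have \<phi>_int: "integrable M (\<lambda>w. \<phi> (?Q w))"
    using \<phi> by (intro integrable_const_bound[where B=1]) auto
  have int: "integrable M ?U" "integrable M ?V"
    using \<phi> by (auto intro!: integrable_const_bound[where B=1])
  have "indep_var borel ?U borel ?V"
    by (rule indep_var_step_integrals[where s=s and f="\<lambda>x y. \<phi> x *\<^sub>R iexp (\<xi> * y)" and g="\<lambda>x. iexp (\<xi> * x)"])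
      (auto intro: p q valid_past_steps valid_future_steps simp: endpoints_past_steps endpoints_future_steps)
  then have "(CLINT w|M. ?U w * ?V w) = (CLINT w|M. ?U w) * (CLINT w|M. ?V w)"
    using int by (rule indep_var_lebesgue_integral)
  moreover have prod: "?U w * ?V w = \<phi> (?Q w) *\<^sub>R iexp (\<xi> * step_integral Z p w)" for w
    by (simp add: step_integral_past_future[of Z p w s] distrib_left exp_add)
  ultimately have eq: "(CLINT w|M. \<phi> (?Q w) *\<^sub>R iexp (\<xi> * step_integral Z p w)) = (CLINT w|M. ?U w) * (CLINT w|M. ?V w)"
    by (simp only: prod)
  have U_le: "cmod (CLINT w|M. ?U w) \<le> (LINT w|M. \<phi> (?Q w))"
    using \<phi> by (intro norm_integral_le_integral int \<phi>_int) auto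
  have V_le: "cmod (CLINT w|M. ?V w) \<le> exp (- (\<bar>\<xi>\<bar> powr \<alpha> * e))"
  proof -
    obtain w where w: "char (distr M borel ?F) \<xi> = exp (- w)"
      "ennreal (Re w) = ennreal (\<bar>\<xi>\<bar> powr \<alpha>) * step_energy \<alpha> (future_steps s p)" "0 \<le> Re w"
      by (rule char_step_integral[OF valid_future_steps[OF p, of s], of \<xi>]) blast
    have "ennreal (\<bar>\<xi>\<bar> powr \<alpha> * e) = ennreal (\<bar>\<xi>\<bar> powr \<alpha>) * ennreal e"
      by (rule ennreal_mult') simp
    also have "\<dots> \<le> ennreal (Re w)"
      unfolding w(2) using e by (intro mult_left_mono) auto
    finally have "\<bar>\<xi>\<bar> powr \<alpha> * e \<le> Re w" using w(3) by (simp add: ennreal_le_iff)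
    moreover have "(CLINT w|M. ?V w) = exp (- w)"
      using w(1) unfolding char_def by (simp add: integral_distr)
    ultimately show ?thesis by simp
  qed
  show ?thesis
    unfolding eq norm_mult using U_le V_le by (intro mult_mono) (auto intro: order_trans[OF norm_ge_zero])
qed

lemma char_step_integral_tendsto_1:
  assumes valid: "\<And>n. valid_steps (p n)" and lim: "(\<lambda>n. step_energy \<alpha> (p n)) \<longlonglongrightarrow> 0"
  shows "(\<lambda>n. char (distr M borel (step_integral Z (p n))) \<xi>) \<longlonglongrightarrow> 1"
proof -
  let ?C = "1 + \<bar>tan (pi * \<alpha> / 2)\<bar>"
  have "\<exists>w. char (distr M borel (step_integral Z (p n))) \<xi> = exp (- w) \<and>
      ennreal (Re w) = ennreal (\<bar>\<xi>\<bar> powr \<alpha>) * step_energy \<alpha> (p n) \<and> 0 \<le> Re w \<and> cmod w \<le> ?C * Re w" for n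
    by (rule char_step_integral[OF valid, of n \<xi>]) blast
  then obtain w where w: "\<And>n. char (distr M borel (step_integral Z (p n))) \<xi> = exp (- w n)"
    "\<And>n. ennreal (Re (w n)) = ennreal (\<bar>\<xi>\<bar> powr \<alpha>) * step_energy \<alpha> (p n)"
    "\<And>n. 0 \<le> Re (w n)" "\<And>n. cmod (w n) \<le> ?C * Re (w n)"
    by metis
  have "(\<lambda>n. ennreal (\<bar>\<xi>\<bar> powr \<alpha>) * step_energy \<alpha> (p n)) \<longlonglongrightarrow> ennreal (\<bar>\<xi>\<bar> powr \<alpha>) * 0"
    by (intro ennreal_tendsto_cmult lim) simp
  then have "(\<lambda>n. ennreal (Re (w n))) \<longlonglongrightarrow> ennreal 0" by (simp add: w(2))
  then have "(\<lambda>n. Re (w n)) \<longlonglongrightarrow> 0"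
    by (rule tendsto_ennrealD) (auto simp: w(3))
  then have "(\<lambda>n. ?C * Re (w n)) \<longlonglongrightarrow> 0" by (rule tendsto_mult_right_zero)
  then have "w \<longlonglongrightarrow> 0"
    by (rule Lim_null_comparison[rotated]) (simp add: w(4))
  then have "(\<lambda>n. exp (- w n)) \<longlonglongrightarrow> exp (- 0)" by (intro tendsto_intros)
  then show ?thesis by (simp add: w(1))
qed

text \<open>By Levy's continuity theorem, characteristic functions tending to 1 give weak
  convergence to the point mass at 0, which is tested on the bounded continuous function
  \<open>min 1 \<bar>x\<bar>\<close>.\<close>

lemma expectation_min_one_step_integral_tendsto_0:
  assumes valid: "\<And>n. valid_steps (p n)" and lim: "(\<lambda>n. step_energy \<alpha> (p n)) \<longlonglongrightarrow> 0"
  shows "(\<lambda>n. expectation (\<lambda>w. min 1 \<bar>step_integral Z (p n) w\<bar>)) \<longlonglongrightarrow> 0"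
proof -
  let ?N = "\<lambda>n. distr M borel (step_integral Z (p n))" and ?Z = "distr M borel (\<lambda>w. 0 :: real)"
  have "char ?Z \<xi> = 1" for \<xi> by (simp add: char_def integral_distr prob_space del: distr_const)
  then have "weak_conv_m ?N ?Z"
    using char_step_integral_tendsto_1[OF assms] by (intro levy_continuity) (auto simp del: distr_const)
  then have "(\<lambda>n. LINT x|?N n. min 1 \<bar>x\<bar>) \<longlonglongrightarrow> (LINT x|?Z. min 1 \<bar>x\<bar>)"
    by (intro weak_conv_imp_integral_bdd_continuous_conv[where B=1])
      (auto intro!: continuous_intros simp del: distr_const)
  then show ?thesis by (simp add: integral_distr del: distr_const)
qed

text \<open>The Lipschitz test functions are the ones for which the passage to the limit in
  probability is immediate.\<close>

lemma conditional_char_le_Lipschitz: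
  fixes \<phi> :: "real \<Rightarrow> real"
  assumes X: "is_stable_integral M \<alpha> Z k X" and Y: "is_stable_integral M \<alpha> Z h Y"
    and k_past: "\<And>v. s < v \<Longrightarrow> k v = 0"
    and e: "ennreal e \<le> (\<integral>\<^sup>+v. ennreal (\<bar>h v\<bar> powr \<alpha>) * indicator {s<..} v \<partial>lborel)" "0 \<le> e"
    and \<phi>: "\<And>x. 0 \<le> \<phi> x" "\<And>x. \<phi> x \<le> 1" and Lip: "\<And>x y. \<bar>\<phi> x - \<phi> y\<bar> \<le> l * \<bar>x - y\<bar>" "0 \<le> l"
  shows "cmod (CLINT w|M. \<phi> (X w) *\<^sub>R iexp (\<xi> * Y w)) \<le>
    (LINT w|M. \<phi> (X w)) * exp (- (\<bar>\<xi>\<bar> powr \<alpha> * (e / 2 powr \<alpha>)))"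
proof -
  have [measurable]: "X \<in> borel_measurable M" "Y \<in> borel_measurable M" "k \<in> borel_measurable borel" "h \<in> borel_measurable borel"
    using X Y by (auto simp: is_stable_integral_def)
  have "l-lipschitz_on UNIV \<phi>"
    using Lip by (intro lipschitz_onI) (auto simp: dist_real_def)
  then have [measurable]: "\<phi> \<in> borel_measurable borel"
    by (intro borel_measurable_continuous_onI lipschitz_on_continuous_on)
  obtain q where q: "\<And>n. valid_steps (q n)"
    "(\<lambda>n. \<integral>\<^sup>+u. ennreal (\<bar>k u - step_fun (q n) u\<bar> powr \<alpha>) \<partial>lborel) \<longlonglongrightarrow> 0"
    "tendsto_in_prob M (\<lambda>n. step_integral Z (q n)) X"
    using X unfolding is_stable_integral_def valid_steps_def by auto
  obtain p where p: "\<And>n. valid_steps (p n)"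
    "(\<lambda>n. \<integral>\<^sup>+u. ennreal (\<bar>h u - step_fun (p n) u\<bar> powr \<alpha>) \<partial>lborel) \<longlonglongrightarrow> 0"
    "tendsto_in_prob M (\<lambda>n. step_integral Z (p n)) Y"
    using Y unfolding is_stable_integral_def valid_steps_def by auto
  let ?E = "\<lambda>D. expectation (\<lambda>w. min 1 \<bar>D w\<bar>)"
  have int_min: "integrable M (\<lambda>w. min 1 \<bar>D w\<bar>)" if [measurable]: "D \<in> borel_measurable M" for D :: "'w \<Rightarrow> real"
    by (intro integrable_const_bound[where B=1]) auto
  let ?Q = "\<lambda>n. step_integral Z (past_steps s (q n))" and ?P = "\<lambda>n. step_integral Z (p n)"
  have lim_P: "(\<lambda>n. ?E (\<lambda>w. ?P n w - Y w)) \<longlonglongrightarrow> 0"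
    by (intro tendsto_expectation_min_one p) auto
  have lim_Q: "(\<lambda>n. ?E (\<lambda>w. ?Q n w - X w)) \<longlonglongrightarrow> 0"
  proof (rule tendsto_sandwich[OF _ _ tendsto_const])
    have energy_le: "step_energy \<alpha> (future_steps s (q n)) \<le> (\<integral>\<^sup>+u. ennreal (\<bar>k u - step_fun (q n) u\<bar> powr \<alpha>) \<partial>lborel)" for n
      unfolding step_energy_future_steps using k_past by (intro nn_integral_mono) (auto simp: indicator_def)
    have "(\<lambda>n. step_energy \<alpha> (future_steps s (q n))) \<longlonglongrightarrow> 0"
      by (rule tendsto_sandwich[OF _ _ tendsto_const q(2)]) (auto simp: energy_le)
    then have tail: "(\<lambda>n. ?E (step_integral Z (future_steps s (q n)))) \<longlonglongrightarrow> 0"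
      by (intro expectation_min_one_step_integral_tendsto_0 valid_future_steps q)
    have full: "(\<lambda>n. ?E (\<lambda>w. step_integral Z (q n) w - X w)) \<longlonglongrightarrow> 0"
      by (intro tendsto_expectation_min_one q) auto
    show "(\<lambda>n. ?E (\<lambda>w. step_integral Z (q n) w - X w) + ?E (step_integral Z (future_steps s (q n)))) \<longlonglongrightarrow> 0"
      using tendsto_add[OF full tail] by simp
    show "\<forall>\<^sub>F n in sequentially. ?E (\<lambda>w. ?Q n w - X w) \<le>
        ?E (\<lambda>w. step_integral Z (q n) w - X w) + ?E (step_integral Z (future_steps s (q n)))"
    proof (intro always_eventually allI)
      fix n
      have "?E (\<lambda>w. ?Q n w - X w) \<le> expectation (\<lambda>w. min 1 \<bar>step_integral Z (q n) w - X w\<bar> + min 1 \<bar>step_integral Z (future_steps s (q n)) w\<bar>)"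
      proof (intro integral_mono int_min Bochner_Integration.integrable_add)
        fix w
        show "min 1 \<bar>?Q n w - X w\<bar> \<le> min 1 \<bar>step_integral Z (q n) w - X w\<bar> + min 1 \<bar>step_integral Z (future_steps s (q n)) w\<bar>"
          unfolding step_integral_past_future[of Z "q n" w s] by linarith
      qed measurable
      also have "\<dots> = ?E (\<lambda>w. step_integral Z (q n) w - X w) + ?E (step_integral Z (future_steps s (q n)))"
        by (intro Bochner_Integration.integral_add int_min) auto
      finally show "?E (\<lambda>w. ?Q n w - X w) \<le> \<dots>" .
    qed
    show "\<forall>\<^sub>F n in sequentially. 0 \<le> ?E (\<lambda>w. ?Q n w - X w)"
      by (intro always_eventually allI Bochner_Integration.integral_nonneg) auto
  qed
  have \<phi>_diff: "\<bar>\<phi> x - \<phi> y\<bar> \<le> (1 + l) * min 1 \<bar>x - y\<bar>" for x y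
  proof -
    have "\<bar>\<phi> x - \<phi> y\<bar> \<le> min 1 (l * \<bar>x - y\<bar>)"
      using \<phi>[of x] \<phi>[of y] Lip(1)[of x y] by linarith
    also have "\<dots> \<le> (1 + l) * min 1 \<bar>x - y\<bar>"
      using Lip(2) by (intro min_one_mult_le) auto
    finally show ?thesis .
  qed
  have int_\<phi>: "integrable M (\<lambda>w. \<phi> (D w))" if [measurable]: "D \<in> borel_measurable M" for D
    using \<phi> by (intro integrable_const_bound[where B=1]) auto
  have int_U: "integrable M (\<lambda>w. \<phi> (D w) *\<^sub>R iexp (\<xi> * D' w))"
    if [measurable]: "D \<in> borel_measurable M" "D' \<in> borel_measurable M" for D D'
    using \<phi> by (intro integrable_const_bound[where B=1]) auto
  have lim_\<phi>: "(\<lambda>n. LINT w|M. \<phi> (?Q n w)) \<longlonglongrightarrow> (LINT w|M. \<phi> (X w))"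
  proof (rule LIM_zero_cancel, rule Lim_null_comparison)
    show "(\<lambda>n. (1 + l) * ?E (\<lambda>w. ?Q n w - X w)) \<longlonglongrightarrow> 0"
      by (rule tendsto_mult_right_zero[OF lim_Q])
    show "\<forall>\<^sub>F n in sequentially. norm ((LINT w|M. \<phi> (?Q n w)) - (LINT w|M. \<phi> (X w))) \<le> (1 + l) * ?E (\<lambda>w. ?Q n w - X w)"
    proof (intro always_eventually allI)
      fix n
      have "norm (LINT w|M. \<phi> (?Q n w) - \<phi> (X w)) \<le> (LINT w|M. (1 + l) * min 1 \<bar>?Q n w - X w\<bar>)"
        using \<phi>_diff by (intro norm_integral_le_integral integrable_mult_right int_min int_\<phi> Bochner_Integration.integrable_diff) auto
      then show "norm ((LINT w|M. \<phi> (?Q n w)) - (LINT w|M. \<phi> (X w))) \<le> (1 + l) * ?E (\<lambda>w. ?Q n w - X w)"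
        by (simp add: int_\<phi> Bochner_Integration.integral_diff)
    qed
  qed
  let ?U = "\<lambda>D D' w. \<phi> (D w) *\<^sub>R iexp (\<xi> * D' w)"
  \<comment> \<open>The difference of products splits into a change of the conditioning variable and
    a change of the target. The constants come from a bound and a Lipschitz constant each: 1 and
    \<open>l\<close> for \<phi>, 2 and |\<xi>| for the exponential.\<close>
  have U_diff: "cmod (?U (?Q n) (?P n) w - ?U X Y w) \<le>
      (1 + l) * min 1 \<bar>?Q n w - X w\<bar> + (2 + \<bar>\<xi>\<bar>) * min 1 \<bar>?P n w - Y w\<bar>" for n w
  proof -
    have "?U (?Q n) (?P n) w - ?U X Y w = (\<phi> (?Q n w) - \<phi> (X w)) *\<^sub>R iexp (\<xi> * ?P n w) +
        \<phi> (X w) *\<^sub>R (iexp (\<xi> * ?P n w) - iexp (\<xi> * Y w))"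
      by (simp only: scaleR_left_diff_distrib scaleR_right_diff_distrib) simp
    then have "cmod (?U (?Q n) (?P n) w - ?U X Y w) \<le> cmod ((\<phi> (?Q n w) - \<phi> (X w)) *\<^sub>R iexp (\<xi> * ?P n w)) +
        cmod (\<phi> (X w) *\<^sub>R (iexp (\<xi> * ?P n w) - iexp (\<xi> * Y w)))"
      by (simp only: norm_triangle_ineq)
    also have "cmod ((\<phi> (?Q n w) - \<phi> (X w)) *\<^sub>R iexp (\<xi> * ?P n w)) = \<bar>\<phi> (?Q n w) - \<phi> (X w)\<bar>"
      by simp
    also have "\<dots> \<le> (1 + l) * min 1 \<bar>?Q n w - X w\<bar>" by (rule \<phi>_diff)
    also have "cmod (\<phi> (X w) *\<^sub>R (iexp (\<xi> * ?P n w) - iexp (\<xi> * Y w))) \<le> (2 + \<bar>\<xi>\<bar>) * min 1 \<bar>?P n w - Y w\<bar>"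
    proof -
      have "cmod (iexp (\<xi> * ?P n w) - iexp (\<xi> * Y w)) \<le> \<bar>\<xi>\<bar> * \<bar>?P n w - Y w\<bar>"
        using cmod_iexp_diff_le[of "\<xi> * ?P n w" "\<xi> * Y w"] by (simp add: abs_mult flip: right_diff_distrib)
      moreover have "cmod (iexp (\<xi> * ?P n w) - iexp (\<xi> * Y w)) \<le> 2"
        using norm_triangle_ineq4[of "iexp (\<xi> * ?P n w)" "iexp (\<xi> * Y w)"] by simp
      ultimately have le: "cmod (iexp (\<xi> * ?P n w) - iexp (\<xi> * Y w)) \<le> (2 + \<bar>\<xi>\<bar>) * min 1 \<bar>?P n w - Y w\<bar>"
        using min_one_mult_le[of "\<bar>\<xi>\<bar>" "\<bar>?P n w - Y w\<bar>" 2] by linarith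
      have "cmod (\<phi> (X w) *\<^sub>R (iexp (\<xi> * ?P n w) - iexp (\<xi> * Y w))) = \<phi> (X w) * cmod (iexp (\<xi> * ?P n w) - iexp (\<xi> * Y w))"
        using \<phi>(1) by simp
      also have "\<dots> \<le> 1 * ((2 + \<bar>\<xi>\<bar>) * min 1 \<bar>?P n w - Y w\<bar>)"
        using \<phi> le by (intro mult_mono) auto
      finally show ?thesis by simp
    qed
    finally show ?thesis by simp
  qed
  have lim_U: "(\<lambda>n. CLINT w|M. ?U (?Q n) (?P n) w) \<longlonglongrightarrow> (CLINT w|M. ?U X Y w)"
  proof (rule LIM_zero_cancel, rule Lim_null_comparison)
    show "(\<lambda>n. (1 + l) * ?E (\<lambda>w. ?Q n w - X w) + (2 + \<bar>\<xi>\<bar>) * ?E (\<lambda>w. ?P n w - Y w)) \<longlonglongrightarrow> 0"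
      by (intro tendsto_add_zero tendsto_mult_right_zero lim_Q lim_P)
    show "\<forall>\<^sub>F n in sequentially. norm ((CLINT w|M. ?U (?Q n) (?P n) w) - (CLINT w|M. ?U X Y w)) \<le>
        (1 + l) * ?E (\<lambda>w. ?Q n w - X w) + (2 + \<bar>\<xi>\<bar>) * ?E (\<lambda>w. ?P n w - Y w)"
    proof (intro always_eventually allI)
      fix n
      have "norm (CLINT w|M. ?U (?Q n) (?P n) w - ?U X Y w) \<le>
          (LINT w|M. (1 + l) * min 1 \<bar>?Q n w - X w\<bar> + (2 + \<bar>\<xi>\<bar>) * min 1 \<bar>?P n w - Y w\<bar>)"
        by (intro norm_integral_le_integral U_diff Bochner_Integration.integrable_add Bochner_Integration.integrable_diff
            integrable_mult_right int_min int_U) auto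
      also have "\<dots> = (1 + l) * ?E (\<lambda>w. ?Q n w - X w) + (2 + \<bar>\<xi>\<bar>) * ?E (\<lambda>w. ?P n w - Y w)"
        by (subst Bochner_Integration.integral_add) (auto intro!: integrable_mult_right int_min)
      finally show "norm ((CLINT w|M. ?U (?Q n) (?P n) w) - (CLINT w|M. ?U X Y w)) \<le>
        (1 + l) * ?E (\<lambda>w. ?Q n w - X w) + (2 + \<bar>\<xi>\<bar>) * ?E (\<lambda>w. ?P n w - Y w)"
        by (subst (asm) Bochner_Integration.integral_diff) (rule int_U; measurable)+
    qed
  qed
  \<comment> \<open>The error may be infinite for finitely many \<open>n\<close>; its real version
    \<open>d n\<close> is used only where it is finite.\<close>
  define \<delta> where "\<delta> n = (\<integral>\<^sup>+u. ennreal (\<bar>h u - step_fun (p n) u\<bar> powr \<alpha>) \<partial>lborel)" for n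
  define d where "d n = enn2real (\<delta> n)" for n
  have "\<delta> \<longlonglongrightarrow> ennreal 0" using p(2) by (simp add: \<delta>_def[abs_def])
  then have lim_d: "d \<longlonglongrightarrow> 0"
    unfolding d_def by (intro tendsto_enn2real) auto
  have "\<forall>\<^sub>F n in sequentially. \<delta> n < \<infinity>"
    using \<open>\<delta> \<longlonglongrightarrow> ennreal 0\<close> by (rule order_tendstoD) simp
  then have le: "\<forall>\<^sub>F n in sequentially. cmod (CLINT w|M. ?U (?Q n) (?P n) w) \<le>
      (LINT w|M. \<phi> (?Q n w)) * exp (- (\<bar>\<xi>\<bar> powr \<alpha> * (e / 2 powr \<alpha> - d n)))"
  proof eventually_elim
    case (elim n)
    let ?N = "step_energy \<alpha> (future_steps s (p n))"
    \<comment> \<open>The quasi-triangle inequality beyond \<open>s\<close> bounds the energy of the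
      future part of \<open>p n\<close> below by \<open>e / 2 powr \<alpha> - d n\<close>; here the
      factor 2^\<alpha> in the exponent is lost.\<close>
    have "ennreal e \<le> (\<integral>\<^sup>+v. ennreal (2 powr \<alpha>) * (ennreal (\<bar>h v - step_fun (p n) v\<bar> powr \<alpha>) +
        ennreal (\<bar>step_fun (p n) v\<bar> powr \<alpha>) * indicator {s<..} v) \<partial>lborel)"
    proof (rule order_trans[OF e(1)], intro nn_integral_mono)
      fix v
      show "ennreal (\<bar>h v\<bar> powr \<alpha>) * indicator {s<..} v \<le> ennreal (2 powr \<alpha>) *
          (ennreal (\<bar>h v - step_fun (p n) v\<bar> powr \<alpha>) + ennreal (\<bar>step_fun (p n) v\<bar> powr \<alpha>) * indicator {s<..} v)"
      proof (cases "s < v")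
        case True
        have "ennreal (\<bar>h v\<bar> powr \<alpha>) \<le> ennreal (2 powr \<alpha> * (\<bar>h v - step_fun (p n) v\<bar> powr \<alpha> + \<bar>step_fun (p n) v\<bar> powr \<alpha>))"
          by (intro ennreal_leI powr_abs_le_add \<alpha>_pos)
        then show ?thesis using True by (simp add: ennreal_mult)
      qed simp
    qed
    also have "\<dots> = ennreal (2 powr \<alpha>) * (\<delta> n + ?N)"
      unfolding \<delta>_def step_energy_future_steps by (simp add: nn_integral_cmult nn_integral_add)
    also have "\<delta> n = ennreal (d n)" using elim by (simp add: d_def)
    finally have le: "ennreal e \<le> ennreal (2 powr \<alpha>) * (ennreal (d n) + ?N)" .
    have "ennreal (e / 2 powr \<alpha> - d n) \<le> ?N"
    proof (cases ?N)
      case (real x)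
      then have "ennreal e \<le> ennreal (2 powr \<alpha> * (d n + x))"
        using le by (simp add: d_def ennreal_mult)
      then have "e \<le> 2 powr \<alpha> * (d n + x)"
        using real by (subst (asm) ennreal_le_iff) (auto simp: d_def)
      then have "e / 2 powr \<alpha> - d n \<le> x"
        by (simp add: field_simps)
      then show ?thesis using real by (simp add: ennreal_leI)
    qed simp
    then show ?case
      by (intro expectation_future_decouple p q \<phi>) auto
  qed
  show ?thesis
  proof (rule tendsto_le[OF sequentially_bot _ tendsto_norm[OF lim_U] le])
    show "(\<lambda>n. (LINT w|M. \<phi> (?Q n w)) * exp (- (\<bar>\<xi>\<bar> powr \<alpha> * (e / 2 powr \<alpha> - d n)))) \<longlonglongrightarrow>
        (LINT w|M. \<phi> (X w)) * exp (- (\<bar>\<xi>\<bar> powr \<alpha> * (e / 2 powr \<alpha>)))"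
      using lim_\<phi> lim_d by (auto intro!: tendsto_eq_intros)
  qed
qed

section \<open>From Lipschitz test functions to Borel sets\<close>

text \<open>The tents \<open>max 0 (1 - real j * infdist x C)\<close> are Lipschitz and converge to
  the indicator of the closed set \<open>C\<close>; dominated convergence carries the bound
  over.\<close>

lemma conditional_char_le_compact:
  assumes X: "is_stable_integral M \<alpha> Z k X" and Y: "is_stable_integral M \<alpha> Z h Y"
    and k_past: "\<And>v. s < v \<Longrightarrow> k v = 0"
    and e: "ennreal e \<le> (\<integral>\<^sup>+v. ennreal (\<bar>h v\<bar> powr \<alpha>) * indicator {s<..} v \<partial>lborel)" "0 \<le> e"
    and "compact C"
  shows "cmod (CLINT w|M. indicator C (X w) *\<^sub>R iexp (\<xi> * Y w)) \<le>
    (LINT w|M. indicator C (X w)) * exp (- (\<bar>\<xi>\<bar> powr \<alpha> * (e / 2 powr \<alpha>)))"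
\<comment> \<open>The distance to the empty set is 0 by default, so there the tents would be 1
  everywhere.\<close>
proof (cases "C = {}")
  case False
  have [measurable]: "X \<in> borel_measurable M" "Y \<in> borel_measurable M"
    using X Y by (auto simp: is_stable_integral_def)
  have "closed C" using \<open>compact C\<close> by (rule compact_imp_closed)
  then have [measurable]: "C \<in> sets borel" by simp
  define \<phi> where "\<phi> j x = max 0 (1 - real j * infdist x C)" for j x
  have [measurable]: "\<phi> j \<in> borel_measurable borel" for j
    unfolding \<phi>_def[abs_def] by (intro borel_measurable_continuous_onI continuous_intros)
  have \<phi>: "0 \<le> \<phi> j x" "\<phi> j x \<le> 1" for j x
    by (auto simp: \<phi>_def infdist_nonneg)
  have Lip: "\<bar>\<phi> j x - \<phi> j y\<bar> \<le> real j * \<bar>x - y\<bar>" for j x y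
  proof -
    have "\<bar>\<phi> j x - \<phi> j y\<bar> \<le> \<bar>real j * infdist x C - real j * infdist y C\<bar>"
      unfolding \<phi>_def by linarith
    also have "\<dots> = real j * \<bar>infdist x C - infdist y C\<bar>"
      by (simp add: abs_mult flip: right_diff_distrib)
    also have "\<dots> \<le> real j * \<bar>x - y\<bar>"
      using infdist_triangle_abs[of x C y] by (intro mult_left_mono) (auto simp: dist_real_def)
    finally show ?thesis .
  qed
  have \<phi>_lim: "(\<lambda>j. \<phi> j x) \<longlonglongrightarrow> indicator C x" for x
  proof (cases "x \<in> C")
    case True then show ?thesis by (simp add: \<phi>_def)
  next
    case False
    then have pos: "0 < infdist x C"
      using infdist_pos_not_in_closed[OF \<open>closed C\<close> \<open>C \<noteq> {}\<close>] by simp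
    obtain N where "1 / infdist x C < real N" using reals_Archimedean2 by blast
    then have N: "1 < real N * infdist x C" using pos by (simp add: field_simps)
    have "\<forall>\<^sub>F j in sequentially. \<phi> j x = indicator C x"
      using eventually_ge_at_top[of N]
    proof eventually_elim
      case (elim j)
      then have "real N * infdist x C \<le> real j * infdist x C" using pos by (intro mult_right_mono) auto
      then show ?case using N False by (simp add: \<phi>_def)
    qed
    then show ?thesis by (rule tendsto_eventually)
  qed
  have lim_\<phi>: "(\<lambda>j. LINT w|M. \<phi> j (X w)) \<longlonglongrightarrow> (LINT w|M. indicator C (X w))"
    using \<phi> \<phi>_lim by (intro integral_dominated_convergence[where w="\<lambda>_. 1"]) auto
  have lim_U: "(\<lambda>j. CLINT w|M. \<phi> j (X w) *\<^sub>R iexp (\<xi> * Y w)) \<longlonglongrightarrow> (CLINT w|M. indicator C (X w) *\<^sub>R iexp (\<xi> * Y w))"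
    using \<phi> \<phi>_lim by (intro integral_dominated_convergence[where w="\<lambda>_. 1"]) (auto intro!: tendsto_intros)
  show ?thesis
  proof (rule LIMSEQ_le[OF tendsto_norm[OF lim_U] tendsto_mult_right[OF lim_\<phi>]], intro exI allI impI)
    show "cmod (CLINT w|M. \<phi> j (X w) *\<^sub>R iexp (\<xi> * Y w)) \<le>
        (LINT w|M. \<phi> j (X w)) * exp (- (\<bar>\<xi>\<bar> powr \<alpha> * (e / 2 powr \<alpha>)))" for j
      by (rule conditional_char_le_Lipschitz[OF X Y k_past e \<phi> Lip]) auto
  qed
qed simp

text \<open>By inner regularity of the law of \<open>X\<close>, a compact subset of \<open>A\<close>
  carries all but \<epsilon> of its mass; the rest costs at most \<epsilon> because the exponential
  has modulus 1.\<close>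

lemma conditional_char_le_Borel:
  assumes X: "is_stable_integral M \<alpha> Z k X" and Y: "is_stable_integral M \<alpha> Z h Y"
    and k_past: "\<And>v. s < v \<Longrightarrow> k v = 0"
    and e: "ennreal e \<le> (\<integral>\<^sup>+v. ennreal (\<bar>h v\<bar> powr \<alpha>) * indicator {s<..} v \<partial>lborel)" "0 \<le> e"
    and A [measurable]: "A \<in> sets borel"
  shows "cmod (CLINT w|M. indicator A (X w) *\<^sub>R iexp (\<xi> * Y w)) \<le>
    measure M {w \<in> space M. X w \<in> A} * exp (- (\<bar>\<xi>\<bar> powr \<alpha> * (e / 2 powr \<alpha>)))" (is "?lhs A \<le> ?m A * ?r")
proof (rule field_le_epsilon)
  fix \<epsilon> :: real assume "\<epsilon> > 0"
  have [measurable]: "X \<in> borel_measurable M" "Y \<in> borel_measurable M"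
    using X Y by (auto simp: is_stable_integral_def)
  have m_eq: "(LINT w|M. indicator B (X w)) = ?m B" if [measurable]: "B \<in> sets borel" for B
  proof -
    have "(LINT w|M. indicator B (X w) :: real) = (LINT w|M. indicator {w \<in> space M. X w \<in> B} w)"
      by (intro Bochner_Integration.integral_cong) (auto simp: indicator_def)
    then show ?thesis by simp
  qed
  have int: "integrable M (\<lambda>w. indicator B (X w) *\<^sub>R iexp (\<xi> * Y w))"
    "integrable M (\<lambda>w. indicator B (X w) :: real)" if [measurable]: "B \<in> sets borel" for B
    by (intro integrable_const_bound[where B=1]; auto simp: indicator_def)+
  interpret D: prob_space "distr M borel X" by (rule prob_space_distr) simp
  have D: "measure (distr M borel X) B = ?m B" if "B \<in> sets borel" for B
    using that by (subst measure_distr) (auto simp: vimage_def Int_def conj_commute)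
  obtain C where C: "compact C" "C \<subseteq> A" "?m A \<le> ?m C + \<epsilon>"
  proof (cases "?m A \<le> \<epsilon>")
    case True then show ?thesis using that[of "{}"] by simp
  next
    case False
    then have "ennreal (?m A - \<epsilon>) < emeasure (distr M borel X) A"
      using \<open>\<epsilon> > 0\<close> by (simp add: D.emeasure_eq_measure D ennreal_lessI)
    also have "\<dots> = (SUP C \<in> {C. C \<subseteq> A \<and> compact C}. emeasure (distr M borel X) C)"
      by (rule inner_regular) (use A in \<open>simp_all add: D.emeasure_space_1\<close>)
    finally obtain C where C: "C \<subseteq> A" "compact C" "ennreal (?m A - \<epsilon>) < emeasure (distr M borel X) C"
      unfolding less_SUP_iff by auto
    then have "?m A - \<epsilon> < ?m C"
      using False compact_imp_closed[OF C(2)] by (simp add: D.emeasure_eq_measure D ennreal_less_iff)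
    then show ?thesis using that[of C] C by simp
  qed
  have [measurable]: "C \<in> sets borel" using compact_imp_closed[OF C(1)] by simp
  have "?lhs A = cmod ((CLINT w|M. indicator C (X w) *\<^sub>R iexp (\<xi> * Y w)) +
      (CLINT w|M. indicator (A - C) (X w) *\<^sub>R iexp (\<xi> * Y w)))"
  proof -
    have "(CLINT w|M. indicator A (X w) *\<^sub>R iexp (\<xi> * Y w)) =
        (CLINT w|M. indicator C (X w) *\<^sub>R iexp (\<xi> * Y w) + indicator (A - C) (X w) *\<^sub>R iexp (\<xi> * Y w))"
      using C(2) by (intro Bochner_Integration.integral_cong refl) (auto simp: indicator_def)
    also have "\<dots> = (CLINT w|M. indicator C (X w) *\<^sub>R iexp (\<xi> * Y w)) +
      (CLINT w|M. indicator (A - C) (X w) *\<^sub>R iexp (\<xi> * Y w))"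
      by (intro Bochner_Integration.integral_add int) auto
    finally show ?thesis by simp
  qed
  also have "\<dots> \<le> ?lhs C + ?lhs (A - C)" by (rule norm_triangle_ineq)
  also have "?lhs C \<le> ?m C * ?r"
    using conditional_char_le_compact[OF X Y k_past e C(1)] m_eq[of C] by simp
  also have "?m C * ?r \<le> ?m A * ?r"
    using C(2) by (intro mult_right_mono finite_measure_mono) auto
  also have "?lhs (A - C) \<le> (LINT w|M. indicator (A - C) (X w))"
    by (intro norm_integral_le_integral int) auto
  also have "\<dots> = ?m A - ?m C"
  proof -
    have "(LINT w|M. indicator (A - C) (X w) :: real) = (LINT w|M. indicator A (X w) - indicator C (X w))"
      using C(2) by (intro Bochner_Integration.integral_cong refl) (auto simp: indicator_def)
    then show ?thesis using int(2) m_eq by simp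
  qed
  finally show "?lhs A \<le> ?m A * ?r + \<epsilon>" using C(3) by simp
qed

section \<open>Operations on stable integrals\<close>

text \<open>The common factor \<open>a\<close> is the shape in which the motion combines its two
  integrals. Approximating lists are concatenated with scaled coefficients, and the quasi-triangle
  inequality bounds the error.\<close>

lemma is_stable_integral_linear:
  assumes I: "is_stable_integral M \<alpha> Z g I" and J: "is_stable_integral M \<alpha> Z h J" and "a \<noteq> 0"
  shows "is_stable_integral M \<alpha> Z (\<lambda>u. a * g u + a * h u) (\<lambda>w. a * I w + a * J w)"
proof -
  have [measurable]: "g \<in> borel_measurable borel" "h \<in> borel_measurable borel" "I \<in> borel_measurable M" "J \<in> borel_measurable M"
    using I J by (auto simp: is_stable_integral_def)
  obtain p where p: "\<And>n. valid_steps (p n)"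
    "(\<lambda>n. \<integral>\<^sup>+u. ennreal (\<bar>g u - step_fun (p n) u\<bar> powr \<alpha>) \<partial>lborel) \<longlonglongrightarrow> 0"
    "tendsto_in_prob M (\<lambda>n. step_integral Z (p n)) I"
    using I unfolding is_stable_integral_def valid_steps_def by auto
  obtain q where q: "\<And>n. valid_steps (q n)"
    "(\<lambda>n. \<integral>\<^sup>+u. ennreal (\<bar>h u - step_fun (q n) u\<bar> powr \<alpha>) \<partial>lborel) \<longlonglongrightarrow> 0"
    "tendsto_in_prob M (\<lambda>n. step_integral Z (q n)) J"
    using J unfolding is_stable_integral_def valid_steps_def by auto
  define r where "r n = map (\<lambda>(c, x, y). (a * c, x, y)) (p n @ q n)" for n
  have r_fun: "step_fun (r n) u = a * step_fun (p n) u + a * step_fun (q n) u" for n u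
  proof -
    have "step_fun (map (\<lambda>(c, x, y). (a * c, x, y)) l) u = a * step_fun l u" for l
      by (induction l) (auto simp: step_fun_Cons distrib_left)
    then show ?thesis by (simp add: r_def step_fun_def distrib_left)
  qed
  have r_int: "step_integral Z (r n) w = a * step_integral Z (p n) w + a * step_integral Z (q n) w" for n w
  proof -
    have "step_integral Z (map (\<lambda>(c, x, y). (a * c, x, y)) l) w = a * step_integral Z l w" for l
      by (induction l) (auto simp: step_integral_Cons distrib_left)
    then show ?thesis by (simp add: r_def step_integral_def distrib_left)
  qed
  have r_valid: "valid_steps (r n)" for n
    using p(1)[of n] q(1)[of n] by (auto simp: valid_steps_def r_def)
  have "(\<lambda>n. \<integral>\<^sup>+u. ennreal (\<bar>(a * g u + a * h u) - step_fun (r n) u\<bar> powr \<alpha>) \<partial>lborel) \<longlonglongrightarrow> 0"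
  proof (rule tendsto_sandwich[OF _ _ tendsto_const])
    let ?c = "ennreal (\<bar>a\<bar> powr \<alpha> * 2 powr \<alpha>)"
    let ?P = "\<lambda>n. \<integral>\<^sup>+u. ennreal (\<bar>g u - step_fun (p n) u\<bar> powr \<alpha>) \<partial>lborel"
      and ?Q = "\<lambda>n. \<integral>\<^sup>+u. ennreal (\<bar>h u - step_fun (q n) u\<bar> powr \<alpha>) \<partial>lborel"
    have "(\<lambda>n. ?c * (?P n + ?Q n)) \<longlonglongrightarrow> ?c * (0 + 0)"
      by (intro ennreal_tendsto_cmult tendsto_add p q) simp
    then show "(\<lambda>n. ?c * (?P n + ?Q n)) \<longlonglongrightarrow> 0" by simp
    show "\<forall>\<^sub>F n in sequentially. (\<integral>\<^sup>+u. ennreal (\<bar>(a * g u + a * h u) - step_fun (r n) u\<bar> powr \<alpha>) \<partial>lborel) \<le> ?c * (?P n + ?Q n)"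
    proof (intro always_eventually allI)
      fix n
      have "(\<integral>\<^sup>+u. ennreal (\<bar>(a * g u + a * h u) - step_fun (r n) u\<bar> powr \<alpha>) \<partial>lborel) \<le>
          (\<integral>\<^sup>+u. ?c * (ennreal (\<bar>g u - step_fun (p n) u\<bar> powr \<alpha>) + ennreal (\<bar>h u - step_fun (q n) u\<bar> powr \<alpha>)) \<partial>lborel)"
      proof (intro nn_integral_mono)
        fix u
        let ?x = "g u - step_fun (p n) u" and ?y = "h u - step_fun (q n) u"
        have "\<bar>(a * g u + a * h u) - step_fun (r n) u\<bar> = \<bar>a\<bar> * \<bar>?x + ?y\<bar>"
          unfolding r_fun by (simp add: algebra_simps flip: abs_mult)
        then have "\<bar>(a * g u + a * h u) - step_fun (r n) u\<bar> powr \<alpha> = \<bar>a\<bar> powr \<alpha> * \<bar>?x + ?y\<bar> powr \<alpha>"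
          by (simp add: powr_mult)
        also have "\<dots> \<le> \<bar>a\<bar> powr \<alpha> * (2 powr \<alpha> * (\<bar>?x\<bar> powr \<alpha> + \<bar>?y\<bar> powr \<alpha>))"
          using powr_abs_le_add[OF \<alpha>_pos, of "?x + ?y" ?y] by (intro mult_left_mono) auto
        finally have "ennreal (\<bar>(a * g u + a * h u) - step_fun (r n) u\<bar> powr \<alpha>) \<le>
            ennreal ((\<bar>a\<bar> powr \<alpha> * 2 powr \<alpha>) * (\<bar>?x\<bar> powr \<alpha> + \<bar>?y\<bar> powr \<alpha>))"
          by (intro ennreal_leI) (simp add: mult.assoc)
        then show "ennreal (\<bar>(a * g u + a * h u) - step_fun (r n) u\<bar> powr \<alpha>) \<le>
            ?c * (ennreal (\<bar>?x\<bar> powr \<alpha>) + ennreal (\<bar>?y\<bar> powr \<alpha>))"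
          by (subst (asm) ennreal_mult) auto
      qed
      also have "\<dots> = ?c * (?P n + ?Q n)"
        by (simp add: nn_integral_cmult nn_integral_add)
      finally show "(\<integral>\<^sup>+u. ennreal (\<bar>(a * g u + a * h u) - step_fun (r n) u\<bar> powr \<alpha>) \<partial>lborel) \<le> ?c * (?P n + ?Q n)" .
    qed
  qed simp
  moreover have "tendsto_in_prob M (\<lambda>n. step_integral Z (r n)) (\<lambda>w. a * I w + a * J w)"
    unfolding tendsto_in_prob_def
  proof (intro allI impI)
    fix \<epsilon> :: real assume "\<epsilon> > 0"
    \<comment> \<open>If both errors are at most this threshold, the combined error is at most 2 |a|
      \<epsilon>' = \<epsilon>.\<close>
    define \<epsilon>' where "\<epsilon>' = \<epsilon> / (2 * \<bar>a\<bar>)"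
    have \<epsilon>': "\<epsilon>' > 0" "\<bar>a\<bar> * \<epsilon>' = \<epsilon> / 2" using \<open>\<epsilon> > 0\<close> \<open>a \<noteq> 0\<close> by (simp_all add: \<epsilon>'_def)
    let ?A = "\<lambda>n. {w \<in> space M. \<epsilon>' < \<bar>step_integral Z (p n) w - I w\<bar>}" and ?B = "\<lambda>n. {w \<in> space M. \<epsilon>' < \<bar>step_integral Z (q n) w - J w\<bar>}"
    show "(\<lambda>n. prob {w \<in> space M. \<epsilon> < \<bar>step_integral Z (r n) w - (a * I w + a * J w)\<bar>}) \<longlonglongrightarrow> 0"
    proof (rule tendsto_sandwich[OF _ _ tendsto_const])
      show "(\<lambda>n. prob (?A n) + prob (?B n)) \<longlonglongrightarrow> 0"
        using p(3) q(3) \<epsilon>'(1) by (intro tendsto_add_zero) (auto simp: tendsto_in_prob_def)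
      show "\<forall>\<^sub>F n in sequentially. prob {w \<in> space M. \<epsilon> < \<bar>step_integral Z (r n) w - (a * I w + a * J w)\<bar>} \<le> prob (?A n) + prob (?B n)"
      proof (intro always_eventually allI)
        fix n
        have "{w \<in> space M. \<epsilon> < \<bar>step_integral Z (r n) w - (a * I w + a * J w)\<bar>} \<subseteq> ?A n \<union> ?B n"
        proof safe
          fix w assume "w \<in> space M" and less: "\<epsilon> < \<bar>step_integral Z (r n) w - (a * I w + a * J w)\<bar>"
            and B: "\<not> \<epsilon>' < \<bar>step_integral Z (q n) w - J w\<bar>"
          let ?x = "step_integral Z (p n) w - I w" and ?y = "step_integral Z (q n) w - J w"
          have "\<bar>step_integral Z (r n) w - (a * I w + a * J w)\<bar> = \<bar>a * ?x + a * ?y\<bar>"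
            unfolding r_int by (simp add: algebra_simps)
          also have "\<dots> \<le> \<bar>a\<bar> * \<bar>?x\<bar> + \<bar>a\<bar> * \<bar>?y\<bar>"
            using abs_triangle_ineq[of "a * ?x" "a * ?y"] by (simp add: abs_mult)
          also have "\<bar>a\<bar> * \<bar>?y\<bar> \<le> \<bar>a\<bar> * \<epsilon>'" using B by (intro mult_left_mono) auto
          finally have "\<bar>a\<bar> * \<epsilon>' < \<bar>a\<bar> * \<bar>?x\<bar>" using less \<epsilon>'(2) by linarith
          then show "\<epsilon>' < \<bar>?x\<bar>" using \<open>a \<noteq> 0\<close> by (simp add: mult_less_cancel_left)
        qed
        then have "prob {w \<in> space M. \<epsilon> < \<bar>step_integral Z (r n) w - (a * I w + a * J w)\<bar>} \<le> prob (?A n \<union> ?B n)"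
          by (intro finite_measure_mono) auto
        also have "\<dots> \<le> prob (?A n) + prob (?B n)" by (intro measure_Un_le) auto
        finally show "prob {w \<in> space M. \<epsilon> < \<bar>step_integral Z (r n) w - (a * I w + a * J w)\<bar>} \<le> prob (?A n) + prob (?B n)" .
      qed
    qed simp
  qed
  ultimately show ?thesis
    unfolding is_stable_integral_def using r_valid[unfolded valid_steps_def] by (intro conjI exI[of _ r]) auto
qed

lemma is_stable_integral_AE_cong:
  assumes I: "is_stable_integral M \<alpha> Z g I" and [measurable]: "J \<in> borel_measurable M" and AE: "AE w in M. J w = I w"
  shows "is_stable_integral M \<alpha> Z g J"
proof -
  have [measurable]: "I \<in> borel_measurable M" using I by (simp add: is_stable_integral_def)
  have "prob {w \<in> space M. \<epsilon> < \<bar>step_integral Z l w - J w\<bar>} = prob {w \<in> space M. \<epsilon> < \<bar>step_integral Z l w - I w\<bar>}" for l \<epsilon>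
    using AE by (intro finite_measure_eq_AE) auto
  then show ?thesis using I unfolding is_stable_integral_def tendsto_in_prob_def by simp
qed

text \<open>This is the kernel in the case H = 1 / \<alpha>. A constant sequence of one-triple lists
  has integral Z t - Z 0, and Z 0 vanishes almost surely.\<close>

lemma is_stable_integral_indicator:
  assumes "0 \<le> t" shows "is_stable_integral M \<alpha> Z (indicator {0<..t}) (Z t)"
proof -
  have "is_stable_integral M \<alpha> Z (indicator {0<..t}) (\<lambda>w. Z t w - Z 0 w)"
    unfolding is_stable_integral_def tendsto_in_prob_def
    using assms by (intro conjI exI[of _ "\<lambda>_. [(1, 0, t)]"]) (auto simp: step_fun_Cons step_integral_Cons)
  then show ?thesis
    by (rule is_stable_integral_AE_cong) (use AE_Z_0 in \<open>auto elim: eventually_mono\<close>)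
qed

end

text \<open>Since (H - 1 / \<alpha>) \<alpha> = \<alpha> H - 1, the power integrates to (u -
  s)^(\<alpha> H) / (\<alpha> H), which is the origin of the scale (u - s)^H. Values of
  \<open>h\<close> beyond \<open>u\<close> can only add energy.\<close>

lemma power_law_energy:
  assumes "0 < \<alpha>" "0 < H" "s < (u :: real)" "0 \<le> (A :: real)"
    and h: "\<And>v. s < v \<Longrightarrow> v < u \<Longrightarrow> \<bar>h v\<bar> = A * (u - v) powr (H - 1 / \<alpha>)"
  shows "ennreal (A powr \<alpha> * ((u - s) powr (\<alpha> * H) / (\<alpha> * H))) \<le>
    (\<integral>\<^sup>+v. ennreal (\<bar>h v\<bar> powr \<alpha>) * indicator {s<..} v \<partial>lborel)"
proof -
  let ?g = "\<lambda>v. v powr (\<alpha> * H - 1)"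
  have "ennreal ((u - s) powr (\<alpha> * H) / (\<alpha> * H)) = (\<integral>\<^sup>+v. ennreal (?g v) * indicator {0..u - s} v \<partial>lborel)"
    using nn_integral_has_integral_lebesgue'[OF _ has_integral_powr_from_0[of "\<alpha> * H - 1" "u - s"]] assms by simp
  also have "\<dots> = (\<integral>\<^sup>+v. ennreal (?g (u - v)) * indicator {0..u - s} (u - v) \<partial>lborel)"
    by (subst nn_integral_real_affine[where c="-1" and t=u]) auto
  finally have eq: "ennreal ((u - s) powr (\<alpha> * H) / (\<alpha> * H)) =
      (\<integral>\<^sup>+v. ennreal (?g (u - v)) * indicator {0..u - s} (u - v) \<partial>lborel)" .
  have "ennreal (A powr \<alpha> * ((u - s) powr (\<alpha> * H) / (\<alpha> * H))) =
      ennreal (A powr \<alpha>) * ennreal ((u - s) powr (\<alpha> * H) / (\<alpha> * H))"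
    by (rule ennreal_mult') simp
  also have "\<dots> = (\<integral>\<^sup>+v. ennreal (A powr \<alpha>) * (ennreal (?g (u - v)) * indicator {0..u - s} (u - v)) \<partial>lborel)"
    unfolding eq by (rule nn_integral_cmult[symmetric]) measurable
  also have "\<dots> \<le> (\<integral>\<^sup>+v. ennreal (\<bar>h v\<bar> powr \<alpha>) * indicator {s<..} v \<partial>lborel)"
  proof (intro nn_integral_mono_AE, use AE_lborel_singleton[of s] AE_lborel_singleton[of u] in eventually_elim)
    fix v assume "v \<noteq> s" "v \<noteq> u"
    show "ennreal (A powr \<alpha>) * (ennreal (?g (u - v)) * indicator {0..u - s} (u - v)) \<le> ennreal (\<bar>h v\<bar> powr \<alpha>) * indicator {s<..} v"
    proof (cases "s < v \<and> v < u")
      case True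
      have "\<bar>h v\<bar> powr \<alpha> = A powr \<alpha> * ?g (u - v)"
      proof -
        have "(H - 1 / \<alpha>) * \<alpha> = \<alpha> * H - 1" using assms(1) by (simp add: field_simps)
        then show ?thesis using h[of v] True by (simp add: powr_mult powr_powr)
      qed
      then show ?thesis using True by (simp add: ennreal_mult')
    next
      case False
      then show ?thesis using \<open>v \<noteq> s\<close> \<open>v \<noteq> u\<close> by (auto simp: indicator_def)
    qed
  qed
  finally show ?thesis .
qed

text \<open>The denominator grows like w^4. For \<alpha> n \<ge> 4 and y = c |w|^\<alpha>, the
  inequality (y / n)^n \<le> exp y dominates w^4 when |w| > 1, with \<open>D\<close> undoing the
  factor (c / n)^n; the summand 4 covers |w| \<le> 1.\<close>

lemma exp_neg_powr_le_rational:
  fixes c \<alpha> :: real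
  assumes "0 < c" "0 < \<alpha>"
  shows "\<exists>K. \<forall>w. exp (- (c * \<bar>w\<bar> powr \<alpha>)) \<le> K / (1 + w\<^sup>2)\<^sup>2"
proof -
  obtain n where n: "4 / \<alpha> < real n" using reals_Archimedean2 by blast
  then have "n > 0" "4 \<le> \<alpha> * real n"
    using assms by (auto simp: field_simps intro: Nat.gr0I)
  define D where "D = (real n / c) ^ n"
  have "D > 0" using assms \<open>n > 0\<close> by (simp add: D_def)
  have "exp (- (c * \<bar>w\<bar> powr \<alpha>)) \<le> (4 + 4 * D) / (1 + w\<^sup>2)\<^sup>2" for w
  proof -
    have pos: "0 < 1 + w\<^sup>2" by (simp add: add_pos_nonneg)
    have "(1 + w\<^sup>2)\<^sup>2 * exp (- (c * \<bar>w\<bar> powr \<alpha>)) \<le> 4 + 4 * D"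
    proof (cases "\<bar>w\<bar> \<le> 1")
      case True
      then have "w\<^sup>2 \<le> 1" by (simp add: abs_square_le_1)
      then have "(1 + w\<^sup>2)\<^sup>2 \<le> 2\<^sup>2" by (intro power_mono) auto
      then have "(1 + w\<^sup>2)\<^sup>2 * exp (- (c * \<bar>w\<bar> powr \<alpha>)) \<le> 4 * 1"
        using assms by (intro mult_mono) auto
      then show ?thesis using \<open>D > 0\<close> by simp
    next
      case False
      then have w: "1 < \<bar>w\<bar>" by simp
      have "1 \<le> w\<^sup>2" using w one_le_power[of "\<bar>w\<bar>" 2] by simp
      then have "(1 + w\<^sup>2)\<^sup>2 \<le> (2 * w\<^sup>2)\<^sup>2" by (intro power_mono) auto
      also have "\<dots> = 4 * \<bar>w\<bar> powr 4"
        using w by (simp add: power_mult_distrib powr_numeral flip: power_mult)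
      also have "\<bar>w\<bar> powr 4 \<le> \<bar>w\<bar> powr (\<alpha> * real n)"
        using w \<open>4 \<le> \<alpha> * real n\<close> by (intro powr_mono) auto
      also have "\<bar>w\<bar> powr (\<alpha> * real n) = (\<bar>w\<bar> powr \<alpha>) ^ n"
        using w by (simp add: powr_powr[symmetric] powr_realpow)
      finally have 1: "(1 + w\<^sup>2)\<^sup>2 \<le> 4 * (\<bar>w\<bar> powr \<alpha>) ^ n" by simp
      let ?y = "c * \<bar>w\<bar> powr \<alpha>"
      have "?y > 0" using assms w by simp
      have "(?y / real n) ^ n \<le> (1 + ?y / real n) ^ n"
        using \<open>?y > 0\<close> by (intro power_mono) auto
      also have "\<dots> \<le> exp ?y"
        using exp_ge_one_plus_x_over_n_power_n[of n ?y] \<open>?y > 0\<close> \<open>n > 0\<close> by simp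
      finally have "D * (?y / real n) ^ n \<le> D * exp ?y" using \<open>D > 0\<close> by simp
      moreover have "D * (?y / real n) ^ n = (\<bar>w\<bar> powr \<alpha>) ^ n"
        using assms \<open>n > 0\<close> by (simp add: D_def flip: power_mult_distrib)
      ultimately have "(\<bar>w\<bar> powr \<alpha>) ^ n \<le> D * exp ?y" by simp
      with 1 have "(1 + w\<^sup>2)\<^sup>2 * exp (- ?y) \<le> 4 * (D * exp ?y) * exp (- ?y)"
        by (intro mult_right_mono) auto
      also have "\<dots> = 4 * D" by (simp add: exp_minus)
      finally show ?thesis by simp
    qed
    then show ?thesis using pos by (simp add: field_simps)
  qed
  then show ?thesis by blast
qed

section \<open>Linear fractional stable motion\<close>

text \<open>The process is constrained at times t \<ge> 0 only. Freezing it at its initial value for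
  negative times makes it jointly measurable on the whole line.\<close>

lemma measurable_process_extend:
  assumes "measurable_process M X"
  shows "(\<lambda>(t, w). X (max 0 t) w) \<in> borel_measurable (borel \<Otimes>\<^sub>M M)"
proof -
  have "(\<lambda>x. (max 0 (fst x), snd x)) \<in> (borel \<Otimes>\<^sub>M M) \<rightarrow>\<^sub>M (restrict_space borel {0::real..} \<Otimes>\<^sub>M M)"
    by (intro measurable_Pair measurable_restrict_space2) auto
  from measurable_compose[OF this assms[unfolded measurable_process_def]] show ?thesis
    by (simp add: case_prod_beta')
qed

text \<open>Both cases of the definition take one form: for H = 1 / \<alpha> the exponent is 0, so
  the indicator of (0, t] is a power law with A = 1, and otherwise A = |a|. The kernel at negative
  times is left open, since only its values after some s \<ge> 0 are estimated.\<close>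

lemma linear_fractional_stable_motion_kernel:
  assumes "prob_space M" "0 < \<alpha>" and lfsm: "linear_fractional_stable_motion M \<alpha> H \<Lambda>"
  obtains \<beta> Z A where "stable_levy_process M \<alpha> \<beta> Z" "0 < A"
    and "\<And>t. 0 \<le> t \<Longrightarrow> \<exists>k. is_stable_integral M \<alpha> Z k (\<Lambda> t) \<and> (\<forall>v>t. k v = 0) \<and>
      (\<forall>v. 0 < v \<longrightarrow> v < t \<longrightarrow> \<bar>k v\<bar> = A * (t - v) powr (H - 1 / \<alpha>))"
proof -
  interpret prob_space M by fact
  let ?g = "\<lambda>t u. indicator {..<0} u * ((t - u) powr (H - 1 / \<alpha>) - (- u) powr (H - 1 / \<alpha>)) :: real"
    and ?h = "\<lambda>t u. indicator {0<..<t} u * (t - u) powr (H - 1 / \<alpha>) :: real"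
  obtain \<beta> Z where meas: "measurable_process M \<Lambda>" and Z: "stable_levy_motion M \<alpha> \<beta> Z"
    and cases: "if H = 1 / \<alpha>
         then \<forall>t\<ge>0. AE w in M. \<Lambda> t w = Z t w
         else \<exists>a. a \<noteq> 0 \<and>
           (\<forall>t\<ge>0. \<exists>I J.
              is_stable_integral M \<alpha> Z (?g t) I \<and> is_stable_integral M \<alpha> Z (?h t) J \<and>
              (AE w in M. \<Lambda> t w = a * I w + a * J w))"
    using lfsm unfolding linear_fractional_stable_motion_def by blast
  interpret stable_levy_process M \<alpha> \<beta> Z by unfold_locales (rule Z)
  have meas_\<Lambda>: "\<Lambda> t \<in> borel_measurable M" if "0 \<le> t" for t
    using measurable_compose[OF measurable_Pair1' measurable_process_extend[OF meas], of t] that by (simp add: max_def)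
  show ?thesis
  proof (cases "H = 1 / \<alpha>")
    case True
    show ?thesis
    proof (rule that[OF stable_levy_process_axioms zero_less_one])
      fix t :: real assume t: "0 \<le> t"
      have "is_stable_integral M \<alpha> Z (indicator {0<..t}) (\<Lambda> t)"
        using cases True t by (intro is_stable_integral_AE_cong[OF is_stable_integral_indicator[OF t] meas_\<Lambda>[OF t]]) auto
      then show "\<exists>k. is_stable_integral M \<alpha> Z k (\<Lambda> t) \<and> (\<forall>v>t. k v = 0) \<and>
          (\<forall>v. 0 < v \<longrightarrow> v < t \<longrightarrow> \<bar>k v\<bar> = 1 * (t - v) powr (H - 1 / \<alpha>))"
        using True by (intro exI[of _ "indicator {0<..t}"]) auto
    qed
  next
    case False
    then obtain a where a: "a \<noteq> 0" and IJ: "\<And>t. 0 \<le> t \<Longrightarrow> \<exists>I J.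
              is_stable_integral M \<alpha> Z (?g t) I \<and> is_stable_integral M \<alpha> Z (?h t) J \<and>
              (AE w in M. \<Lambda> t w = a * I w + a * J w)"
      using cases by auto
    show ?thesis
    proof (rule that[OF stable_levy_process_axioms])
      show "0 < \<bar>a\<bar>" using a by simp
      fix t :: real assume t: "0 \<le> t"
      obtain I J where "is_stable_integral M \<alpha> Z (?g t) I" "is_stable_integral M \<alpha> Z (?h t) J"
        "AE w in M. \<Lambda> t w = a * I w + a * J w"
        using IJ[OF t] by blast
      then have "is_stable_integral M \<alpha> Z (\<lambda>u. a * ?g t u + a * ?h t u) (\<Lambda> t)"
        by (intro is_stable_integral_AE_cong[OF is_stable_integral_linear[OF _ _ a] meas_\<Lambda>[OF t]])
      moreover have "\<forall>v>t. a * ?g t v + a * ?h t v = 0" using t by auto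
      moreover have "\<forall>v. 0 < v \<longrightarrow> v < t \<longrightarrow> \<bar>a * ?g t v + a * ?h t v\<bar> = \<bar>a\<bar> * (t - v) powr (H - 1 / \<alpha>)"
        by (auto simp: abs_mult)
      ultimately show "\<exists>k. is_stable_integral M \<alpha> Z k (\<Lambda> t) \<and> (\<forall>v>t. k v = 0) \<and>
          (\<forall>v. 0 < v \<longrightarrow> v < t \<longrightarrow> \<bar>k v\<bar> = \<bar>a\<bar> * (t - v) powr (H - 1 / \<alpha>))"
        by blast
    qed
  qed
qed

theorem lfsm_locally_nondeterministic:
  assumes "prob_space M" "0 < \<alpha>" "0 < H" "H < 1" and lfsm: "linear_fractional_stable_motion M \<alpha> H \<Lambda>"
  shows "\<exists>K. locally_nondeterministic_process M (\<lambda>s. \<Lambda> (max 0 s)) H K"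
proof -
  obtain \<beta> Z A where Z: "stable_levy_process M \<alpha> \<beta> Z" and "0 < A"
    and kernel: "\<And>t. 0 \<le> t \<Longrightarrow> \<exists>k. is_stable_integral M \<alpha> Z k (\<Lambda> t) \<and> (\<forall>v>t. k v = 0) \<and>
      (\<forall>v. 0 < v \<longrightarrow> v < t \<longrightarrow> \<bar>k v\<bar> = A * (t - v) powr (H - 1 / \<alpha>))"
    by (rule linear_fractional_stable_motion_kernel[OF assms(1,2) lfsm]) blast
  interpret stable_levy_process M \<alpha> \<beta> Z by fact
  \<comment> \<open>The energy constant A^\<alpha> / (\<alpha> H), divided by the 2^\<alpha> lost in
    approximating by step functions.\<close>
  define c where "c = A powr \<alpha> / (\<alpha> * H * 2 powr \<alpha>)"
  have "0 < c" using assms \<open>0 < A\<close> by (simp add: c_def)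
  then obtain K where K: "\<And>w. exp (- (c * \<bar>w\<bar> powr \<alpha>)) \<le> K / (1 + w\<^sup>2)\<^sup>2"
    using exp_neg_powr_le_rational[OF _ assms(2)] by blast
  have "locally_nondeterministic_process M (\<lambda>s. \<Lambda> (max 0 s)) H K"
  proof
    show "(\<lambda>(s, w). \<Lambda> (max 0 s) w) \<in> borel_measurable (borel \<Otimes>\<^sub>M M)"
      using lfsm by (intro measurable_process_extend) (simp add: linear_fractional_stable_motion_def)
    fix s u \<xi> :: real and B :: "real set"
    assume su: "0 \<le> s" "s < u" and B: "B \<in> sets borel"
    obtain k where k: "is_stable_integral M \<alpha> Z k (\<Lambda> s)" "\<And>v. s < v \<Longrightarrow> k v = 0"
      using kernel[OF su(1)] by blast
    obtain h where h: "is_stable_integral M \<alpha> Z h (\<Lambda> u)"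
      "\<And>v. 0 < v \<Longrightarrow> v < u \<Longrightarrow> \<bar>h v\<bar> = A * (u - v) powr (H - 1 / \<alpha>)"
      using kernel[of u] su by fastforce
    let ?e = "A powr \<alpha> * ((u - s) powr (\<alpha> * H) / (\<alpha> * H))"
    have "cmod (CLINT w|M. indicator B (\<Lambda> s w) *\<^sub>R iexp (\<xi> * \<Lambda> u w)) \<le>
        measure M {w \<in> space M. \<Lambda> s w \<in> B} * exp (- (\<bar>\<xi>\<bar> powr \<alpha> * (?e / 2 powr \<alpha>)))"
    proof (rule conditional_char_le_Borel[OF k(1) h(1) k(2) _ _ B])
      show "ennreal ?e \<le> (\<integral>\<^sup>+v. ennreal (\<bar>h v\<bar> powr \<alpha>) * indicator {s<..} v \<partial>lborel)"
        using su \<open>0 < A\<close> assms by (intro power_law_energy[of \<alpha> H s u]) (auto intro: h(2))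
      show "0 \<le> ?e" using assms by simp
    qed auto
    also have "\<bar>\<xi>\<bar> powr \<alpha> * (?e / 2 powr \<alpha>) = c * \<bar>(u - s) powr H * \<xi>\<bar> powr \<alpha>"
      using su by (simp add: c_def abs_mult powr_mult powr_powr mult.commute mult.left_commute)
    also have "measure M {w \<in> space M. \<Lambda> s w \<in> B} * exp (- (c * \<bar>(u - s) powr H * \<xi>\<bar> powr \<alpha>)) \<le>
        measure M {w \<in> space M. \<Lambda> s w \<in> B} * (K / (1 + ((u - s) powr H * \<xi>)\<^sup>2)\<^sup>2)"
      by (intro mult_left_mono K) simp
    finally show "cmod (CLINT w|M. indicator B (\<Lambda> (max 0 s) w) *\<^sub>R iexp (\<xi> * \<Lambda> (max 0 u) w)) \<le>
        measure M {w \<in> space M. \<Lambda> (max 0 s) w \<in> B} * (K / (1 + ((u - s) powr H * \<xi>)\<^sup>2)\<^sup>2)"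
      using su by (simp add: max_def)
  qed (use assms in auto)
  then show ?thesis ..
qed

section \<open>Lebesgue measurable test functions and completions\<close>

text \<open>Changing a function on a null set preserves measurability for the completed
  sigma-algebra. This serves both Lebesgue measure in time and the completed probability
  space.\<close>

lemma borel_measurable_completion_AE_cong:
  fixes f g :: "'a \<Rightarrow> 'b::topological_space"
  assumes "g \<in> borel_measurable (completion M)" and AE: "AE x in M. f x = g x"
  shows "f \<in> borel_measurable (completion M)"
proof (rule measurableI)
  fix B :: "'b set" assume "B \<in> sets borel"
  then have sets: "g -` B \<inter> space M \<in> sets (completion M)"
    using measurable_sets[OF assms(1)] by simp
  have AE_iff: "AE x in completion M. x \<in> g -` B \<inter> space M \<longleftrightarrow> x \<in> f -` B \<inter> space M"
    using AE_completion[OF AE] by eventually_elim simp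
  have "f -` B \<inter> space M \<in> sets (completion M)"
    by (rule completion.in_sets_AE[OF AE_iff sets]) simp
  then show "f -` B \<inter> space (completion M) \<in> sets (completion M)" by simp
qed simp

lemma square_integrable_diff:
  assumes "square_integrable M X" "square_integrable M Y"
  shows "integrable M (\<lambda>w. (X w - Y w)\<^sup>2)"
proof (rule Bochner_Integration.integrable_bound)
  have [measurable]: "X \<in> borel_measurable M" "Y \<in> borel_measurable M"
    using assms by (auto simp: square_integrable_def)
  show "integrable M (\<lambda>w. 2 * (X w)\<^sup>2 + 2 * (Y w)\<^sup>2)"
    using assms by (simp add: square_integrable_def)
  show "(\<lambda>w. (X w - Y w)\<^sup>2) \<in> borel_measurable M" by measurable
  have "(x - y)\<^sup>2 \<le> 2 * x\<^sup>2 + 2 * y\<^sup>2" for x y :: real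
    using sum_squares_bound[of x "-y"] by (simp add: power2_diff)
  then show "AE w in M. norm ((X w - Y w)\<^sup>2) \<le> norm (2 * (X w)\<^sup>2 + 2 * (Y w)\<^sup>2)"
    by (intro AE_I2) simp
qed

text \<open>The second-moment bound for the indicator of \<open>N\<close> has right side 0. Hence
  changing a test function on a Lebesgue null set affects its time integral only on a null
  event.\<close>

lemma (in locally_nondeterministic_process) AE_occupation_null_set:
  assumes "N \<in> null_sets lborel"
  shows "AE w in M. AE s in lborel. s \<in> {0..t} \<longrightarrow> Y s w \<notin> N"
proof -
  have [measurable]: "N \<in> sets borel" using assms by auto
  have "(\<integral>\<^sup>+w. (\<integral>\<^sup>+s. indicator N (Y s w) * indicator {0..t} s \<partial>lborel)\<^sup>2 \<partial>M) = 0"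
    using second_moment_occupation_le[of "indicator N" t] assms by (simp add: null_setsD1)
  then have zero: "AE w in M. (\<integral>\<^sup>+s. indicator N (Y s w) * indicator {0..t} s \<partial>lborel)\<^sup>2 = 0"
    by (subst (asm) nn_integral_0_iff_AE) auto
  show ?thesis
  proof (rule AE_mp[OF zero], rule AE_I2, rule impI)
    fix w assume [measurable]: "w \<in> space M" and "(\<integral>\<^sup>+s. indicator N (Y s w) * indicator {0..t} s \<partial>lborel)\<^sup>2 = 0"
    then have "AE s in lborel. indicator N (Y s w) * indicator {0..t} s = (0 :: ennreal)"
      by (subst (asm) power_eq_0_iff, subst (asm) nn_integral_0_iff_AE) auto
    then show "AE s in lborel. s \<in> {0..t} \<longrightarrow> Y s w \<notin> N"
      by eventually_elim (auto simp: indicator_def split: if_splits)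
  qed
qed

lemma AE_lborel_real_affine:
  fixes b c :: real
  assumes "AE y in lborel. P y" "c \<noteq> 0"
  shows "AE y in lborel. P (b + c * y)"
proof -
  obtain N where N: "{y. \<not> P y} \<subseteq> N" "emeasure lborel N = 0" "N \<in> sets lborel"
    using assms(1) by (auto elim!: AE_E)
  have [measurable]: "N \<in> sets borel" using N(3) by simp
  have "ennreal \<bar>c\<bar> * (\<integral>\<^sup>+y. indicator N (b + c * y) \<partial>lborel) = (\<integral>\<^sup>+y. indicator N y \<partial>lborel)"
    using \<open>c \<noteq> 0\<close> by (intro nn_integral_real_affine[symmetric]) auto
  also have "\<dots> = 0" using N by simp
  finally have "AE y in lborel. indicator N (b + c * y) = (0 :: ennreal)"
    using \<open>c \<noteq> 0\<close> by (subst (asm) mult_eq_0_iff) (auto simp: nn_integral_0_iff_AE)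
  then show ?thesis
    by eventually_elim (use N(1) in \<open>auto simp: indicator_def split: if_splits\<close>)
qed

text \<open>The substitution \<open>s = \<kappa> r\<close>, together with the replacement of a Lebesgue measurable \<open>f\<close>
  by a Borel version.\<close>

lemma (in locally_nondeterministic_process) AE_rescaled_integral:
  assumes [measurable]: "g \<in> borel_measurable borel" and fg: "AE y in lborel. f y = g y" and "0 < \<kappa>"
  shows "AE w in M. 1 / \<kappa> powr (1 - H) * (LINT s:{0..\<kappa> * t}|lebesgue. f (\<kappa> powr H * (Y (s / \<kappa>) w - x))) =
    occupation t (scaled_test H x \<kappa> g) w"
proof -
  obtain N where N: "{y. f y \<noteq> g y} \<subseteq> N" "emeasure lborel N = 0" "N \<in> sets lborel"
    using fg by (auto elim!: AE_E)
  have [measurable]: "N \<in> sets borel" using N(3) by simp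
  \<comment> \<open>The exceptional set of the test function, pulled back to the values of
    \<open>Y\<close>; an affine preimage of a null set is null.\<close>
  define N' where "N' = {y. \<kappa> powr H * (y - x) \<in> N}"
  have [measurable]: "N' \<in> sets borel" unfolding N'_def by measurable
  have "AE y in lborel. y \<notin> N" using N by (intro AE_not_in) auto
  from AE_lborel_real_affine[OF this, of "\<kappa> powr H" "- (\<kappa> powr H * x)"]
  have "AE y in lborel. y \<notin> N'"
    using \<open>0 < \<kappa>\<close> by (simp add: N'_def right_diff_distrib)
  then have "N' \<in> null_sets lborel"
    by (subst (asm) AE_iff_null_sets[symmetric]) auto
  from AE_occupation_null_set[OF this, of t] show ?thesis
  proof (rule AE_mp, intro AE_I2 impI)
    fix w assume [measurable]: "w \<in> space M" and AE: "AE s in lborel. s \<in> {0..t} \<longrightarrow> Y s w \<notin> N'"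
    let ?F = "\<lambda>(f :: real \<Rightarrow> real) s. indicator {0..\<kappa> * t} s *\<^sub>R f (\<kappa> powr H * (Y (s / \<kappa>) w - x))"
    have G [measurable]: "?F g \<in> borel_measurable borel" by measurable
    have "AE s in lborel. 0 + 1 / \<kappa> * s \<in> {0..t} \<longrightarrow> Y (0 + 1 / \<kappa> * s) w \<notin> N'"
      using \<open>0 < \<kappa>\<close> by (intro AE_lborel_real_affine[OF AE]) auto
    then have eq: "AE s in lborel. ?F f s = ?F g s"
    proof eventually_elim
      case (elim s)
      then have "s \<in> {0..\<kappa> * t} \<Longrightarrow> \<kappa> powr H * (Y (s / \<kappa>) w - x) \<notin> N"
        using \<open>0 < \<kappa>\<close> by (auto simp: N'_def field_simps)
      then show ?case using N(1) by (cases "s \<in> {0..\<kappa> * t}") auto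
    qed
    have G': "?F g \<in> borel_measurable lebesgue"
      by (rule measurable_completion) simp
    \<comment> \<open>The integrand with \<open>f\<close> need not be Borel in time, so the integral
      is over completed Lebesgue measure until \<open>g\<close> has replaced
      \<open>f\<close>.\<close>
    have "(LINT s:{0..\<kappa> * t}|lebesgue. f (\<kappa> powr H * (Y (s / \<kappa>) w - x))) = (LINT s|lebesgue. ?F g s)"
      unfolding set_lebesgue_integral_def
      using eq by (intro integral_cong_AE borel_measurable_completion_AE_cong[OF G'] G') (auto simp: AE_completion_iff)
    also have "\<dots> = (LINT s|lborel. ?F g s)"
      by (rule integral_completion) simp
    also have "\<dots> = \<kappa> * (LINT s|lborel. ?F g (0 + \<kappa> * s))"
      using lborel_integral_real_affine[of \<kappa> "?F g" 0] \<open>0 < \<kappa>\<close> by simp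
    also have "(\<lambda>s. ?F g (0 + \<kappa> * s)) = (\<lambda>s. indicator {0..t} s *\<^sub>R g (\<kappa> powr H * (Y s w - x)))"
      using \<open>0 < \<kappa>\<close> by (auto simp: fun_eq_iff indicator_def zero_le_mult_iff)
    \<comment> \<open>The factor \<kappa> of the substitution against 1 / \<kappa>^(1 - H) leaves
      \<kappa>^H, the prefactor in \<open>scaled_test\<close>.\<close>
    finally have "1 / \<kappa> powr (1 - H) * (LINT s:{0..\<kappa> * t}|lebesgue. f (\<kappa> powr H * (Y (s / \<kappa>) w - x))) =
        \<kappa> powr H * (LINT s|lborel. indicator {0..t} s *\<^sub>R g (\<kappa> powr H * (Y s w - x)))"
      using \<open>0 < \<kappa>\<close> by (simp add: powr_diff)
    also have "\<dots> = occupation t (scaled_test H x \<kappa> g) w"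
      by (simp add: occupation_def set_lebesgue_integral_def scaled_test_def mult.left_commute)
    finally show "1 / \<kappa> powr (1 - H) * (LINT s:{0..\<kappa> * t}|lebesgue. f (\<kappa> powr H * (Y (s / \<kappa>) w - x))) =
        occupation t (scaled_test H x \<kappa> g) w" .
  qed
qed

text \<open>Square integrability of the averages and of \<open>L\<close> lets the Bochner integrals
  of the mean-square limit be read as nonnegative integrals; on [0, t] the freezing at negative
  times is invisible.\<close>

lemma process_with_local_timeI:
  assumes "locally_nondeterministic_process M (\<lambda>s. \<Lambda> (max 0 s)) H K"
    and L2: "L2_version M \<Lambda> L" and "0 \<le> t"
  shows "process_with_local_time M (\<lambda>s. \<Lambda> (max 0 s)) H K t x (L t x)"
proof -
  interpret locally_nondeterministic_process M "\<lambda>s. \<Lambda> (max 0 s)" H K by fact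
  let ?X = "\<lambda>\<eta> w. 1 / \<eta> * (LINT s:{0..t}|lborel. indicator {x..<x + \<eta>} (\<Lambda> s w))"
  have occ: "occupation t (indicator {x..<x + \<eta>}) w = (LINT s:{0..t}|lborel. indicator {x..<x + \<eta>} (\<Lambda> s w))" for \<eta> w
    unfolding occupation_def by (intro set_lebesgue_integral_cong) (auto simp: max_def)
  have L: "square_integrable M (L t x)" and X: "\<forall>\<^sub>F \<eta> in at_right 0. square_integrable M (?X \<eta>)"
    and lim: "((\<lambda>\<eta>. \<integral>w. (?X \<eta> w - L t x w)\<^sup>2 \<partial>M) \<longlongrightarrow> 0) (at_right 0)"
    using L2 \<open>0 \<le> t\<close> unfolding L2_version_def tendsto_L2_def by auto
  show ?thesis
  proof
    show "0 \<le> t" by fact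
    show "L t x \<in> borel_measurable M" using L by (simp add: square_integrable_def)
    show "(\<integral>\<^sup>+w. ennreal ((L t x w)\<^sup>2) \<partial>M) < \<infinity>"
      using L by (subst nn_integral_eq_integral) (auto simp: square_integrable_def)
    fix \<delta> :: real assume "\<delta> > 0"
    then have "\<forall>\<^sub>F \<eta> in at_right 0. (\<integral>w. (?X \<eta> w - L t x w)\<^sup>2 \<partial>M) < \<delta>"
      by (intro order_tendstoD(2)[OF lim])
    with X show "\<forall>\<^sub>F \<eta> in at_right 0.
      (\<integral>\<^sup>+w. ennreal ((1 / \<eta> * occupation t (indicator {x..<x + \<eta>}) w - L t x w)\<^sup>2) \<partial>M) \<le> ennreal \<delta>"
    proof eventually_elim
      case (elim \<eta>)
      have "(\<integral>\<^sup>+w. ennreal ((?X \<eta> w - L t x w)\<^sup>2) \<partial>M) = ennreal (\<integral>w. (?X \<eta> w - L t x w)\<^sup>2 \<partial>M)"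
        by (intro nn_integral_eq_integral square_integrable_diff elim(1) L) auto
      also have "\<dots> \<le> ennreal \<delta>" using elim(2) by (intro ennreal_leI) simp
      finally show ?case by (simp only: occ)
    qed
  qed
qed

theorem theorem5:
  fixes M :: "'w measure" and \<alpha> H :: real
    and \<Lambda> :: "real \<Rightarrow> 'w \<Rightarrow> real" and L :: "real \<Rightarrow> real \<Rightarrow> 'w \<Rightarrow> real"
    and f :: "real \<Rightarrow> real"
  assumes "prob_space M"
    and "0 < \<alpha>" "\<alpha> \<le> 2" "0 < H" "H < 1"
    and "linear_fractional_stable_motion M \<alpha> H \<Lambda>"
    and "local_time M \<Lambda> L" "L2_version M \<Lambda> L"
    and "integrable lebesgue f" "integrable lebesgue (\<lambda>y. (f y)\<^sup>2)"
  shows "\<forall>t\<ge>0. \<forall>x. tendsto_L2 (completion M)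
           (\<lambda>\<kappa> \<omega>. 1 / \<kappa> powr (1 - H) *
              (LINT s:{0..\<kappa> * t}|lebesgue. f (\<kappa> powr H * (\<Lambda> (s / \<kappa>) \<omega> - x))))
           (\<lambda>\<omega>. (LINT y|lebesgue. f y) * L t x \<omega>)
           at_top"
proof (intro allI impI)
  fix t x :: real assume "0 \<le> t"
  obtain K where K: "locally_nondeterministic_process M (\<lambda>s. \<Lambda> (max 0 s)) H K"
    using lfsm_locally_nondeterministic[OF assms(1,2,4,5,6)] by blast
  interpret process_with_local_time M "\<lambda>s. \<Lambda> (max 0 s)" H K t x "L t x"
    by (rule process_with_local_timeI[OF K assms(8) \<open>0 \<le> t\<close>])
  \<comment> \<open>A Borel version of \<open>f\<close> has measurable compositions with the
    process, which the occupation estimates require.\<close>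
  have "f \<in> borel_measurable (completion lborel)"
    using borel_measurable_integrable[OF assms(9)] by simp
  then obtain g where g [measurable]: "g \<in> borel_measurable lborel" and fg: "AE y in lborel. f y = g y"
    using completion_ex_borel_measurable_real by blast
  have [measurable]: "g \<in> borel_measurable borel" using g by simp
  have fg': "AE y in lebesgue. f y = g y" using fg by (rule AE_completion)
  have g': "g \<in> borel_measurable lebesgue" using g by (rule measurable_completion)
  have "integrable lebesgue g"
    using integrable_cong_AE[OF borel_measurable_integrable[OF assms(9)] g' fg'] assms(9) by simp
  then have int_g: "integrable lborel g" using integrable_completion[OF g] by simp
  have integral_eq: "(LINT y|lebesgue. f y) = (LINT y|lborel. g y)"
    using integral_cong_AE[OF borel_measurable_integrable[OF assms(9)] g' fg'] integral_completion[OF g] by simp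
  let ?X = "\<lambda>\<kappa> w. 1 / \<kappa> powr (1 - H) * (LINT s:{0..\<kappa> * t}|lebesgue. f (\<kappa> powr H * (\<Lambda> (s / \<kappa>) w - x)))"
  let ?O = "\<lambda>\<kappa>. occupation t (scaled_test H x \<kappa> g)"
  let ?c = "LINT y|lebesgue. f y"
  \<comment> \<open>The exceptional event may depend on \<kappa>; mean-square convergence looks at
    one \<kappa> at a time.\<close>
  have AE_X: "AE w in M. ?X \<kappa> w = ?O \<kappa> w" if "0 < \<kappa>" for \<kappa>
  proof -
    have eq: "?X \<kappa> w = 1 / \<kappa> powr (1 - H) * (LINT s:{0..\<kappa> * t}|lebesgue. f (\<kappa> powr H * (\<Lambda> (max 0 (s / \<kappa>)) w - x)))" for w
      using that by (intro arg_cong[where f="\<lambda>z. 1 / \<kappa> powr (1 - H) * z"] set_lebesgue_integral_cong) (auto simp: max_def)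
    show ?thesis
      unfolding eq by (rule AE_rescaled_integral[OF _ fg that]) simp
  qed
  have X_measurable: "?X \<kappa> \<in> borel_measurable (completion M)" if "0 < \<kappa>" for \<kappa>
    by (rule borel_measurable_completion_AE_cong[OF _ AE_X[OF that]]) (simp add: measurable_completion)
  have O_square: "square_integrable M (?O \<kappa>)" if "0 < \<kappa>" for \<kappa>
    unfolding square_integrable_def
  proof (intro conjI integrableI_bounded)
    show "(\<integral>\<^sup>+w. ennreal (norm ((?O \<kappa> w)\<^sup>2)) \<partial>M) < \<infinity>"
      using second_moment_le[OF integrable_scaled_test(1)[OF int_g that] t_nonneg, of H x] by (auto simp: less_top[symmetric] top_unique)
  qed measurable
  have L_square: "square_integrable M (\<lambda>w. ?c * L t x w)"
    using L_finite by (auto simp: square_integrable_def power_mult_distrib intro!: integrableI_bounded integrable_mult_right)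
  have square_completion: "square_integrable (completion M) Z \<longleftrightarrow> square_integrable M Z" if "Z \<in> borel_measurable M" for Z
    using that by (auto simp: square_integrable_def integrable_completion measurable_completion)
  have X_square: "square_integrable (completion M) (?X \<kappa>)" if "0 < \<kappa>" for \<kappa>
  proof -
    have "integrable (completion M) (\<lambda>w. (?X \<kappa> w)\<^sup>2) \<longleftrightarrow> integrable (completion M) (\<lambda>w. (?O \<kappa> w)\<^sup>2)"
      using AE_X[OF that] X_measurable[OF that]
      by (intro integrable_cong_AE) (auto simp: AE_completion_iff measurable_completion elim: eventually_mono)
    then show ?thesis
      using O_square[OF that] square_completion[of "?O \<kappa>"] X_measurable[OF that] by (simp add: square_integrable_def)
  qed
  \<comment> \<open>Neither the null event nor the completion changes the integral, so the
    mean-square error is exactly \<open>occupation_error\<close>.\<close>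
  have error_eq: "ennreal (\<integral>w. (?X \<kappa> w - ?c * L t x w)\<^sup>2 \<partial>completion M) = occupation_error \<kappa> g" if "0 < \<kappa>" for \<kappa>
  proof -
    have "(\<integral>w. (?X \<kappa> w - ?c * L t x w)\<^sup>2 \<partial>completion M) = (\<integral>w. (?O \<kappa> w - ?c * L t x w)\<^sup>2 \<partial>completion M)"
      using AE_X[OF that] X_measurable[OF that]
      by (intro integral_cong_AE borel_measurable_power borel_measurable_diff)
        (auto simp: AE_completion_iff measurable_completion elim: eventually_mono)
    also have "\<dots> = (\<integral>w. (?O \<kappa> w - ?c * L t x w)\<^sup>2 \<partial>M)"
      by (rule integral_completion) measurable
    finally show ?thesis
      unfolding occupation_error_def integral_eq[symmetric]
      by (simp add: nn_integral_eq_integral square_integrable_diff[OF O_square[OF that] L_square])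
  qed
  show "tendsto_L2 (completion M) ?X (\<lambda>w. ?c * L t x w) at_top"
    unfolding tendsto_L2_def
  proof (intro conjI)
    show "square_integrable (completion M) (\<lambda>w. ?c * L t x w)"
      using L_square by (subst square_completion) measurable
    show "\<forall>\<^sub>F \<kappa> in at_top. square_integrable (completion M) (?X \<kappa>)"
      using eventually_gt_at_top[of 0] by eventually_elim (rule X_square)
    show "((\<lambda>\<kappa>. \<integral>w. (?X \<kappa> w - ?c * L t x w)\<^sup>2 \<partial>completion M) \<longlongrightarrow> 0) at_top"
    proof (rule tendstoI)
      fix e :: real assume "e > 0"
      then have "\<forall>\<^sub>F \<kappa> in at_top. occupation_error \<kappa> g \<le> ennreal (e / 2)"
        using occupation_converges_integrable[OF int_g] by (simp add: occupation_converges_def)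
      then show "\<forall>\<^sub>F \<kappa> in at_top. dist (\<integral>w. (?X \<kappa> w - ?c * L t x w)\<^sup>2 \<partial>completion M) 0 < e"
        using eventually_gt_at_top[of 0]
      proof eventually_elim
        case (elim \<kappa>)
        then have "(\<integral>w. (?X \<kappa> w - ?c * L t x w)\<^sup>2 \<partial>completion M) \<le> e / 2"
          using \<open>e > 0\<close> by (simp only: error_eq[symmetric] ennreal_le_iff half_gt_zero less_imp_le)
        then show ?case using \<open>e > 0\<close> by simp
      qed
    qed
  qed
qed

end
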